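(* Let $1<p<\infty$, let $u,v$ be measurable functions on the tree $\Gamma$ with $v\in L^p(\Gamma)$ and $u\in L^{p'}(K)$ for every $K\subset\subset\Gamma$, let $a\in\Gamma$ and $T=T_a$. Let $q\in(p,\infty)$. Then, for some positive constant $c$, $$\|\{a_n(T)\}\|_{l^q(\mathbf{N})}\le c\,\|\{\sigma_k\}\|_{l^q(\mathbf{Z})}.$$
   Context: A tree $\Gamma$ is a connected graph without loops or cycles whose edges are non-degenerate closed line segments with the vertices as end-points; every vertex has finite degree. For $x,y\in\Gamma$, $(x,y)$ denotes the unique polygonal path in $\Gamma$ joining $x$ and $y$; the distance between $x$ and $y$ is the length of this path, $\Gamma$ carries the resulting metric topology and the natural one-dimensional Lebesgue measure. $\int_a^x g(t)\,dt$ denotes the (unsigned) integral of $g$ over the points of the path $(a,x)$. $K\subset\subset\Gamma$ means that the closure of $K$ is compact. $p'$ is the conjugate exponent of $p$. $T_af(x)=v(x)\int_a^x f(t)u(t)\,dt$. The $m$-th approximation number ($m\in\mathbf N$) of $T:L^p(\Gamma)\to L^p(\Gamma)$ is $a_m(T)=\inf\|T-F\,|\,L^p(\Gamma)\to L^p(\Gamma)\|$, the infimum over bounded linear $F:L^p(\Gamma)\to L^p(\Gamma)$ of rank less than $m$. $\mu(K)=\int_K|v|^p\,dt$; $U(x)=\int_a^x|u(t)|^{p'}dt$. $Z_k$ is the closure of $\{x\in\Gamma:2^{kp'/p}\le U(x)<2^{(k+1)p'/p}\}$, where $k$ may be any integer if $u\in L^{p'}_{loc}(\Gamma)\setminus L^{p'}(\Gamma)$,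 while if $u\in L^{p'}(\Gamma)$ only $k$ with $2^k\le\|u\|_{p',\Gamma}^p$ are used; these $k$ are called admissible. For admissible $k$, $\sigma_k^p=2^k\mu(Z_k)$; for non-admissible $k$, $\sigma_k=0$. *)

theory Defs
  imports "HOL-Analysis.Analysis" "Graph_Theory.Digraph_Component"
begin

section \<open>Trees\<close>

text \<open>
  The edge \<open>e\<close> is the segment \<open>param \<Gamma> e ` {0..len \<Gamma> e}\<close>, parametrised by arc length.
  Each edge occurs once in \<open>edges \<Gamma>\<close>; the direction of \<open>param \<Gamma> e\<close> is an arbitrary choice.
\<close>

record ('a, 'e) metric_graph =
  vertices :: "'a set"
  edges :: "'e set"
  len :: "'e \<Rightarrow> real"
  param :: "'e \<Rightarrow> real \<Rightarrow> 'a"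

definition points :: "('a, 'e) metric_graph \<Rightarrow> 'a set" where
  "points \<Gamma> = vertices \<Gamma> \<union> (\<Union>e\<in>edges \<Gamma>. param \<Gamma> e ` {0..len \<Gamma> e})"

text \<open>
  The underlying undirected graph, as a digraph in which every edge can be traversed in both
  directions: the arc \<open>(e, True)\<close> runs along \<open>param \<Gamma> e\<close> and \<open>(e, False)\<close> against it.
\<close>

definition graph_of :: "('a, 'e) metric_graph \<Rightarrow> ('a, 'e \<times> bool) pre_digraph" where
  "graph_of \<Gamma> = \<lparr> verts = vertices \<Gamma>, arcs = edges \<Gamma> \<times> UNIV,
     tail = (\<lambda>(e, b). param \<Gamma> e (if b then 0 else len \<Gamma> e)),
     head = (\<lambda>(e, b). param \<Gamma> e (if b then len \<Gamma> e else 0)) \<rparr>"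

text \<open>
  Loops are excluded by the injectivity of \<open>param \<Gamma> e\<close> on the closed interval.  A cycle of the
  undirected graph is a cycle of \<open>graph_of \<Gamma>\<close> that uses no edge twice; without this proviso,
  going back and forth along one edge would count as a cycle.
\<close>

definition is_tree :: "('a, 'e) metric_graph \<Rightarrow> bool" where
  "is_tree \<Gamma> \<longleftrightarrow>
     (\<forall>e\<in>edges \<Gamma>. 0 < len \<Gamma> e \<and> inj_on (param \<Gamma> e) {0..len \<Gamma> e} \<and>
        param \<Gamma> e ` {0<..<len \<Gamma> e} \<inter> vertices \<Gamma> = {}) \<and>
     (\<forall>e\<in>edges \<Gamma>. \<forall>e'\<in>edges \<Gamma>. e \<noteq> e' \<longrightarrow>
        param \<Gamma> e ` {0<..<len \<Gamma> e} \<inter> param \<Gamma> e' ` {0<..<len \<Gamma> e'} = {}) \<and>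
     wf_digraph (graph_of \<Gamma>) \<and>
     strongly_connected (graph_of \<Gamma>) \<and>
     (\<forall>c. pre_digraph.cycle (graph_of \<Gamma>) c \<longrightarrow> \<not> distinct (map fst c)) \<and>
     (\<forall>x\<in>vertices \<Gamma>. finite (out_arcs (graph_of \<Gamma>) x))"


section \<open>Paths and distance\<close>

text \<open>
  \<open>polypath \<Gamma> x S L y\<close>: the set \<open>S\<close> is a polygonal path without self-intersections from \<open>x\<close> to
  \<open>y\<close>, of length \<open>L\<close>.
\<close>

inductive polypath :: "('a, 'e) metric_graph \<Rightarrow> 'a \<Rightarrow> 'a set \<Rightarrow> real \<Rightarrow> 'a \<Rightarrow> bool"
  for \<Gamma> where
  refl: "x \<in> points \<Gamma> \<Longrightarrow> polypath \<Gamma> x {x} 0 x"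
| step: "\<lbrakk> e \<in> edges \<Gamma>; s \<in> {0..len \<Gamma> e}; t \<in> {0..len \<Gamma> e}; s \<noteq> t;
           polypath \<Gamma> (param \<Gamma> e t) S L y;
           param \<Gamma> e ` closed_segment s t \<inter> S = {param \<Gamma> e t} \<rbrakk>
         \<Longrightarrow> polypath \<Gamma> (param \<Gamma> e s) (param \<Gamma> e ` closed_segment s t \<union> S) (\<bar>s - t\<bar> + L) y"

definition tpath :: "('a, 'e) metric_graph \<Rightarrow> 'a \<Rightarrow> 'a \<Rightarrow> 'a set" where
  "tpath \<Gamma> x y = (THE S. \<exists>L. polypath \<Gamma> x S L y)"

text \<open>
  The value 0 outside \<open>\<Gamma>\<close> is needed because the locale \<open>Metric_space\<close> requires symmetry and
  nonnegativity on the whole type.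
\<close>

definition tdist :: "('a, 'e) metric_graph \<Rightarrow> 'a \<Rightarrow> 'a \<Rightarrow> real" where
  "tdist \<Gamma> x y =
     (if x \<in> points \<Gamma> \<and> y \<in> points \<Gamma> then THE L. \<exists>S. polypath \<Gamma> x S L y else 0)"

definition ttopology :: "('a, 'e) metric_graph \<Rightarrow> 'a topology" where
  "ttopology \<Gamma> = Metric_space.mtopology (points \<Gamma>) (tdist \<Gamma>)"

definition relatively_compact :: "('a, 'e) metric_graph \<Rightarrow> 'a set \<Rightarrow> bool" where
  "relatively_compact \<Gamma> K \<longleftrightarrow>
     K \<subseteq> points \<Gamma> \<and> compactin (ttopology \<Gamma>) (ttopology \<Gamma> closure_of K)"


section \<open>Lebesgue measure and \<open>L\<^sup>p\<close> on a tree\<close>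

definition tleb :: "('a, 'e) metric_graph \<Rightarrow> 'a measure" where
  "tleb \<Gamma> = measure_of (points \<Gamma>)
     {A. A \<subseteq> points \<Gamma> \<and>
         (\<forall>e\<in>edges \<Gamma>. {t \<in> {0..len \<Gamma> e}. param \<Gamma> e t \<in> A} \<in> sets lebesgue)}
     (\<lambda>A. \<integral>\<^sup>+e. emeasure lebesgue {t \<in> {0..len \<Gamma> e}. param \<Gamma> e t \<in> A} \<partial>count_space (edges \<Gamma>))"

definition Lp :: "'a measure \<Rightarrow> real \<Rightarrow> ('a \<Rightarrow> 'k::real_normed_field) set" where
  "Lp M p = {f \<in> borel_measurable M. integrable M (\<lambda>x. norm (f x) powr p)}"

definition Lp_norm :: "'a measure \<Rightarrow> real \<Rightarrow> ('a \<Rightarrow> 'k::real_normed_field) \<Rightarrow> real" where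
  "Lp_norm M p f = (LINT x|M. norm (f x) powr p) powr (1 / p)"

definition conj_exp :: "real \<Rightarrow> real" where
  "conj_exp p = p / (p - 1)"


section \<open>Approximation numbers\<close>

text \<open>
  Elements of \<open>L\<^sup>p\<close> are represented by functions, so linearity and spanning are required almost
  everywhere.  With boundedness this makes \<open>F\<close> respect equality almost everywhere.
\<close>

definition bounded_operator ::
  "'a measure \<Rightarrow> real \<Rightarrow> (('a \<Rightarrow> 'k::real_normed_field) \<Rightarrow> 'a \<Rightarrow> 'k) \<Rightarrow> bool" where
  "bounded_operator M p F \<longleftrightarrow>
     (\<forall>f\<in>Lp M p. F f \<in> Lp M p) \<and>
     (\<forall>f\<in>Lp M p. \<forall>g\<in>Lp M p. AE x in M. F (\<lambda>t. f t + g t) x = F f x + F g x) \<and>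
     (\<forall>f\<in>Lp M p. \<forall>c. AE x in M. F (\<lambda>t. c * f t) x = c * F f x) \<and>
     (\<exists>C. \<forall>f\<in>Lp M p. Lp_norm M p (F f) \<le> C * Lp_norm M p f)"

definition rank_less ::
  "'a measure \<Rightarrow> real \<Rightarrow> (('a \<Rightarrow> 'k::real_normed_field) \<Rightarrow> 'a \<Rightarrow> 'k) \<Rightarrow> nat \<Rightarrow> bool" where
  "rank_less M p F m \<longleftrightarrow>
     (\<exists>B. B \<subseteq> Lp M p \<and> finite B \<and> card B < m \<and>
        (\<forall>f\<in>Lp M p. \<exists>c. AE x in M. F f x = (\<Sum>b\<in>B. c b * b x)))"

text \<open>
  The operator norm is \<open>\<infinity>\<close> if \<open>D\<close> does not map \<open>L\<^sup>p\<close> boundedly into \<open>L\<^sup>p\<close>.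
\<close>

definition op_norm ::
  "'a measure \<Rightarrow> real \<Rightarrow> (('a \<Rightarrow> 'k::real_normed_field) \<Rightarrow> 'a \<Rightarrow> 'k) \<Rightarrow> ennreal" where
  "op_norm M p D =
     Inf {ennreal C |C. 0 \<le> C \<and> (\<forall>f\<in>Lp M p. D f \<in> Lp M p \<and> Lp_norm M p (D f) \<le> C * Lp_norm M p f)}"

definition approx_num ::
  "'a measure \<Rightarrow> real \<Rightarrow> (('a \<Rightarrow> 'k::real_normed_field) \<Rightarrow> 'a \<Rightarrow> 'k) \<Rightarrow> nat \<Rightarrow> ennreal" where
  "approx_num M p T m =
     (INF F\<in>{F. bounded_operator M p F \<and> rank_less M p F m}. op_norm M p (\<lambda>f x. T f x - F f x))"


section \<open>Sequence norms\<close>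

text \<open>Only used with positive exponent.\<close>

definition ennpowr :: "ennreal \<Rightarrow> real \<Rightarrow> ennreal" where
  "ennpowr x r = (if x = \<infinity> then \<infinity> else ennreal (enn2real x powr r))"

definition lq_norm :: "real \<Rightarrow> 'i set \<Rightarrow> ('i \<Rightarrow> ennreal) \<Rightarrow> ennreal" where
  "lq_norm q I b = ennpowr (\<integral>\<^sup>+i. ennpowr (b i) q \<partial>count_space I) (1 / q)"


section \<open>The Hardy operator and the sequence \<open>\<sigma>\<close>\<close>

definition hardy ::
  "('a, 'e) metric_graph \<Rightarrow> ('a \<Rightarrow> 'k) \<Rightarrow> ('a \<Rightarrow> 'k) \<Rightarrow> 'a \<Rightarrow> ('a \<Rightarrow> 'k) \<Rightarrow> 'a
     \<Rightarrow> 'k::{real_normed_field, banach, second_countable_topology}" where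
  "hardy \<Gamma> u v a f x = v x * (LINT t:tpath \<Gamma> a x|tleb \<Gamma>. f t * u t)"

definition mu :: "('a, 'e) metric_graph \<Rightarrow> real \<Rightarrow> ('a \<Rightarrow> 'k::real_normed_field) \<Rightarrow> 'a set \<Rightarrow> real" where
  "mu \<Gamma> p v K = (LINT t:K|tleb \<Gamma>. norm (v t) powr p)"

definition U :: "('a, 'e) metric_graph \<Rightarrow> real \<Rightarrow> ('a \<Rightarrow> 'k::real_normed_field) \<Rightarrow> 'a \<Rightarrow> 'a \<Rightarrow> real" where
  "U \<Gamma> p u a x = (LINT t:tpath \<Gamma> a x|tleb \<Gamma>. norm (u t) powr conj_exp p)"

definition Z :: "('a, 'e) metric_graph \<Rightarrow> real \<Rightarrow> ('a \<Rightarrow> 'k::real_normed_field) \<Rightarrow> 'a \<Rightarrow> int \<Rightarrow> 'a set" where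
  "Z \<Gamma> p u a k = ttopology \<Gamma> closure_of
     {x \<in> points \<Gamma>. 2 powr (of_int k * conj_exp p / p) \<le> U \<Gamma> p u a x \<and>
                   U \<Gamma> p u a x < 2 powr (of_int (k + 1) * conj_exp p / p)}"

definition admissible ::
  "('a, 'e) metric_graph \<Rightarrow> real \<Rightarrow> ('a \<Rightarrow> 'k::real_normed_field) \<Rightarrow> int \<Rightarrow> bool" where
  "admissible \<Gamma> p u k \<longleftrightarrow>
     (u \<in> Lp (tleb \<Gamma>) (conj_exp p) \<longrightarrow>
        2 powr of_int k \<le> Lp_norm (tleb \<Gamma>) (conj_exp p) u powr p)"

definition sigma_seq ::
  "('a, 'e) metric_graph \<Rightarrow> real \<Rightarrow> ('a \<Rightarrow> 'k::real_normed_field) \<Rightarrow> ('a \<Rightarrow> 'k) \<Rightarrow> 'a \<Rightarrow> int \<Rightarrow> real" where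
  "sigma_seq \<Gamma> p u v a k =
     (if admissible \<Gamma> p u k then (2 powr of_int k * mu \<Gamma> p v (Z \<Gamma> p u a k)) powr (1 / p) else 0)"

end

theory Submission
  imports Defs
begin

text \<open>
  A tree embeds isometrically into $\ell^1$ of its edge set by recording, for every edge, the
  projection of a point to that edge; paths become coordinatewise intervals, so uniqueness of
  paths, the metric and measurability can all be read off the coordinates.

  Let $h = U^{p-1}$. Hoelder's inequality with the weights $U^{\pm 1/(2p')}$ bounds the tail
  $|\int_{y}^x fu|^p$ by a multiple of $h(x)^{1/2} \int_{y}^x |f|^p h^{1/2}$. If $T$ is approximated
  by integrating only up to the last of finitely many roots before $x$, Tonelli's theorem reduces
  the error to the masses $\int h^{1/2}(x) h^{1/2}(t) |v(x)|^p dx$ over those $x$ beyond $t$ that no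
  root separates from $t$. A greedy choice of at most $\sum_k \lfloor\sigma_k^p/\delta\rfloor$ roots
  makes this mass $O(\delta)$ on all dyadic levels at once, so the number of $n$ with
  $a_n^p > C\delta$ is at most the number of pairs $(k,j)$, $j \geq 1$, with
  $\sigma_k^p / j \geq \delta$. Comparing counting functions gives
  $\sum a_n^q \leq C \sum_{k,j} (\sigma_k^p/j)^{q/p}$, where the sum over $j$ converges as $q > p$.
\<close>

section \<open>Coordinates on a tree\<close>

text \<open>The half powers of h are the crux. Roots serve each dyadic level of h separately: the x
  that no root separates from t have mass at most \<delta> on every level, and there may be
  infinitely many levels above that of t. Weighting with h(x) alone would cost \<delta> for each of
  them. The product h^(1/2)(x) h^(1/2)(t) gains a factor 2^(-j/2) when x lies j levels above t, and
  x, being beyond t, never lies below it, so the sum over j >= 0 is geometric. The price is that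
  U^(-1/2) must be integrable against |u|^p' along each path; it is, because the part of a path
  where U <= s carries mass at most s.

  The estimates use little of the tree: a sigma-finite measure with null points, an order in which
  predecessors form chains and cones are measurable, a real height that makes chains countably
  cofinal, and a countable order-dense set that makes the order jointly measurable. No completeness
  is among these, so a root is an increasing union of paths and not a point.\<close>

locale mtree =
  fixes \<Gamma> :: "('a, 'e) metric_graph"
  assumes tree: "is_tree \<Gamma>"
begin

abbreviation "E \<equiv> edges \<Gamma>"
abbreviation "V \<equiv> vertices \<Gamma>"
abbreviation "l \<equiv> len \<Gamma>"
abbreviation "\<pi> \<equiv> param \<Gamma>"
abbreviation "G \<equiv> graph_of \<Gamma>"
abbreviation "X \<equiv> points \<Gamma>"

lemma len_pos: "e \<in> E \<Longrightarrow> 0 < l e"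
  and param_inj: "e \<in> E \<Longrightarrow> inj_on (\<pi> e) {0..l e}"
  and interior_vertices: "e \<in> E \<Longrightarrow> \<pi> e ` {0<..<l e} \<inter> V = {}"
  using tree by (simp_all add: is_tree_def)

lemma interior_disjoint:
  "\<lbrakk>e \<in> E; e' \<in> E; e \<noteq> e'\<rbrakk> \<Longrightarrow> \<pi> e ` {0<..<l e} \<inter> \<pi> e' ` {0<..<l e'} = {}"
  using tree by (simp add: is_tree_def)

section \<open>The underlying graph and the two sides of an edge\<close>

lemma wf: "wf_digraph G"
  and strongly_connected_G: "strongly_connected G"
  and no_cycle: "pre_digraph.cycle G c \<Longrightarrow> \<not> distinct (map fst c)"
  and finite_out: "x \<in> V \<Longrightarrow> finite (out_arcs G x)"
  using tree by (simp_all add: is_tree_def)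

sublocale wf_digraph G by (rule wf)

lemma verts_G [simp]: "verts G = V"
  and arcs_G [simp]: "arcs G = E \<times> UNIV"
  and tail_G [simp]: "tail G (e, b) = \<pi> e (if b then 0 else l e)"
  and head_G [simp]: "head G (e, b) = \<pi> e (if b then l e else 0)"
  by (simp_all add: graph_of_def)

lemma ends_in_V [simp]:
  assumes "e \<in> E" shows "\<pi> e 0 \<in> V" "\<pi> e (l e) \<in> V"
  using tail_in_verts[of "(e, True)"] head_in_verts[of "(e, True)"] assms by auto

text \<open>On vertices, \<open>(linked e)\<^sup>*\<close> is connectedness in the graph with the
  edge \<open>e\<close> deleted.\<close>

definition linked :: "'e \<Rightarrow> ('a \<times> 'a) set" where
  "linked e = {(x, y). \<exists>e'\<in>E - {e}.
     (x = \<pi> e' 0 \<and> y = \<pi> e' (l e')) \<or> (x = \<pi> e' (l e') \<and> y = \<pi> e' 0)}"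

lemma sym_linked: "sym ((linked e)\<^sup>*)"
  by (rule sym_rtrancl) (auto simp: sym_def linked_def)

lemma linked_arc:
  assumes "(e', b) \<in> arcs G" "e' \<noteq> e"
  shows "(tail G (e', b), head G (e', b)) \<in> linked e"
  using assms by (auto simp: linked_def)

lemma linked_walk:
  assumes "awalk x p y" "e \<notin> fst ` set p"
  shows "(x, y) \<in> (linked e)\<^sup>*"
  using assms
proof (induction p arbitrary: x)
  case (Cons a p)
  obtain e' b where a: "a = (e', b)" by fastforce
  from Cons.prems have *: "a \<in> arcs G" "tail G a = x" "awalk (head G a) p y"
    by (auto simp: awalk_Cons_iff)
  have "(x, head G a) \<in> linked e"
    using linked_arc[of e' b e] * Cons.prems a by auto
  with Cons.IH[OF *(3)] Cons.prems show ?case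
    by (auto intro: converse_rtrancl_into_rtrancl)
qed (auto simp: awalk_Nil_iff)

lemma walk_if_linked:
  assumes "(x, y) \<in> (linked e)\<^sup>*" "x \<in> V"
  shows "\<exists>p. awalk x p y \<and> e \<notin> fst ` set p"
  using assms
proof (induction rule: rtrancl_induct)
  case base
  then show ?case by (intro exI[of _ "[]"]) (auto simp: awalk_Nil_iff)
next
  case (step y z)
  from step obtain p where p: "awalk x p y" "e \<notin> fst ` set p" by auto
  from step(2) obtain e' b where e': "e' \<in> E" "e' \<noteq> e" "y = tail G (e', b)" "z = head G (e', b)"
    unfolding linked_def by (auto split: if_splits) (metis (full_types) tail_G head_G)+
  have "awalk y [(e', b)] z"
    using e' by (auto simp: awalk_Cons_iff awalk_Nil_iff)
  with p(1) have "awalk x (p @ [(e', b)]) z" by (rule awalk_appendI)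
  with p(2) e' show ?case by (intro exI[of _ "p @ [(e', b)]"]) auto
qed

text \<open>Cycles are excluded only if they repeat no edge, so simple paths must be known to repeat
  none. Traversing an edge in either direction visits both of its ends, so a second use would
  revisit the vertex just left.\<close>

lemma apath_distinct_edges:
  assumes "apath u p v"
  shows "distinct (map fst p)"
  using assms
proof (induction p arbitrary: u)
  case (Cons a p)
  obtain e b where a: "a = (e, b)" by fastforce
  from Cons.prems have *: "a \<in> arcs G" "u = tail G a" "apath (head G a) p v"
      "u \<notin> set (awalk_verts (head G a) p)"
    by (auto simp: apath_def awalk_Cons_iff)
  have "e \<notin> fst ` set p"
  proof
    assume "e \<in> fst ` set p"
    then obtain b' where b': "(e, b') \<in> set p" by auto
    have "awalk (head G a) p v" using *(3) by (simp add: apath_def)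
    then have "tail G (e, b') \<in> set (awalk_verts (head G a) p)"
        "head G (e, b') \<in> set (awalk_verts (head G a) p)"
      using awalk_verts_arc1[OF b'] awalk_verts_arc2[OF _ b'] by (auto elim!: awalkE)
    then show False using *(2,4) a by (cases b; cases b') auto
  qed
  with Cons.IH[OF *(3)] a show ?case by simp
qed simp

text \<open>The component of the tree minus \<open>e\<close> that contains the initial end of
  \<open>e\<close>. By \<open>linked_to_end\<close> and \<open>side_head\<close> there are exactly
  two components.\<close>

definition side :: "'e \<Rightarrow> 'a \<Rightarrow> bool" where
  "side e x \<longleftrightarrow> (\<pi> e 0, x) \<in> (linked e)\<^sup>*"

lemma side_linked: "(x, y) \<in> (linked e)\<^sup>* \<Longrightarrow> side e x = side e y"
  unfolding side_def using sym_linked[of e] by (meson rtrancl_trans symD)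

lemma side_tail [simp]: "side e (\<pi> e 0)"
  by (simp add: side_def)

lemma side_const: "e' \<in> E \<Longrightarrow> e' \<noteq> e \<Longrightarrow> side e (\<pi> e' (l e')) = side e (\<pi> e' 0)"
  by (rule side_linked) (auto simp: linked_def)

text \<open>Otherwise a simple path between the ends of \<open>e\<close> that avoids
  \<open>e\<close>, closed up by \<open>e\<close> itself, would be a cycle.\<close>

lemma side_head [simp]:
  assumes e: "e \<in> E" shows "\<not> side e (\<pi> e (l e))"
proof
  assume "side e (\<pi> e (l e))"
  then obtain p where p: "awalk (\<pi> e 0) p (\<pi> e (l e))" "e \<notin> fst ` set p"
    using walk_if_linked ends_in_V[OF e] unfolding side_def by blast
  define q where "q = awalk_to_apath p"
  have q: "apath (\<pi> e 0) q (\<pi> e (l e))"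
    unfolding q_def using p by (rule_tac apath_awalk_to_apath)
  have "e \<notin> fst ` set q"
    using p awalk_to_apath_subset[OF p(1)] unfolding q_def by auto
  then have "distinct (map fst ((e, False) # q))"
    using apath_distinct_edges[OF q] by simp
  moreover have "cycle ((e, False) # q)"
    unfolding cycle_def using q e
    by (intro exI[of _ "\<pi> e (l e)"]) (auto simp: awalk_Cons_iff apath_def)
  ultimately show False using no_cycle by blast
qed

lemma connecting_walk:
  assumes "x \<in> V" "y \<in> V"
  obtains p where "awalk x p y"
  using strongly_connected_G assms unfolding strongly_connected_def
  by (metis reachable_awalk verts_G)

text \<open>A simple path crosses its first edge only once, so that edge separates its end
  points.\<close>

lemma first_edge:
  assumes "x \<in> V" "y \<in> V" "x \<noteq> y"
  obtains e s where "e \<in> E" "s \<in> {0, l e}" "x = \<pi> e s" "side e x \<noteq> side e y"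
proof -
  obtain p where "awalk x p y" using connecting_walk assms by blast
  define q where "q = awalk_to_apath p"
  have q: "apath x q y"
    unfolding q_def using \<open>awalk x p y\<close> by (rule apath_awalk_to_apath)
  with \<open>x \<noteq> y\<close> obtain e b r where r: "q = (e, b) # r"
    by (cases q) (auto simp: apath_def awalk_Nil_iff)
  have *: "e \<in> E" "x = tail G (e, b)" "awalk (head G (e, b)) r y"
    using q r by (auto simp: apath_def awalk_Cons_iff simp del: tail_G head_G)
  have "e \<notin> fst ` set r"
    using apath_distinct_edges[OF q] r by simp
  then have "side e (head G (e, b)) = side e y"
    by (intro side_linked linked_walk[OF *(3)])
  moreover have "side e x \<noteq> side e (head G (e, b))"
    using * by (cases b) auto
  ultimately show thesis
    using * by (intro that[of e "if b then 0 else l e"]) auto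
qed

text \<open>Only edges on a connecting walk can separate two vertices. This keeps coordinate sums
  finite in an infinite tree.\<close>

lemma finite_side_diff:
  assumes "x \<in> V" "y \<in> V"
  shows "finite {e\<in>E. side e x \<noteq> side e y}"
proof -
  obtain p where p: "awalk x p y" using connecting_walk assms by blast
  have "{e\<in>E. side e x \<noteq> side e y} \<subseteq> fst ` set p"
    using linked_walk[OF p] side_linked by blast
  then show ?thesis by (rule finite_subset) auto
qed

lemma linked_to_end:
  assumes e: "e \<in> E" and "x \<in> V"
  shows "\<exists>s\<in>{0, l e}. (\<pi> e s, x) \<in> (linked e)\<^sup>*"
proof -
  obtain p where "awalk x p (\<pi> e 0)" using connecting_walk assms ends_in_V by blast
  then show ?thesis
  proof (induction p arbitrary: x)
    case (Cons a p)
    obtain e' b where a: "a = (e', b)" by fastforce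
    from Cons.prems have *: "a \<in> arcs G" "tail G a = x" "awalk (head G a) p (\<pi> e 0)"
      by (auto simp: awalk_Cons_iff)
    show ?case
    proof (cases "e' = e")
      case True
      then show ?thesis using * a by (cases b) auto
    next
      case False
      have "(x, head G a) \<in> linked e"
        using linked_arc[of e' b e] * False a by auto
      then show ?thesis
        using Cons.IH[OF *(3)] sym_linked[of e]
        by (meson r_into_rtrancl rtrancl_trans symD)
    qed
  qed (auto simp: awalk_Nil_iff)
qed

text \<open>Join \<open>w\<close> to an end of \<open>e\<close> without using \<open>e\<close>. All
  vertices met lie on the same side of \<open>e\<close> as \<open>w\<close>. If that is not the side
  of \<open>e'\<close>, the connection never touches an end of \<open>e'\<close>, hence avoids
  \<open>e'\<close>, and \<open>w\<close> lies on the same side of \<open>e'\<close> as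
  \<open>e\<close>.\<close>

lemma side_nested:
  assumes e: "e \<in> E" "e' \<in> E" "e \<noteq> e'" and w: "w \<in> V"
  shows "side e w = side e (\<pi> e' 0) \<or> side e' w = side e' (\<pi> e 0)"
proof (rule disjCI)
  assume side': "side e' w \<noteq> side e' (\<pi> e 0)"
  obtain s where s: "s \<in> {0, l e}" "(\<pi> e s, w) \<in> (linked e)\<^sup>*"
    using linked_to_end e w by blast
  show "side e w = side e (\<pi> e' 0)"
  proof (rule ccontr)
    assume ne: "side e w \<noteq> side e (\<pi> e' 0)"
    from s(2) have "(\<pi> e s, w) \<in> (linked e')\<^sup>*"
    proof (induction rule: rtrancl_induct)
      case (step y z)
      have "side e y = side e w"
        using step(1) s(2) side_linked by metis
      with ne side_const[of e' e] e have "y \<noteq> \<pi> e' 0" "y \<noteq> \<pi> e' (l e')" by auto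
      with step(2) have "(y, z) \<in> linked e'"
        unfolding linked_def by blast
      with step(3) show ?case by auto
    qed auto
    then have "side e' w = side e' (\<pi> e s)" using side_linked by metis
    also have "\<dots> = side e' (\<pi> e 0)" using s(1) side_const[of e e'] e by auto
    finally show False using side' by simp
  qed
qed

section \<open>Edge coordinates of points\<close>

lemma points_cases:
  assumes "x \<in> X"
  obtains "x \<in> V" | e t where "e \<in> E" "t \<in> {0<..<l e}" "x = \<pi> e t" "x \<notin> V"
proof (cases "x \<in> V")
  case False
  then obtain e t where *: "e \<in> E" "t \<in> {0..l e}" "x = \<pi> e t"
    using assms by (auto simp: points_def)
  with False have "t \<noteq> 0" "t \<noteq> l e" by auto
  then show thesis using that(2)[of e t] * False by auto
qed (use that in blast)

lemma param_in_points [simp]: "e \<in> E \<Longrightarrow> t \<in> {0..l e} \<Longrightarrow> \<pi> e t \<in> X"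
  unfolding points_def by blast

text \<open>Both ends of an edge lie on the same side of every other edge, so either end can
  represent an interior point there.\<close>

definition base :: "'a \<Rightarrow> 'a" where
  "base x = (if x \<in> V then x else \<pi> (SOME e. e \<in> E \<and> x \<in> \<pi> e ` {0<..<l e}) 0)"

lemma base_interior:
  assumes "e \<in> E" "t \<in> {0<..<l e}"
  shows "base (\<pi> e t) = \<pi> e 0"
proof -
  have "(SOME e'. e' \<in> E \<and> \<pi> e t \<in> \<pi> e' ` {0<..<l e'}) = e"
    using assms interior_disjoint[of _ e] by (intro some_equality) blast+
  moreover have "\<pi> e t \<notin> V" using interior_vertices assms by blast
  ultimately show ?thesis unfolding base_def by simp
qed

lemma base_in_V: "x \<in> X \<Longrightarrow> base x \<in> V"
  by (erule points_cases) (auto simp: base_interior, simp add: base_def)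

text \<open>Arc-length position of the point of \<open>e\<close> nearest to \<open>x\<close>; the
  two ends stand for the two components left when \<open>e\<close> is deleted.\<close>

definition coord :: "'e \<Rightarrow> 'a \<Rightarrow> real" where
  "coord e x = (if x \<in> \<pi> e ` {0<..<l e} then the_inv_into {0..l e} (\<pi> e) x
     else if side e (base x) then 0 else l e)"

lemma coord_vertex: "e \<in> E \<Longrightarrow> x \<in> V \<Longrightarrow> coord e x = (if side e x then 0 else l e)"
  using interior_vertices[of e] by (auto simp: coord_def base_def)

lemma coord_param [simp]:
  assumes "e \<in> E" "t \<in> {0..l e}" shows "coord e (\<pi> e t) = t"
proof -
  consider "t = 0" | "t = l e" | "t \<in> {0<..<l e}" using assms by fastforce
  then show ?thesis
  proof cases
    case 3
    then show ?thesis
      using the_inv_into_f_f[OF param_inj[OF assms(1)] assms(2)] by (simp add: coord_def)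
  qed (use assms in \<open>auto simp: coord_vertex\<close>)
qed

lemma coord_other:
  assumes "e \<in> E" "e' \<in> E" "e \<noteq> e'" "t \<in> {0..l e'}"
  shows "coord e (\<pi> e' t) = coord e (\<pi> e' 0)"
proof -
  consider "t = 0" | "t = l e'" | "t \<in> {0<..<l e'}" using assms by fastforce
  then show ?thesis
  proof cases
    case 2
    then show ?thesis using assms side_const[of e' e] by (simp add: coord_vertex)
  next
    case 3
    then have "\<pi> e' t \<notin> \<pi> e ` {0<..<l e}" using interior_disjoint assms by blast
    then show ?thesis
      using assms 3 by (simp add: coord_vertex base_interior) (simp add: coord_def base_interior)
  qed auto
qed

lemma coord_corner: "e \<in> E \<Longrightarrow> e' \<in> E \<Longrightarrow> coord e (\<pi> e' 0) \<in> {0, l e}"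
  by (simp add: coord_vertex)

lemma coord_not_interior: "x \<notin> \<pi> e ` {0<..<l e} \<Longrightarrow> coord e x \<in> {0, l e}"
  by (simp add: coord_def)

lemma coord_range:
  assumes "e \<in> E" shows "coord e x \<in> {0..l e}"
proof (cases "x \<in> \<pi> e ` {0<..<l e}")
  case False
  then show ?thesis using coord_not_interior[OF False] len_pos[OF assms] by auto
qed (use assms in auto)

lemma param_coord:
  assumes "e \<in> E" "0 < coord e x" "coord e x < l e"
  shows "\<pi> e (coord e x) = x"
proof -
  have "x \<in> \<pi> e ` {0<..<l e}"
    using coord_not_interior[of x e] assms by fastforce
  then show ?thesis using assms by auto
qed

text \<open>
  The pair of coordinates on two distinct edges takes values in an L-shaped set, whose corner is
  given by the position of each edge relative to the other one.
\<close>

lemma coord_nested: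
  assumes e: "e \<in> E" "e' \<in> E" "e \<noteq> e'" and x: "x \<in> X"
  shows "coord e x = coord e (\<pi> e' 0) \<or> coord e' x = coord e' (\<pi> e 0)"
  using x
proof (cases rule: points_cases)
  case 1
  then show ?thesis using side_nested[OF e 1] e by (auto simp: coord_vertex)
next
  case (2 e'' t)
  have t: "t \<in> {0..l e''}" using 2 by auto
  consider "e'' = e" | "e'' = e'" | "e'' \<noteq> e" "e'' \<noteq> e'" by blast
  then show ?thesis
  proof cases
    case 3
    then have "coord e x = coord e (\<pi> e'' 0)" "coord e' x = coord e' (\<pi> e'' 0)"
      using coord_other[of e e'' t] coord_other[of e' e'' t] t 2(1,3) e by metis+
    moreover have "coord e (\<pi> e'' 0) = coord e (\<pi> e' 0) \<or> coord e' (\<pi> e'' 0) = coord e' (\<pi> e 0)"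
      using side_nested[OF e, of "\<pi> e'' 0"] e 2(1) by (auto simp: coord_vertex)
    ultimately show ?thesis by metis
  next
    case 1
    then show ?thesis using coord_other[of e' e t] t 2(3) e by metis
  next
    case 2
    then show ?thesis using coord_other[of e e' t] t \<open>x = \<pi> e'' t\<close> e by metis
  qed
qed

lemma coord_base:
  assumes "e \<in> E" "x \<in> X" "x \<notin> \<pi> e ` {0<..<l e}"
  shows "coord e x = coord e (base x)"
  using assms(3) coord_vertex[OF assms(1) base_in_V[OF assms(2)]] by (simp add: coord_def)

lemma finite_coord_diff:
  assumes "x \<in> X" "y \<in> X"
  shows "finite {e\<in>E. coord e x \<noteq> coord e y}"
proof -
  have fin: "finite {e\<in>E. z \<in> \<pi> e ` {0<..<l e}}" for z
  proof (cases "\<exists>e\<in>E. z \<in> \<pi> e ` {0<..<l e}")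
    case True
    then obtain e where e: "e \<in> E" "z \<in> \<pi> e ` {0<..<l e}" by blast
    have "{e\<in>E. z \<in> \<pi> e ` {0<..<l e}} \<subseteq> {e}"
    proof
      fix e' assume "e' \<in> {e\<in>E. z \<in> \<pi> e ` {0<..<l e}}"
      then show "e' \<in> {e}" using interior_disjoint[OF e(1), of e'] e(2) by blast
    qed
    then show ?thesis by (rule finite_subset) simp
  next
    case False
    then have empty: "{e\<in>E. z \<in> \<pi> e ` {0<..<l e}} = {}" by blast
    show ?thesis unfolding empty by simp
  qed
  have "{e\<in>E. coord e x \<noteq> coord e y} \<subseteq> {e\<in>E. x \<in> \<pi> e ` {0<..<l e}} \<union>
      {e\<in>E. y \<in> \<pi> e ` {0<..<l e}} \<union> {e\<in>E. side e (base x) \<noteq> side e (base y)}"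
  proof
    fix e assume "e \<in> {e\<in>E. coord e x \<noteq> coord e y}"
    then show "e \<in> {e\<in>E. x \<in> \<pi> e ` {0<..<l e}} \<union>
      {e\<in>E. y \<in> \<pi> e ` {0<..<l e}} \<union> {e\<in>E. side e (base x) \<noteq> side e (base y)}"
      unfolding coord_def mem_Collect_eq Un_iff by presburger
  qed
  then show ?thesis
    using fin finite_side_diff[OF base_in_V base_in_V] assms
    by (rule_tac finite_subset) auto
qed

text \<open>This gives the separation of points by coordinates and, since moving along
  \<open>e\<close> to \<open>coord e y\<close> settles one coordinate, the induction step in the
  construction of paths.\<close>

lemma step_towards:
  assumes "x \<in> X" "y \<in> X" "x \<noteq> y"
  obtains e s where "e \<in> E" "s \<in> {0..l e}" "x = \<pi> e s" "coord e y \<noteq> s"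
  using assms(1)
proof (cases rule: points_cases)
  case 1
  show ?thesis
  proof (cases "base y = x")
    \<comment> \<open>There is no walk between distinct vertices to start from: \<open>y\<close>
      lies inside an edge whose initial end is \<open>x\<close>.\<close>
    case True
    then have "y \<notin> V" using assms by (auto simp: base_def)
    with assms(2) obtain e t where *: "e \<in> E" "t \<in> {0<..<l e}" "y = \<pi> e t"
      by (auto elim: points_cases)
    then have "coord e y = t" "x = \<pi> e 0" using base_interior True by auto
    then show ?thesis using * by (intro that[of e 0]) auto
  next
    case False
    then obtain e s where *: "e \<in> E" "s \<in> {0, l e}" "x = \<pi> e s" "side e x \<noteq> side e (base y)"
      using first_edge[OF 1 base_in_V[OF assms(2)]] by metis
    have "coord e y \<noteq> s"
    proof (cases "y \<in> \<pi> e ` {0<..<l e}")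
      case True
      then obtain t where "y = \<pi> e t" "t \<in> {0<..<l e}" by auto
      then show ?thesis using * by auto
    next
      case False
      then show ?thesis using * coord_base[OF *(1) assms(2) False] base_in_V[OF assms(2)]
          len_pos[OF *(1)] by (auto simp: coord_vertex split: if_splits)
    qed
    then show ?thesis using * len_pos[OF *(1)] by (intro that[of e s]) auto
  qed
next
  case (2 e t)
  show ?thesis
  proof (rule that[of e t])
    show "coord e y \<noteq> t" using param_coord[of e y] 2 assms(3) by auto
  qed (use 2 in auto)
qed

lemma coord_separates:
  assumes "x \<in> X" "y \<in> X" "\<And>e. e \<in> E \<Longrightarrow> coord e x = coord e y"
  shows "x = y"
  by (rule ccontr) (metis step_towards[OF assms(1,2)] assms(3) coord_param)

end

lemma mem_closed_segment_real:
  fixes a b c :: real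
  shows "c \<in> closed_segment a b \<longleftrightarrow> a \<le> c \<and> c \<le> b \<or> b \<le> c \<and> c \<le> a"
  by (auto simp: closed_segment_eq_real_ivl)

lemma closed_sets_lebesgue: "closed S \<Longrightarrow> S \<in> sets lebesgue"
  by (metis borel_closed sets_completionI_sets sets_lborel)

section \<open>Paths, distance and measure in coordinates\<close>

context mtree
begin

section \<open>Coordinate intervals are the paths, and the l^1 distance is their length\<close>

definition btw :: "'a \<Rightarrow> 'a \<Rightarrow> 'a set" where
  "btw x y = {z \<in> X. \<forall>e\<in>E. coord e z \<in> closed_segment (coord e x) (coord e y)}"

definition cdist :: "'a \<Rightarrow> 'a \<Rightarrow> real" where
  "cdist x y = (\<Sum>e | e \<in> E \<and> coord e x \<noteq> coord e y. \<bar>coord e x - coord e y\<bar>)"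

lemma cdist_superset:
  assumes "finite F" "F \<subseteq> E" "\<And>e. e \<in> E \<Longrightarrow> coord e x \<noteq> coord e y \<Longrightarrow> e \<in> F"
  shows "cdist x y = (\<Sum>e\<in>F. \<bar>coord e x - coord e y\<bar>)"
  unfolding cdist_def using assms by (intro sum.mono_neutral_left) auto

lemma btw_self: "x \<in> X \<Longrightarrow> btw x x = {x}"
  using coord_separates[of _ x] by (auto simp: btw_def)

lemma cdist_self [simp]: "cdist x x = 0"
  by (simp add: cdist_def)

lemma ends_in_btw: "x \<in> X \<Longrightarrow> x \<in> btw x y" "y \<in> X \<Longrightarrow> y \<in> btw x y"
  by (auto simp: btw_def)

lemma coord_same_edge:
  assumes "e \<in> E" "e' \<in> E" "e' \<noteq> e" "s \<in> {0..l e}" "t \<in> {0..l e}"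
  shows "coord e' (\<pi> e s) = coord e' (\<pi> e t)"
  using coord_other[of e' e s] coord_other[of e' e t] assms by metis

text \<open>The point is that some \<open>z\<close> of the interval that has not reached the part
  from \<open>t\<close> to \<open>y\<close> must lie on \<open>e\<close>. If it deviated on another
  edge \<open>e'\<close>, then so would \<open>y\<close>, and \<open>coord_nested\<close> would give
  \<open>z\<close> and \<open>y\<close> the same coordinate on \<open>e\<close>, namely the corner
  value.\<close>

lemma btw_step:
  assumes e: "e \<in> E" and s: "s \<in> {0..l e}" and t: "t \<in> {0..l e}" and y: "y \<in> X"
    and ne: "s \<noteq> t" and between: "t \<in> closed_segment s (coord e y)"
  shows "btw (\<pi> e s) y = \<pi> e ` closed_segment s t \<union> btw (\<pi> e t) y"
proof (intro equalityI subsetI)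
  fix z assume z: "z \<in> btw (\<pi> e s) y"
  then have zX: "z \<in> X" and zc: "\<And>e'. e' \<in> E \<Longrightarrow> coord e' z \<in> closed_segment (coord e' (\<pi> e s)) (coord e' y)"
    by (auto simp: btw_def)
  show "z \<in> \<pi> e ` closed_segment s t \<union> btw (\<pi> e t) y"
  proof (cases "coord e z \<in> closed_segment t (coord e y)")
    case True
    have "coord e' z \<in> closed_segment (coord e' (\<pi> e t)) (coord e' y)" if "e' \<in> E" for e'
      using True zc[OF that] coord_same_edge[OF e that _ s t] e t by (cases "e' = e") auto
    then show ?thesis using zX by (auto simp: btw_def)
  next
    case False
    have cz: "coord e z \<in> closed_segment s (coord e y)" using zc[OF e] e s by auto
    have cz': "coord e z \<in> closed_segment s t"
      using cz False between unfolding mem_closed_segment_real by linarith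
    have "z = \<pi> e (coord e z)"
    proof (rule coord_separates)
      show "\<pi> e (coord e z) \<in> X" using e coord_range by simp
      fix e' assume e': "e' \<in> E"
      show "coord e' z = coord e' (\<pi> e (coord e z))"
      proof (cases "e' = e")
        case False
        have k: "coord e' (\<pi> e (coord e z)) = coord e' (\<pi> e 0)"
            "coord e' (\<pi> e s) = coord e' (\<pi> e 0)"
          using coord_other[of e' e] e e' False s coord_range[of e z] by metis+
        show ?thesis
        proof (rule ccontr)
          assume "coord e' z \<noteq> coord e' (\<pi> e (coord e z))"
          then have 1: "coord e' z \<noteq> coord e' (\<pi> e 0)" using k by simp
          then have 2: "coord e' y \<noteq> coord e' (\<pi> e 0)" using zc[OF e'] k by auto
          have "coord e z = coord e (\<pi> e' 0)" "coord e y = coord e (\<pi> e' 0)"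
            using coord_nested[OF e' e False zX] coord_nested[OF e' e False y] 1 2 by auto
          then show False
            using \<open>coord e z \<notin> closed_segment t (coord e y)\<close> by auto
        qed
      qed (use e coord_range in simp)
    qed (rule zX)
    with cz' show ?thesis by blast
  qed
next
  fix z assume "z \<in> \<pi> e ` closed_segment s t \<union> btw (\<pi> e t) y"
  then consider r where "r \<in> closed_segment s t" "z = \<pi> e r" | "z \<in> btw (\<pi> e t) y" by blast
  then show "z \<in> btw (\<pi> e s) y"
  proof cases
    case 1
    have r: "r \<in> {0..l e}" using 1(1) s t unfolding mem_closed_segment_real by auto
    have "coord e' z \<in> closed_segment (coord e' (\<pi> e s)) (coord e' y)" if e': "e' \<in> E" for e'
    proof (cases "e' = e")
      case True
      have "r \<in> closed_segment s (coord e y)"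
        using 1(1) between unfolding mem_closed_segment_real by linarith
      then show ?thesis using True e r s 1 by simp
    next
      case False
      then have "coord e' z = coord e' (\<pi> e s)" using coord_same_edge[OF e e' False r s] 1 by simp
      then show ?thesis by simp
    qed
    then show ?thesis using 1 e r by (auto simp: btw_def)
  next
    case 2
    then have zX: "z \<in> X" and zc: "\<And>e'. e' \<in> E \<Longrightarrow> coord e' z \<in> closed_segment (coord e' (\<pi> e t)) (coord e' y)"
      by (auto simp: btw_def)
    have "coord e' z \<in> closed_segment (coord e' (\<pi> e s)) (coord e' y)" if e': "e' \<in> E" for e'
    proof (cases "e' = e")
      case True
      have "coord e z \<in> closed_segment t (coord e y)" using zc[OF e] e t by simp
      then have "coord e z \<in> closed_segment s (coord e y)"
        using between unfolding mem_closed_segment_real by linarith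
      then show ?thesis using True e s by simp
    next
      case False
      then show ?thesis using zc[OF e'] coord_same_edge[OF e e' False s t] by simp
    qed
    then show ?thesis using zX by (auto simp: btw_def)
  qed
qed

lemma cdist_step:
  assumes e: "e \<in> E" and s: "s \<in> {0..l e}" and t: "t \<in> {0..l e}" and y: "y \<in> X"
    and between: "t \<in> closed_segment s (coord e y)"
  shows "cdist (\<pi> e s) y = \<bar>s - t\<bar> + cdist (\<pi> e t) y"
proof -
  define F where "F = {e'\<in>E. coord e' (\<pi> e s) \<noteq> coord e' y} \<union> {e'\<in>E. coord e' (\<pi> e t) \<noteq> coord e' y} - {e}"
  have F: "finite F" "F \<subseteq> E" "e \<notin> F"
    unfolding F_def using finite_coord_diff e s t y by auto
  have "cdist (\<pi> e s) y = (\<Sum>e'\<in>insert e F. \<bar>coord e' (\<pi> e s) - coord e' y\<bar>)"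
       "cdist (\<pi> e t) y = (\<Sum>e'\<in>insert e F. \<bar>coord e' (\<pi> e t) - coord e' y\<bar>)"
    using F e by (intro cdist_superset; auto simp: F_def)+
  moreover have "(\<Sum>e'\<in>F. \<bar>coord e' (\<pi> e s) - coord e' y\<bar>) = (\<Sum>e'\<in>F. \<bar>coord e' (\<pi> e t) - coord e' y\<bar>)"
  proof (rule sum.cong)
    fix e' assume "e' \<in> F"
    then show "\<bar>coord e' (\<pi> e s) - coord e' y\<bar> = \<bar>coord e' (\<pi> e t) - coord e' y\<bar>"
      using coord_same_edge[OF e _ _ s t, of e'] F(2,3) by force
  qed simp
  moreover have "\<bar>s - coord e y\<bar> = \<bar>s - t\<bar> + \<bar>t - coord e y\<bar>"
    using between unfolding mem_closed_segment_real by linarith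
  ultimately show ?thesis using F e s t by simp
qed

lemma polypath_unique:
  assumes "polypath \<Gamma> x S L y"
  shows "x \<in> X \<and> y \<in> X \<and> S = btw x y \<and> L = cdist x y"
  using assms
proof induction
  case (refl x)
  then show ?case by (simp add: btw_self)
next
  case (step e s t S L y)
  note e = step(1) and s = step(2) and t = step(3) and ne = step(4)
  have y: "y \<in> X" and S: "S = btw (\<pi> e t) y" and L: "L = cdist (\<pi> e t) y" using step by auto
  have "t \<in> closed_segment s (coord e y)"
  proof (rule ccontr)
    assume neg: "t \<notin> closed_segment s (coord e y)"
    \<comment> \<open>A path that does not move towards \<open>y\<close> has to turn back:
      \<open>r\<close> is the point between \<open>s\<close> and \<open>t\<close> nearest to
      \<open>coord e y\<close>, and the rest of the path runs through it again.\<close>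
    define r where "r = (if s < t then max s (coord e y) else min s (coord e y))"
    have r: "r \<in> closed_segment s t" "r \<in> closed_segment t (coord e y)" "r \<noteq> t"
      using neg ne unfolding mem_closed_segment_real r_def by (auto split: if_splits)
    have r': "r \<in> {0..l e}" using r(1) s t unfolding mem_closed_segment_real by auto
    have "coord e' (\<pi> e r) \<in> closed_segment (coord e' (\<pi> e t)) (coord e' y)" if e': "e' \<in> E" for e'
    proof (cases "e' = e")
      case True
      then show ?thesis using r r' e t by simp
    next
      case False
      have "coord e' (\<pi> e r) = coord e' (\<pi> e t)" using coord_same_edge[OF e e' False r' t] .
      then show ?thesis by simp
    qed
    then have "\<pi> e r \<in> S" using r' e by (auto simp: S btw_def)
    then have "\<pi> e r = \<pi> e t" using r(1) step(6) by blast
    then show False using r(3) inj_onD[OF param_inj[OF e]] r' t by blast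
  qed
  then show ?case
    using btw_step[OF e s t y ne] cdist_step[OF e s t y] e s y S L by simp
qed

text \<open>Induction on the number of coordinates in which \<open>x\<close> and \<open>y\<close>
  differ: moving along \<open>e\<close> to the coordinate of \<open>y\<close> settles
  \<open>e\<close> and leaves all other coordinates alone.\<close>

lemma polypath_exists:
  assumes "x \<in> X" "y \<in> X"
  shows "polypath \<Gamma> x (btw x y) (cdist x y) y"
  using assms
proof (induction "card {e\<in>E. coord e x \<noteq> coord e y}" arbitrary: x rule: less_induct)
  case less
  show ?case
  proof (cases "x = y")
    case True
    then show ?thesis using polypath.refl[of x \<Gamma>] less.prems by (simp add: btw_self)
  next
    case False
    then obtain e s where e: "e \<in> E" and s: "s \<in> {0..l e}" and x: "x = \<pi> e s" and ne: "coord e y \<noteq> s"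
      using step_towards less.prems by metis
    define t where "t = coord e y"
    have t: "t \<in> {0..l e}" using coord_range[OF e] by (simp add: t_def)
    have same: "coord e' (\<pi> e t) = coord e' x" if "e' \<in> E" "e' \<noteq> e" for e'
      using coord_same_edge[OF e that t s] x by simp
    have "{e'\<in>E. coord e' (\<pi> e t) \<noteq> coord e' y} \<subset> {e'\<in>E. coord e' x \<noteq> coord e' y}"
    proof
      show "{e'\<in>E. coord e' (\<pi> e t) \<noteq> coord e' y} \<subseteq> {e'\<in>E. coord e' x \<noteq> coord e' y}"
      proof
        fix e' assume e': "e' \<in> {e'\<in>E. coord e' (\<pi> e t) \<noteq> coord e' y}"
        then have "e' \<noteq> e" using e t by (auto simp: t_def)
        then show "e' \<in> {e'\<in>E. coord e' x \<noteq> coord e' y}" using same e' by auto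
      qed
      show "{e'\<in>E. coord e' (\<pi> e t) \<noteq> coord e' y} \<noteq> {e'\<in>E. coord e' x \<noteq> coord e' y}"
      proof -
        have "e \<in> {e'\<in>E. coord e' x \<noteq> coord e' y}" using e s x ne by auto
        moreover have "e \<notin> {e'\<in>E. coord e' (\<pi> e t) \<noteq> coord e' y}" using e t t_def by auto
        ultimately show ?thesis by blast
      qed
    qed
    then have "card {e'\<in>E. coord e' (\<pi> e t) \<noteq> coord e' y} < card {e'\<in>E. coord e' x \<noteq> coord e' y}"
      using finite_coord_diff less.prems by (intro psubset_card_mono) auto
    then have path: "polypath \<Gamma> (\<pi> e t) (btw (\<pi> e t) y) (cdist (\<pi> e t) y) y"
      using less.hyps e t less.prems by simp
    have between: "t \<in> closed_segment s (coord e y)" by (simp add: t_def)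
    have "\<pi> e ` closed_segment s t \<inter> btw (\<pi> e t) y = {\<pi> e t}"
    proof (intro equalityI subsetI)
      fix z assume "z \<in> \<pi> e ` closed_segment s t \<inter> btw (\<pi> e t) y"
      then obtain r where r: "z = \<pi> e r" "r \<in> closed_segment s t" "z \<in> btw (\<pi> e t) y" by blast
      have r': "r \<in> {0..l e}" using r(2) s t unfolding mem_closed_segment_real by auto
      have "coord e z \<in> closed_segment (coord e (\<pi> e t)) (coord e y)" using r(3) e by (simp add: btw_def)
      then have "r = t" using r(1) r' e t by (simp add: t_def[symmetric])
      then show "z \<in> {\<pi> e t}" using r by simp
    next
      fix z assume "z \<in> {\<pi> e t}"
      then show "z \<in> \<pi> e ` closed_segment s t \<inter> btw (\<pi> e t) y"
        using ends_in_btw(1)[of "\<pi> e t" y] e t by auto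
    qed
    from polypath.step[OF e s t _ path this] ne
    show ?thesis
      using btw_step[OF e s t less.prems(2) _ between] cdist_step[OF e s t less.prems(2) between]
      by (simp add: x t_def)
  qed
qed

lemma tpath_eq: "x \<in> X \<Longrightarrow> y \<in> X \<Longrightarrow> tpath \<Gamma> x y = btw x y"
  unfolding tpath_def
  by (rule the_equality) (metis polypath_exists, metis polypath_unique)

lemma tdist_eq: "x \<in> X \<Longrightarrow> y \<in> X \<Longrightarrow> tdist \<Gamma> x y = cdist x y"
  unfolding tdist_def
  by (simp, rule the_equality) (metis polypath_exists, metis polypath_unique)

lemma cdist_nonneg: "0 \<le> cdist x y"
  unfolding cdist_def by (rule sum_nonneg) auto

lemma cdist_pos:
  assumes "x \<in> X" "y \<in> X" "x \<noteq> y" shows "0 < cdist x y"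
proof -
  have "{e. e \<in> E \<and> coord e x \<noteq> coord e y} \<noteq> {}"
    using coord_separates[OF assms(1,2)] assms(3) by blast
  then show ?thesis
    unfolding cdist_def using finite_coord_diff[OF assms(1,2)] by (intro sum_pos) auto
qed

lemma cdist_commute: "cdist x y = cdist y x"
  unfolding cdist_def by (intro sum.cong) (auto simp: abs_minus_commute)

lemma cdist_common:
  assumes "x \<in> X" "y \<in> X" "z \<in> X"
  obtains F where "finite F" "F \<subseteq> E" "cdist x z = (\<Sum>e\<in>F. \<bar>coord e x - coord e z\<bar>)"
    "cdist x y = (\<Sum>e\<in>F. \<bar>coord e x - coord e y\<bar>)" "cdist y z = (\<Sum>e\<in>F. \<bar>coord e y - coord e z\<bar>)"
proof (rule that)
  let ?F = "{e\<in>E. coord e x \<noteq> coord e y} \<union> {e\<in>E. coord e y \<noteq> coord e z} \<union> {e\<in>E. coord e x \<noteq> coord e z}"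
  show F: "finite ?F" "?F \<subseteq> E" using finite_coord_diff assms by auto
  show "cdist x z = (\<Sum>e\<in>?F. \<bar>coord e x - coord e z\<bar>)"
    "cdist x y = (\<Sum>e\<in>?F. \<bar>coord e x - coord e y\<bar>)" "cdist y z = (\<Sum>e\<in>?F. \<bar>coord e y - coord e z\<bar>)"
    by (rule cdist_superset[OF F], blast)+
qed

lemma cdist_triangle:
  assumes "x \<in> X" "y \<in> X" "z \<in> X"
  shows "cdist x z \<le> cdist x y + cdist y z"
proof -
  obtain F where F: "cdist x z = (\<Sum>e\<in>F. \<bar>coord e x - coord e z\<bar>)"
    "cdist x y = (\<Sum>e\<in>F. \<bar>coord e x - coord e y\<bar>)" "cdist y z = (\<Sum>e\<in>F. \<bar>coord e y - coord e z\<bar>)"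
    by (rule cdist_common[OF assms])
  show ?thesis unfolding F sum.distrib[symmetric] by (rule sum_mono) linarith
qed

lemma cdist_btw:
  assumes "x \<in> X" "y \<in> X" "t \<in> btw x y"
  shows "cdist x y = cdist x t + cdist t y"
proof -
  have "t \<in> X" using assms by (simp add: btw_def)
  obtain F where F: "F \<subseteq> E" "cdist x y = (\<Sum>e\<in>F. \<bar>coord e x - coord e y\<bar>)"
    "cdist x t = (\<Sum>e\<in>F. \<bar>coord e x - coord e t\<bar>)" "cdist t y = (\<Sum>e\<in>F. \<bar>coord e t - coord e y\<bar>)"
    by (rule cdist_common[OF assms(1) \<open>t \<in> X\<close> assms(2)])
  show ?thesis unfolding F(2-4) sum.distrib[symmetric]
  proof (rule sum.cong)
    fix e assume "e \<in> F"
    then have "coord e t \<in> closed_segment (coord e x) (coord e y)" using F(1) assms(3) by (auto simp: btw_def)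
    then show "\<bar>coord e x - coord e y\<bar> = \<bar>coord e x - coord e t\<bar> + \<bar>coord e t - coord e y\<bar>"
      unfolding mem_closed_segment_real by linarith
  qed simp
qed

section \<open>The metric topology and compactness of paths\<close>

sublocale Metric_space X "tdist \<Gamma>"
proof
  show "0 \<le> tdist \<Gamma> x y" for x y
    using cdist_nonneg[of x y] tdist_eq[of x y] by (cases "x \<in> X \<and> y \<in> X") (auto simp: tdist_def)
  show "tdist \<Gamma> x y = tdist \<Gamma> y x" for x y
    using cdist_commute[of x y] tdist_eq[of x y] tdist_eq[of y x]
    by (cases "x \<in> X \<and> y \<in> X") (auto simp: tdist_def)
  show "tdist \<Gamma> x y = 0 \<longleftrightarrow> x = y" if "x \<in> X" "y \<in> X" for x y
    using cdist_pos[OF that] tdist_eq[OF that] by (cases "x = y") auto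
  show "tdist \<Gamma> x z \<le> tdist \<Gamma> x y + tdist \<Gamma> y z" if "x \<in> X" "y \<in> X" "z \<in> X" for x y z
    using cdist_triangle[OF that] tdist_eq that by simp
qed

lemma tdist_param:
  assumes "e \<in> E" "s \<in> {0..l e}" "t \<in> {0..l e}"
  shows "tdist \<Gamma> (\<pi> e s) (\<pi> e t) = \<bar>s - t\<bar>"
  using cdist_step[OF assms, of "\<pi> e t"] assms by (simp add: tdist_eq)

lemma continuous_param:
  assumes e: "e \<in> E"
  shows "continuous_map (top_of_set {0..l e}) (ttopology \<Gamma>) (\<pi> e)"
  unfolding ttopology_def continuous_map_to_metric
proof (intro ballI allI impI)
  fix s \<epsilon> :: real assume s: "s \<in> topspace (top_of_set {0..l e})" and \<epsilon>: "0 < \<epsilon>"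
  show "\<exists>U. openin (top_of_set {0..l e}) U \<and> s \<in> U \<and> (\<forall>t\<in>U. \<pi> e t \<in> mball (\<pi> e s) \<epsilon>)"
  proof (intro exI[of _ "{0..l e} \<inter> ball s \<epsilon>"] conjI ballI)
    fix t assume t: "t \<in> {0..l e} \<inter> ball s \<epsilon>"
    have "tdist \<Gamma> (\<pi> e s) (\<pi> e t) = \<bar>s - t\<bar>" using tdist_param[OF e, of s t] s t by auto
    also have "\<dots> < \<epsilon>" using t by (auto simp: dist_real_def)
    finally have "tdist \<Gamma> (\<pi> e s) (\<pi> e t) < \<epsilon>" .
    moreover have "\<pi> e s \<in> X" "\<pi> e t \<in> X" using e s t by auto
    ultimately show "\<pi> e t \<in> mball (\<pi> e s) \<epsilon>" by simp
  qed (use s \<epsilon> in \<open>auto intro: openin_open_Int\<close>)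
qed

text \<open>A path is a finite union of continuous images of compact segments. Through this the
  local integrability of \<open>u\<close> becomes available on paths.\<close>

lemma compactin_polypath: "polypath \<Gamma> x S L y \<Longrightarrow> compactin (ttopology \<Gamma>) S"
proof (induction rule: polypath.induct)
  case (refl x)
  then show ?case by (simp add: ttopology_def)
next
  case (step e s t S L y)
  have "closed_segment s t \<subseteq> {0..l e}" using step(2,3) by (intro closed_segment_subset) auto
  then have "compactin (top_of_set {0..l e}) (closed_segment s t)"
    by (simp add: compactin_subtopology)
  from image_compactin[OF this continuous_param[OF step(1)]] step
  show ?case by (auto intro: compactin_Un)
qed

lemma relatively_compact_btw:
  assumes "x \<in> X" "y \<in> X"
  shows "relatively_compact \<Gamma> (btw x y)"
proof -
  have c: "compactin (ttopology \<Gamma>) (btw x y)"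
    using compactin_polypath polypath_exists assms by blast
  then have "closedin (ttopology \<Gamma>) (btw x y)"
    using compactin_imp_closedin Hausdorff_space_mtopology by (simp add: ttopology_def)
  then have "ttopology \<Gamma> closure_of (btw x y) = btw x y" by (rule closure_of_closedin)
  with c show ?thesis by (auto simp: relatively_compact_def btw_def)
qed

section \<open>Lebesgue measure: measurable sets, null sets, sigma-finiteness\<close>

definition sect :: "'e \<Rightarrow> 'a set \<Rightarrow> real set" where
  "sect e A = {t \<in> {0..l e}. \<pi> e t \<in> A}"

lemma sigma_algebra_tleb:
  "sigma_algebra X {A. A \<subseteq> X \<and> (\<forall>e\<in>E. sect e A \<in> sets lebesgue)}"
proof (intro sigma_algebra_iff2[THEN iffD2] conjI ballI allI impI; clarsimp)
  show "sect e {} \<in> sets lebesgue" for e by (simp add: sect_def)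
next
  fix s e assume s: "s \<subseteq> X" "\<forall>e\<in>E. sect e s \<in> sets lebesgue" and e: "e \<in> E"
  have "sect e (X - s) = {0..l e} - sect e s" using e by (auto simp: sect_def)
  then show "sect e (X - s) \<in> sets lebesgue" using s e by auto
next
  fix A :: "nat \<Rightarrow> 'a set"
  assume A: "range A \<subseteq> {A. A \<subseteq> X \<and> (\<forall>e\<in>E. sect e A \<in> sets lebesgue)}"
  show "\<Union>(range A) \<subseteq> X \<and> (\<forall>e\<in>E. sect e (\<Union>(range A)) \<in> sets lebesgue)"
  proof (intro conjI ballI)
    show "\<Union>(range A) \<subseteq> X" using A by blast
    fix e assume e: "e \<in> E"
    have "sect e (\<Union>(range A)) = (\<Union>i. sect e (A i))" by (auto simp: sect_def)
    moreover have "sect e (A i) \<in> sets lebesgue" for i using A e by blast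
    ultimately show "sect e (\<Union>(range A)) \<in> sets lebesgue" by auto
  qed
qed blast

lemma space_tleb [simp]: "space (tleb \<Gamma>) = X"
  unfolding tleb_def by (rule space_measure_of) auto

lemma sets_tleb: "A \<in> sets (tleb \<Gamma>) \<longleftrightarrow> A \<subseteq> X \<and> (\<forall>e\<in>E. sect e A \<in> sets lebesgue)"
proof -
  have "sets (tleb \<Gamma>) = {A. A \<subseteq> X \<and> (\<forall>e\<in>E. sect e A \<in> sets lebesgue)}"
    unfolding tleb_def using sigma_algebra.sets_measure_of_eq[OF sigma_algebra_tleb]
    by (simp add: sect_def)
  then show ?thesis by simp
qed

lemma emeasure_tleb:
  assumes "A \<in> sets (tleb \<Gamma>)"
  shows "emeasure (tleb \<Gamma>) A = (\<integral>\<^sup>+e. emeasure lebesgue (sect e A) \<partial>count_space E)"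
  unfolding tleb_def sect_def
proof (rule emeasure_measure_of_sigma)
  let ?S = "{A. A \<subseteq> X \<and> (\<forall>e\<in>E. {t \<in> {0..l e}. \<pi> e t \<in> A} \<in> sets lebesgue)}"
  let ?\<mu> = "\<lambda>A. \<integral>\<^sup>+e. emeasure lebesgue {t \<in> {0..l e}. \<pi> e t \<in> A} \<partial>count_space E"
  show "sigma_algebra X ?S" using sigma_algebra_tleb by (simp add: sect_def)
  show "A \<in> ?S" using assms unfolding sets_tleb by (simp add: sect_def)
  show "positive ?S ?\<mu>" by (simp add: positive_def)
  show "countably_additive ?S ?\<mu>"
  proof (rule countably_additiveI)
    fix A :: "nat \<Rightarrow> 'a set" assume A: "range A \<subseteq> ?S" "disjoint_family A"
    have "(\<Sum>i. ?\<mu> (A i)) = (\<integral>\<^sup>+e. (\<Sum>i. emeasure lebesgue (sect e (A i))) \<partial>count_space E)"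
      unfolding sect_def by (rule nn_integral_suminf[symmetric]) simp
    also have "\<dots> = (\<integral>\<^sup>+e. emeasure lebesgue (sect e (\<Union>i. A i)) \<partial>count_space E)"
    proof (rule nn_integral_cong)
      fix e assume "e \<in> space (count_space E)"
      then have "range (\<lambda>i. sect e (A i)) \<subseteq> sets lebesgue" using A(1) by (auto simp: sect_def)
      moreover have "disjoint_family (\<lambda>i. sect e (A i))"
        using A(2) by (auto simp: disjoint_family_on_def sect_def)
      ultimately have "(\<Sum>i. emeasure lebesgue (sect e (A i))) = emeasure lebesgue (\<Union>i. sect e (A i))"
        by (rule suminf_emeasure)
      also have "(\<Union>i. sect e (A i)) = sect e (\<Union>i. A i)" by (auto simp: sect_def)
      finally show "(\<Sum>i. emeasure lebesgue (sect e (A i))) = emeasure lebesgue (sect e (\<Union>i. A i))" .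
    qed
    finally show "(\<Sum>i. ?\<mu> (A i)) = ?\<mu> (\<Union>i. A i)" by (simp add: sect_def)
  qed
qed

text \<open>This is for the sets \<open>Z\<close>, which are closures.\<close>

lemma closedin_sets_tleb:
  assumes "closedin (ttopology \<Gamma>) Y" shows "Y \<in> sets (tleb \<Gamma>)"
  unfolding sets_tleb
proof (intro conjI ballI)
  show "Y \<subseteq> X" using closedin_subset[OF assms] by (simp add: ttopology_def)
  fix e assume e: "e \<in> E"
  have "closedin (top_of_set {0..l e}) {t \<in> topspace (top_of_set {0..l e}). \<pi> e t \<in> Y}"
    by (rule closedin_continuous_map_preimage[OF continuous_param[OF e] assms])
  then have "closed (sect e Y)"
    using closedin_closed_eq[of "{0..l e}"] by (auto simp: sect_def)
  then show "sect e Y \<in> sets lebesgue" by (intro closed_sets_lebesgue)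
qed

text \<open>Along an edge only one coordinate moves. A condition imposed on all edges therefore
  becomes, on a single edge, a condition on \<open>t\<close> and a fixed truth value, so sections of
  paths and cones are intervals or empty, without any intersection over edges.\<close>

lemma all_coord_param:
  assumes e: "e \<in> E" and t: "t \<in> {0..l e}"
  shows "(\<forall>e'\<in>E. \<Phi> e' (coord e' (\<pi> e t))) \<longleftrightarrow>
    \<Phi> e t \<and> (\<forall>e'\<in>E - {e}. \<Phi> e' (coord e' (\<pi> e 0)))"
proof -
  have "coord e' (\<pi> e t) = coord e' (\<pi> e 0)" if "e' \<in> E - {e}" for e'
    using coord_other[of e' e t] that e t by blast
  moreover have "coord e (\<pi> e t) = t" using e t by simp
  moreover have "E = insert e (E - {e})" using e by blast
  ultimately show ?thesis by (metis (no_types, lifting) insert_iff)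
qed

lemma sect_btw:
  assumes e: "e \<in> E"
  shows "sect e (btw x y) \<in> sets lebesgue"
proof -
  have "sect e (btw x y) = {t\<in>{0..l e}. t \<in> closed_segment (coord e x) (coord e y) \<and>
      (\<forall>e'\<in>E-{e}. coord e' (\<pi> e 0) \<in> closed_segment (coord e' x) (coord e' y))}" (is "_ = {t\<in>_. t \<in> ?I \<and> ?K}")
  proof -
    have "\<pi> e t \<in> btw x y \<longleftrightarrow> t \<in> ?I \<and> ?K" if t: "t \<in> {0..l e}" for t
      using all_coord_param[OF e t, of "\<lambda>e' c. c \<in> closed_segment (coord e' x) (coord e' y)"] e t
      by (simp add: btw_def)
    then show ?thesis unfolding sect_def by blast
  qed
  also have "\<dots> = (if ?K then {0..l e} \<inter> ?I else {})" by auto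
  also have "\<dots> \<in> sets lebesgue" by (auto intro!: closed_sets_lebesgue)
  finally show ?thesis .
qed

lemma btw_sets: "btw x y \<in> sets (tleb \<Gamma>)"
  unfolding sets_tleb using sect_btw by (auto simp: btw_def)

lemma cone_sets:
  assumes t: "t \<in> X"
  shows "{x \<in> X. t \<in> btw a x} \<in> sets (tleb \<Gamma>)"
  unfolding sets_tleb
proof (intro conjI ballI)
  fix e assume e: "e \<in> E"
  have "sect e {x \<in> X. t \<in> btw a x} = {r\<in>{0..l e}. coord e t \<in> closed_segment (coord e a) r \<and>
      (\<forall>e'\<in>E-{e}. coord e' t \<in> closed_segment (coord e' a) (coord e' (\<pi> e 0)))}"
      (is "_ = {r\<in>_. ?I r \<and> ?K}")
  proof -
    have "t \<in> btw a (\<pi> e r) \<longleftrightarrow> ?I r \<and> ?K" if r: "r \<in> {0..l e}" for r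
      using all_coord_param[OF e r, of "\<lambda>e' c. coord e' t \<in> closed_segment (coord e' a) c"] e t
      by (simp add: btw_def)
    moreover have "\<pi> e r \<in> X" if "r \<in> {0..l e}" for r using e that by simp
    ultimately show ?thesis unfolding sect_def by blast
  qed
  also have "\<dots> = (if ?K then {0..l e} \<inter> {r. ?I r} else {})" by auto
  also have "{r. ?I r} = (if coord e a < coord e t then {coord e t..} else
      if coord e t < coord e a then {..coord e t} else UNIV)"
    unfolding mem_closed_segment_real by auto
  also have "(if ?K then {0..l e} \<inter> \<dots> else {}) \<in> sets lebesgue"
    by (auto intro!: closed_sets_lebesgue)
  finally show "sect e {x \<in> X. t \<in> btw a x} \<in> sets lebesgue" .
qed auto

lemma sect_singleton: "e \<in> E \<Longrightarrow> sect e {x} \<subseteq> {coord e x}"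
  by (auto simp: sect_def)

lemma null_sect:
  assumes A: "A \<subseteq> X" and fin: "\<And>e. e \<in> E \<Longrightarrow> finite (sect e A)"
  shows "A \<in> null_sets (tleb \<Gamma>)"
proof -
  have s: "A \<in> sets (tleb \<Gamma>)"
    unfolding sets_tleb using A fin by (auto intro!: closed_sets_lebesgue finite_imp_closed)
  have "emeasure lebesgue (sect e A) = 0" if "e \<in> E" for e
    using emeasure_lborel_countable[OF countable_finite[OF fin[OF that]]] fin[OF that]
    by (simp add: finite_imp_closed)
  then have "emeasure (tleb \<Gamma>) A = (\<integral>\<^sup>+e. 0 \<partial>count_space E)"
    unfolding emeasure_tleb[OF s] by (intro nn_integral_cong) simp
  with s show ?thesis by auto
qed

lemma singleton_null: "x \<in> X \<Longrightarrow> {x} \<in> null_sets (tleb \<Gamma>)"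
  by (rule null_sect) (auto intro: finite_subset[OF sect_singleton])

text \<open>Finite degrees and connectedness: everything is reachable from one vertex through
  countably many arcs. Sigma-finiteness, and hence Tonelli's theorem, rests on this.\<close>

lemma countable_V: "countable V"
proof -
  obtain v where v: "v \<in> V" using strongly_connected_G by (auto simp: strongly_connected_def)
  have "V \<subseteq> (arcs_ends G)\<^sup>* `` {v}"
  proof
    fix w assume "w \<in> V"
    then have "v \<rightarrow>\<^sup>*\<^bsub>G\<^esub> w" using strongly_connected_G v by (simp add: strongly_connected_def)
    then have "(v, w) \<in> (arcs_ends G)\<^sup>*" by (rule reachable_rtranclI)
    then show "w \<in> (arcs_ends G)\<^sup>* `` {v}" by simp
  qed
  moreover have "countable ((arcs_ends G)\<^sup>* `` {v})"
  proof (rule countable_rtrancl)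
    fix Y :: "'a set" assume Y: "countable Y"
    have "arcs_ends G `` Y \<subseteq> (\<Union>y\<in>Y \<inter> V. head G ` out_arcs G y)"
    proof
      fix z assume "z \<in> arcs_ends G `` Y"
      then obtain y f where f: "y \<in> Y" "f \<in> arcs G" "tail G f = y" "head G f = z"
        by (auto simp: arcs_ends_def arc_to_ends_def)
      then have "y \<in> V" using tail_in_verts[of f] by simp
      then show "z \<in> (\<Union>y\<in>Y \<inter> V. head G ` out_arcs G y)" using f by (auto simp: out_arcs_def)
    qed
    moreover have "countable (\<Union>y\<in>Y \<inter> V. head G ` out_arcs G y)"
      using Y finite_out by (intro countable_UN countable_image) (auto intro: countable_finite)
    ultimately show "countable (arcs_ends G `` Y)" by (rule countable_subset)
  qed auto
  ultimately show ?thesis by (rule countable_subset)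
qed

lemma countable_E: "countable E"
proof -
  have "E \<subseteq> fst ` (\<Union>v\<in>V. out_arcs G v)"
  proof
    fix e assume "e \<in> E"
    then have "(e, True) \<in> out_arcs G (\<pi> e 0)" "\<pi> e 0 \<in> V" by (auto simp: out_arcs_def)
    then show "e \<in> fst ` (\<Union>v\<in>V. out_arcs G v)" by force
  qed
  moreover have "countable (fst ` (\<Union>v\<in>V. out_arcs G v))"
    using countable_V finite_out by (intro countable_image countable_UN) (auto intro: countable_finite)
  ultimately show ?thesis by (rule countable_subset)
qed

lemma sigma_finite_tleb: "sigma_finite_measure (tleb \<Gamma>)"
proof
  let ?I = "\<lambda>e. \<pi> e ` {0..l e}"
  have other: "sect e' (?I e) \<subseteq> {0, l e'}" if "e \<in> E" "e' \<in> E" "e' \<noteq> e" for e e'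
  proof
    fix t assume "t \<in> sect e' (?I e)"
    then obtain s where s: "t \<in> {0..l e'}" "s \<in> {0..l e}" "\<pi> e' t = \<pi> e s" by (auto simp: sect_def)
    have "t = coord e' (\<pi> e s)" using s that by (metis coord_param)
    also have "\<dots> \<in> {0, l e'}" using coord_other[of e' e s] coord_corner[of e' e] that s by metis
    finally show "t \<in> {0, l e'}" .
  qed
  have self: "sect e (?I e) = {0..l e}" for e by (auto simp: sect_def)
  have I: "?I e \<in> sets (tleb \<Gamma>)" if "e \<in> E" for e
    unfolding sets_tleb
  proof (intro conjI ballI)
    fix e' assume "e' \<in> E"
    then show "sect e' (?I e) \<in> sets lebesgue"
      using finite_subset[OF other[OF that]] self[of e]
      by (cases "e' = e") (auto intro!: closed_sets_lebesgue finite_imp_closed)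
  qed (use that in auto)
  have "emeasure (tleb \<Gamma>) (?I e) \<noteq> \<infinity>" if e: "e \<in> E" for e
  proof -
    have "emeasure (tleb \<Gamma>) (?I e) = (\<integral>\<^sup>+e'. ennreal (l e) * indicator {e} e' \<partial>count_space E)"
      unfolding emeasure_tleb[OF I[OF e]]
    proof (rule nn_integral_cong)
      fix e' assume e': "e' \<in> space (count_space E)"
      show "emeasure lebesgue (sect e' (?I e)) = ennreal (l e) * indicator {e} e'"
      proof (cases "e' = e")
        case True
        then show ?thesis using self[of e] len_pos[OF e] by simp
      next
        case False
        then have "finite (sect e' (?I e))" using finite_subset[OF other[OF e _ False]] e' by auto
        then show ?thesis using False emeasure_lborel_countable[OF countable_finite]
          by (simp add: finite_imp_closed)
      qed
    qed
    also have "\<dots> = ennreal (l e)" using e by (simp add: nn_integral_cmult)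
    finally show ?thesis by simp
  qed
  \<comment> \<open>The vertices join the cover because a tree without edges is a single vertex that
    no edge covers.\<close>
  moreover have "V \<in> null_sets (tleb \<Gamma>)"
  proof (rule null_sect)
    show "V \<subseteq> X" by (auto simp: points_def)
    fix e assume "e \<in> E"
    then have e: "\<pi> e ` {0<..<l e} \<inter> V = {}" by (rule interior_vertices)
    have "sect e V \<subseteq> {0, l e}"
    proof
      fix t assume "t \<in> sect e V"
      then have "t \<in> {0..l e}" "\<pi> e t \<in> V" by (auto simp: sect_def)
      with e have "t \<notin> {0<..<l e}" by blast
      with \<open>t \<in> {0..l e}\<close> have "t = 0 \<or> t = l e" by auto
      then show "t \<in> {0, l e}" by auto
    qed
    then show "finite (sect e V)" by (rule finite_subset) simp
  qed
  ultimately show "\<exists>A. countable A \<and> A \<subseteq> sets (tleb \<Gamma>) \<and> \<Union> A = space (tleb \<Gamma>) \<and>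
      (\<forall>a\<in>A. emeasure (tleb \<Gamma>) a \<noteq> \<infinity>)"
    using countable_E I by (intro exI[of _ "insert V (?I ` E)"]) (auto simp: points_def)
qed

section \<open>The order of the tree rooted at a point\<close>

lemma btw_trans:
  assumes "t \<in> btw a x" shows "btw a t \<subseteq> btw a x"
proof
  fix s assume s: "s \<in> btw a t"
  have "coord e s \<in> closed_segment (coord e a) (coord e x)" if "e \<in> E" for e
  proof -
    have "coord e s \<in> closed_segment (coord e a) (coord e t)"
         "coord e t \<in> closed_segment (coord e a) (coord e x)"
      using s assms that by (auto simp: btw_def)
    then show ?thesis unfolding mem_closed_segment_real by linarith
  qed
  then show "s \<in> btw a x" using s by (auto simp: btw_def)
qed

text \<open>
  If \<open>s\<close> is ahead of \<open>t\<close> on \<open>e\<close> and \<open>t\<close> ahead of \<open>s\<close> on \<open>e'\<close>, then both edges are crossed on the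
  way from \<open>a\<close> to \<open>x\<close>, and one of the four points misses the L-shape of \<open>coord_nested\<close>.
\<close>

lemma btw_chain:
  assumes a: "a \<in> X" and x: "x \<in> X" and s: "s \<in> btw a x" and t: "t \<in> btw a x"
  shows "s \<in> btw a t \<or> t \<in> btw a s"
proof (rule ccontr)
  have X: "s \<in> X" "t \<in> X" using s t by (auto simp: btw_def)
  assume "\<not> ?thesis"
  then obtain e e' where e: "e \<in> E" "coord e s \<notin> closed_segment (coord e a) (coord e t)"
    and e': "e' \<in> E" "coord e' t \<notin> closed_segment (coord e' a) (coord e' s)"
    using X by (auto simp: btw_def)
  have seg: "coord f s \<in> closed_segment (coord f a) (coord f x)"
      "coord f t \<in> closed_segment (coord f a) (coord f x)" if "f \<in> E" for f
    using s t that by (auto simp: btw_def)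
  have "e \<noteq> e'"
  proof
    assume "e = e'"
    then show False using seg[OF e(1)] e(2) e'(2) unfolding mem_closed_segment_real by auto
  qed
  define k where "k = coord e (\<pi> e' 0)"
  define k' where "k' = coord e' (\<pi> e 0)"
  have nested: "coord e z = k \<or> coord e' z = k'" if "z \<in> X" for z
    unfolding k_def k'_def by (rule coord_nested[OF e(1) e'(1) \<open>e \<noteq> e'\<close> that])
  have k: "k = 0 \<or> k = l e" "k' = 0 \<or> k' = l e'"
    using coord_corner[of e e'] coord_corner[of e' e] e e' by (auto simp: k_def k'_def)
  have range: "0 \<le> coord e z" "coord e z \<le> l e" "0 \<le> coord e' z" "coord e' z \<le> l e'" for z
    using coord_range[OF e(1), of z] coord_range[OF e'(1), of z] by auto
  have 1: "coord e s \<noteq> coord e t" "coord e' s \<noteq> coord e' t" using e e' by auto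
  show False
  proof (cases "coord e s = k")
    case True
    then have "coord e' t = k'" using 1 nested[OF X(2)] by auto
    then have "coord e a \<noteq> k" "coord e' a \<noteq> k'"
      using True seg[OF e(1)] seg[OF e'(1)] e e' k range unfolding mem_closed_segment_real
      by (smt (verit))+
    then show False using nested[OF a] by blast
  next
    case False
    then have "coord e' s = k'" "coord e t = k" using 1 nested[OF X(1)] nested[OF X(2)] by auto
    then have "coord e x \<noteq> k" "coord e' x \<noteq> k'"
      using False seg[OF e(1)] seg[OF e'(1)] e e' k range 1 unfolding mem_closed_segment_real
      by (smt (verit))+
    then show False using nested[OF x] by blast
  qed
qed

text \<open>A countable order-dense set; with it the order becomes a countable union of measurable
  rectangles.\<close>

definition rational_points :: "'a set" where
  "rational_points = (\<Union>e\<in>E. \<pi> e ` (\<rat> \<inter> {0..l e}))"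

lemma countable_rational_points: "countable rational_points"
  unfolding rational_points_def using countable_E countable_rat
  by (intro countable_UN countable_image) auto

lemma rational_points_subset: "rational_points \<subseteq> X"
  by (auto simp: rational_points_def)

text \<open>On an edge where \<open>t\<close> and \<open>x\<close> differ, take a rational parameter
  strictly between them. On any other edge the new point has the corner coordinate, which by
  \<open>coord_nested\<close> is also the coordinate of \<open>t\<close> or of
  \<open>x\<close>.\<close>

lemma rational_points_dense:
  assumes x: "x \<in> X" and t: "t \<in> btw a x" and ne: "t \<noteq> x"
  obtains q where "q \<in> rational_points" "t \<in> btw a q" "q \<in> btw a x"
proof -
  have tX: "t \<in> X" using t by (simp add: btw_def)
  obtain e where e: "e \<in> E" "coord e t \<noteq> coord e x" using coord_separates[OF tX x] ne by blast
  then have "min (coord e t) (coord e x) < max (coord e t) (coord e x)" by linarith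
  then obtain r where r: "r \<in> \<rat>" "min (coord e t) (coord e x) < r" "r < max (coord e t) (coord e x)"
    using Rats_dense_in_real by blast
  have r': "r \<in> {0..l e}" using r coord_range[OF e(1), of t] coord_range[OF e(1), of x] by auto
  have q: "coord f (\<pi> e r) \<in> closed_segment (coord f t) (coord f x)" if f: "f \<in> E" for f
  proof (cases "f = e")
    case True
    then show ?thesis using e r r' unfolding mem_closed_segment_real by auto
  next
    case False
    have "coord f (\<pi> e r) = coord f (\<pi> e 0)" using coord_other[of f e r] False e f r' by blast
    moreover have "coord f t = coord f (\<pi> e 0) \<or> coord f x = coord f (\<pi> e 0)"
      using coord_nested[OF e(1) f _ tX] coord_nested[OF e(1) f _ x] e False by metis
    ultimately show ?thesis by auto
  qed
  have "coord f t \<in> closed_segment (coord f a) (coord f (\<pi> e r)) \<and>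
      coord f (\<pi> e r) \<in> closed_segment (coord f a) (coord f x)" if f: "f \<in> E" for f
  proof -
    have "coord f t \<in> closed_segment (coord f a) (coord f x)" using t f by (simp add: btw_def)
    with q[OF f] show ?thesis unfolding mem_closed_segment_real by linarith
  qed
  moreover have "\<pi> e r \<in> rational_points" using e(1) r(1) r' unfolding rational_points_def by blast
  ultimately show thesis
    using tX e r r' by (intro that[of "\<pi> e r"]) (auto simp: btw_def)
qed

end

section \<open>Path orders\<close>

text \<open>
  The measure-theoretic content of a rooted tree: \<open>P x\<close> is the set of predecessors of \<open>x\<close>, \<open>d\<close>
  a strictly monotone height and \<open>D\<close> a countable order-dense set.
\<close>

locale path_order = sigma_finite_measure M for M :: "'a measure" +
  fixes P :: "'a \<Rightarrow> 'a set" and d :: "'a \<Rightarrow> real" and D :: "'a set"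
  assumes P_sets [measurable]: "x \<in> space M \<Longrightarrow> P x \<in> sets M"
    and P_refl: "x \<in> space M \<Longrightarrow> x \<in> P x"
    and P_trans: "x \<in> space M \<Longrightarrow> t \<in> P x \<Longrightarrow> P t \<subseteq> P x"
    and P_chain: "x \<in> space M \<Longrightarrow> s \<in> P x \<Longrightarrow> t \<in> P x \<Longrightarrow> s \<in> P t \<or> t \<in> P s"
    and d_less: "x \<in> space M \<Longrightarrow> t \<in> P x \<Longrightarrow> t \<noteq> x \<Longrightarrow> d t < d x"
    and cone_point: "t \<in> space M \<Longrightarrow> {x \<in> space M. t \<in> P x} \<in> sets M"
    and countable_D: "countable D" and D_subset: "D \<subseteq> space M"
    and D_dense: "x \<in> space M \<Longrightarrow> t \<in> P x \<Longrightarrow> t \<noteq> x \<Longrightarrow> \<exists>q\<in>D. t \<in> P q \<and> q \<in> P x"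
    and point_null: "x \<in> space M \<Longrightarrow> {x} \<in> null_sets M"
begin

section \<open>Chains, branches and the greedy choice of roots\<close>

lemma P_space: "x \<in> space M \<Longrightarrow> t \<in> P x \<Longrightarrow> t \<in> space M"
  using sets.sets_into_space[OF P_sets] by blast

definition path_chain :: "'a set \<Rightarrow> bool" where
  "path_chain H \<longleftrightarrow> H \<subseteq> space M \<and> (\<forall>s\<in>H. \<forall>t\<in>H. s \<in> P t \<or> t \<in> P s)"

text \<open>The real-valued height keeps the cofinality countable. A highest point of the chain
  dominates all others; if there is none, it is enough to choose, for each rational exceeded by some
  height, one point of greater height.\<close>

lemma countable_cofinal:
  assumes H: "path_chain H" "H \<noteq> {}"
  shows "\<exists>K. K \<subseteq> H \<and> K \<noteq> {} \<and> countable K \<and> (\<forall>h\<in>H. \<exists>k\<in>K. h \<in> P k)"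
proof (cases "\<exists>m\<in>H. \<forall>h\<in>H. d h \<le> d m")
  case True
  then obtain m where m: "m \<in> H" "\<And>h. h \<in> H \<Longrightarrow> d h \<le> d m" by blast
  have "h \<in> P m" if h: "h \<in> H" for h
  proof -
    have "h \<in> space M" "h \<in> P m \<or> m \<in> P h" using H m h by (auto simp: path_chain_def)
    then show ?thesis using d_less[of h m] m(2)[OF h] by force
  qed
  then show ?thesis using m(1) by (intro exI[of _ "{m}"]) auto
next
  case False
  define g where "g r = (SOME h. h \<in> H \<and> r < d h)" for r
  define K where "K = g ` {r\<in>\<rat>. \<exists>h\<in>H. r < d h}"
  have g: "g r \<in> H \<and> r < d (g r)" if "\<exists>h\<in>H. r < d h" for r
    unfolding g_def by (rule someI_ex) (use that in blast)
  have cof: "\<exists>k\<in>K. h \<in> P k" if h: "h \<in> H" for h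
  proof -
    obtain h' where h': "h' \<in> H" "d h < d h'" using False h by (meson not_le)
    then obtain r where r: "r \<in> \<rat>" "d h < r" "r < d h'" using Rats_dense_in_real by blast
    then have "g r \<in> H" "r < d (g r)" using g h' by blast+
    moreover have "g r \<notin> P h"
      using d_less[of h "g r"] h H(1) \<open>r < d (g r)\<close> r(2) by (force simp: path_chain_def)
    ultimately have "h \<in> P (g r)" using H(1) h by (auto simp: path_chain_def)
    moreover have "g r \<in> K" unfolding K_def using r h' by blast
    ultimately show ?thesis by blast
  qed
  have "countable K" unfolding K_def
    by (intro countable_image countable_subset[OF _ countable_rat]) auto
  moreover have "K \<subseteq> H" unfolding K_def using g by blast
  ultimately show ?thesis using cof H(2) by (intro exI[of _ K]) blast
qed

text \<open>Running maxima of an enumeration of a countable cofinal subset.\<close>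

lemma cofinal_sequence:
  assumes H: "path_chain H" "H \<noteq> {}"
  obtains y :: "nat \<Rightarrow> 'a" where "\<And>n. y n \<in> H" "\<And>n. P (y n) \<subseteq> P (y (Suc n))"
    "\<And>h. h \<in> H \<Longrightarrow> \<exists>n. h \<in> P (y n)"
proof -
  obtain K where K: "K \<subseteq> H" "K \<noteq> {}" "countable K" "\<And>h. h \<in> H \<Longrightarrow> \<exists>k\<in>K. h \<in> P k"
    using countable_cofinal[OF H] by blast
  define g where "g = from_nat_into K"
  have g: "g n \<in> H" for n using from_nat_into[OF K(2)] K(1) by (auto simp: g_def)
  define y where "y = rec_nat (g 0) (\<lambda>n z. if z \<in> P (g (Suc n)) then g (Suc n) else z)"
  have y0: "y 0 = g 0" and yS: "y (Suc n) = (if y n \<in> P (g (Suc n)) then g (Suc n) else y n)" for n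
    by (simp_all add: y_def)
  have yH: "y n \<in> H" for n by (induction n) (auto simp: y0 yS g)
  have sp: "h \<in> space M" if "h \<in> H" for h using H that by (auto simp: path_chain_def)
  have mono: "P (y n) \<subseteq> P (y (Suc n))" for n
    using P_trans[OF sp[OF g]] by (auto simp: yS)
  have gy: "g n \<in> P (y n)" for n
  proof (cases n)
    case 0
    then show ?thesis using P_refl[OF sp[OF g]] by (simp add: y0)
  next
    case (Suc m)
    then show ?thesis using P_refl[OF sp[OF g]] H(1) yH[of m] g[of "Suc m"]
      by (auto simp: yS path_chain_def)
  qed
  have "\<exists>n. h \<in> P (y n)" if "h \<in> H" for h
  proof -
    obtain k where k: "k \<in> K" "h \<in> P k" using K(4) \<open>h \<in> H\<close> by blast
    obtain n where "k = g n" using k(1) from_nat_into_surj[OF K(3) k(1)] unfolding g_def by metis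
    then have "k \<in> P (y n)" using gy by simp
    then show ?thesis using P_trans[OF sp[OF yH]] k(2) by blast
  qed
  with yH mono show thesis by (rule that)
qed

text \<open>An initial segment that may lack a last point. A root is represented by the segment
  before it, so limits of chains need not exist in the space.\<close>

definition branch :: "'a set \<Rightarrow> bool" where
  "branch Q \<longleftrightarrow> (\<exists>y :: nat \<Rightarrow> 'a. range y \<subseteq> space M \<and> (\<forall>n. P (y n) \<subseteq> P (y (Suc n))) \<and>
     Q = (\<Union>n. P (y n)))"

definition shadow :: "'a set \<Rightarrow> 'a set" where
  "shadow Q = {x \<in> space M. Q \<subseteq> P x}"

lemma branch_cofinal:
  assumes "path_chain H" "H \<noteq> {}"
  obtains Q y where "branch Q" "H \<subseteq> Q" "\<And>n. y n \<in> H" "\<And>n. P (y n) \<subseteq> P (y (Suc n))"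
    "Q = (\<Union>n::nat. P (y n))"
proof -
  obtain y :: "nat \<Rightarrow> 'a" where y: "\<And>n. y n \<in> H" "\<And>n. P (y n) \<subseteq> P (y (Suc n))"
    "\<And>h. h \<in> H \<Longrightarrow> \<exists>n. h \<in> P (y n)" using cofinal_sequence[OF assms] by blast
  have "branch (\<Union>n. P (y n))"
    unfolding branch_def using y(1,2) assms(1) by (intro exI[of _ y]) (auto simp: path_chain_def)
  with y show thesis by (intro that) auto
qed

lemma branch_sets: "branch Q \<Longrightarrow> Q \<in> sets M"
  unfolding branch_def using P_sets by (auto intro!: sets.countable_UN)

lemma branch_down:
  assumes "branch Q" "t \<in> Q" shows "P t \<subseteq> Q"
proof -
  obtain y :: "nat \<Rightarrow> 'a" where y: "range y \<subseteq> space M" "Q = (\<Union>n. P (y n))"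
    using assms(1) by (auto simp: branch_def)
  then obtain n where "t \<in> P (y n)" using assms(2) by blast
  moreover have "y n \<in> space M" using y(1) by blast
  ultimately show ?thesis using P_trans y(2) by blast
qed

text \<open>Turns inclusion of a whole branch into countably many cone conditions; both the
  measurability of shadows and continuity from above depend on it.\<close>

lemma shadow_seq:
  assumes y: "range y \<subseteq> space M" and Q: "Q = (\<Union>n. P (y n))"
  shows "shadow Q = (\<Inter>n. {x \<in> space M. y n \<in> P x})"
proof -
  have "y n \<in> P (y n)" for n using y P_refl by blast
  then have "(\<Union>n. P (y n)) \<subseteq> P x \<longleftrightarrow> (\<forall>n. y n \<in> P x)" if "x \<in> space M" for x
    using P_trans[OF that] by (auto simp: subset_iff)
  then show ?thesis by (auto simp: shadow_def Q)
qed

lemma shadow_sets [measurable]: "branch Q \<Longrightarrow> shadow Q \<in> sets M"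
proof -
  assume "branch Q"
  then obtain y :: "nat \<Rightarrow> 'a" where y: "range y \<subseteq> space M" "Q = (\<Union>n. P (y n))"
    by (auto simp: branch_def)
  then have "{x \<in> space M. y n \<in> P x} \<in> sets M" for n using cone_point[of "y n"] by auto
  then show "shadow Q \<in> sets M" unfolding shadow_seq[OF y] by auto
qed

text \<open>The points at which the contribution of \<open>t\<close> is lost when integration stops
  at the last root.\<close>

definition unrooted :: "'a set set \<Rightarrow> 'a \<Rightarrow> 'a set" where
  "unrooted R t = {x \<in> space M. t \<in> P x \<and> \<not> (\<exists>Q\<in>R. t \<in> Q \<and> Q \<subseteq> P x)}"

lemma unrooted_sets:
  assumes "finite R" "\<And>Q. Q \<in> R \<Longrightarrow> branch Q" "t \<in> space M"
  shows "unrooted R t \<in> sets M"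
proof -
  have "unrooted R t = {x \<in> space M. t \<in> P x} - (\<Union>Q\<in>{Q\<in>R. t \<in> Q}. shadow Q)"
    by (auto simp: unrooted_def shadow_def)
  also have "\<dots> \<in> sets M"
    using assms by (intro sets.Diff sets.finite_UN shadow_sets cone_point) auto
  finally show ?thesis .
qed

text \<open>Zorn's lemma for chains of points satisfying \<open>\<Phi>\<close>. In the greedy
  choice, \<open>\<Phi>\<close> says that the cone beyond a point is heavy.\<close>

lemma maximal_heavy_chain:
  assumes t0: "t0 \<in> space M" "\<Phi> t0"
  obtains H where "path_chain H" "H \<noteq> {}" "\<And>h. h \<in> H \<Longrightarrow> \<Phi> h"
    "\<And>t. t \<in> space M \<Longrightarrow> \<Phi> t \<Longrightarrow> H \<subseteq> P t \<Longrightarrow> t \<in> H"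
proof -
  define A where "A = {H. path_chain H \<and> (\<forall>h\<in>H. \<Phi> h)}"
  have "\<Union>C \<in> A" if C: "subset.chain A C" for C
  proof -
    have CA: "H \<in> A" if "H \<in> C" for H using C that by (auto simp: subset.chain_def)
    have "s \<in> P t \<or> t \<in> P s" if st: "s \<in> \<Union>C" "t \<in> \<Union>C" for s t
    proof -
      obtain H1 H2 where H: "s \<in> H1" "H1 \<in> C" "t \<in> H2" "H2 \<in> C" using st by blast
      then have "H1 \<subseteq> H2 \<or> H2 \<subseteq> H1" using C by (auto simp: subset.chain_def)
      then obtain H3 where "s \<in> H3" "t \<in> H3" "H3 \<in> C" using H by blast
      then show ?thesis using CA by (auto simp: A_def path_chain_def)
    qed
    moreover have "\<Union>C \<subseteq> space M" "\<forall>h\<in>\<Union>C. \<Phi> h" using CA unfolding A_def path_chain_def by blast+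
    ultimately show ?thesis by (simp add: A_def path_chain_def)
  qed
  then obtain H where H: "H \<in> A" "\<And>H'. H' \<in> A \<Longrightarrow> H \<subseteq> H' \<Longrightarrow> H' = H"
    using subset_Zorn'[of A] by blast
  have "{t0} \<in> A" using t0 P_refl by (auto simp: A_def path_chain_def)
  then have "H \<noteq> {}" using H(2)[of "{t0}"] by blast
  moreover have "t \<in> H" if t: "t \<in> space M" "\<Phi> t" "H \<subseteq> P t" for t
  proof -
    have "insert t H \<in> A" using H(1) t P_refl[OF t(1)] by (auto simp: A_def path_chain_def)
    then show ?thesis using H(2)[of "insert t H"] by blast
  qed
  ultimately show thesis using H(1) by (intro that[of H]) (auto simp: A_def)
qed

text \<open>
  Greedy choice of roots: a maximal chain of points with heavy shadows gives a branch whose shadow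
  is still heavy, while nothing above it is; remove that shadow and continue.
\<close>

lemma roots_exist:
  fixes \<nu> :: "'a measure" and \<delta> :: real
  assumes fin: "finite_measure \<nu>" and sets: "sets \<nu> = sets M" and \<delta>: "0 < \<delta>"
    and A: "A \<in> sets M"
  shows "\<exists>R. finite R \<and> (\<forall>Q\<in>R. branch Q \<and> shadow Q \<noteq> {}) \<and> real (card R) * \<delta> \<le> measure \<nu> A \<and>
    (\<forall>t\<in>space M. measure \<nu> (A \<inter> unrooted R t) \<le> \<delta>)"
proof -
  interpret \<nu>: finite_measure \<nu> by (rule fin)
  \<comment> \<open>Each root removes a shadow of mass at least \<open>\<delta>\<close>, so the mass
    counted in units of \<open>\<delta>\<close> drops by at least one.\<close>
  have "measure \<nu> A < real (Suc n) * \<delta> \<Longrightarrow> ?thesis" for n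
    using A
  proof (induction n arbitrary: A)
    case 0
    have "measure \<nu> (A \<inter> unrooted {} t) \<le> \<delta>" if "t \<in> space M" for t
    proof -
      have "measure \<nu> (A \<inter> unrooted {} t) \<le> measure \<nu> A"
        using 0 sets by (intro \<nu>.finite_measure_mono) auto
      then show ?thesis using 0 by simp
    qed
    then show ?case by (intro exI[of _ "{}"]) auto
  next
    case (Suc n)
    have C_sets: "A \<inter> {x \<in> space M. t \<in> P x} \<in> sets \<nu>" if "t \<in> space M" for t
      using cone_point[OF that] Suc.prems sets by auto
    define \<Phi> where "\<Phi> t \<longleftrightarrow> \<delta> \<le> measure \<nu> (A \<inter> {x \<in> space M. t \<in> P x})" for t
    show ?case
    proof (cases "\<exists>t\<in>space M. \<Phi> t")
      case False
      have "measure \<nu> (A \<inter> unrooted {} t) \<le> \<delta>" if t: "t \<in> space M" for t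
      proof -
        have "unrooted {} t = {x \<in> space M. t \<in> P x}" by (auto simp: unrooted_def)
        then show ?thesis using False t unfolding \<Phi>_def by force
      qed
      then show ?thesis by (intro exI[of _ "{}"]) auto
    next
      case True
      then obtain H where H: "path_chain H" "H \<noteq> {}" "\<And>h. h \<in> H \<Longrightarrow> \<Phi> h"
        "\<And>t. t \<in> space M \<Longrightarrow> \<Phi> t \<Longrightarrow> H \<subseteq> P t \<Longrightarrow> t \<in> H"
        using maximal_heavy_chain[of _ \<Phi>] by metis
      obtain Q y where Q: "branch Q" "H \<subseteq> Q" and y: "\<And>n. y n \<in> H" "\<And>n. P (y n) \<subseteq> P (y (Suc n))"
        and Qy: "Q = (\<Union>n::nat. P (y n))"
        using branch_cofinal[OF H(1,2)] by metis
      have ysp: "range y \<subseteq> space M" using y(1) H(1) by (auto simp: path_chain_def)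
      let ?E = "\<lambda>n. A \<inter> {x \<in> space M. y n \<in> P x}"
      have E_sets: "range ?E \<subseteq> sets \<nu>" using C_sets ysp by blast
      have "decseq ?E"
      proof (rule decseq_SucI)
        fix n
        have "y n \<in> P (y n)" using P_refl ysp by blast
        then have "y n \<in> P (y (Suc n))" using y(2) by blast
        then show "?E (Suc n) \<le> ?E n" using P_trans by (auto simp: subset_iff)
      qed
      \<comment> \<open>Continuity from above, where finiteness of \<open>\<nu>\<close> enters: the
        cones beyond the points \<open>y n\<close> are all heavy and decrease to the shadow.\<close>
      from \<nu>.finite_Lim_measure_decseq[OF E_sets this]
      have "(\<lambda>n. measure \<nu> (?E n)) \<longlonglongrightarrow> measure \<nu> (\<Inter>n. ?E n)" .
      moreover have "(\<Inter>n. ?E n) = A \<inter> shadow Q" unfolding shadow_seq[OF ysp Qy] by blast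
      moreover have "\<delta> \<le> measure \<nu> (?E n)" for n using H(3)[OF y(1)] by (simp add: \<Phi>_def)
      ultimately have heavy: "\<delta> \<le> measure \<nu> (A \<inter> shadow Q)"
        by (intro LIMSEQ_le_const[where X = "\<lambda>n. measure \<nu> (?E n)"]) auto
      then have ne: "shadow Q \<noteq> {}" using \<delta> by auto
      have split: "measure \<nu> A = measure \<nu> (A - shadow Q) + measure \<nu> (A \<inter> shadow Q)"
        using \<nu>.finite_measure_Diff'[of A "shadow Q"] Suc.prems shadow_sets[OF Q(1)] sets by simp
      have "measure \<nu> (A - shadow Q) < real (Suc n) * \<delta>"
        using split heavy Suc.prems by (simp add: algebra_simps)
      moreover have A': "A - shadow Q \<in> sets M" using Suc.prems shadow_sets[OF Q(1)] by auto
      ultimately obtain R where R: "finite R" "\<And>Q. Q \<in> R \<Longrightarrow> branch Q \<and> shadow Q \<noteq> {}"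
        "real (card R) * \<delta> \<le> measure \<nu> (A - shadow Q)"
        "\<And>t. t \<in> space M \<Longrightarrow> measure \<nu> ((A - shadow Q) \<inter> unrooted R t) \<le> \<delta>"
        using Suc.IH[of "A - shadow Q"] by blast
      have "measure \<nu> (A \<inter> unrooted (insert Q R) t) \<le> \<delta>" if t: "t \<in> space M" for t
      proof (cases "A \<inter> unrooted (insert Q R) t \<inter> shadow Q = {}")
        case True
        then have "A \<inter> unrooted (insert Q R) t \<subseteq> (A - shadow Q) \<inter> unrooted R t"
          by (auto simp: unrooted_def)
        then have "measure \<nu> (A \<inter> unrooted (insert Q R) t) \<le> measure \<nu> ((A - shadow Q) \<inter> unrooted R t)"
          using A' unrooted_sets[of R t] R t sets by (intro \<nu>.finite_measure_mono) auto
        then show ?thesis using R(4)[OF t] by simp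
      next
        case False
        \<comment> \<open>Some \<open>x\<close> beyond \<open>Q\<close> is not separated from
          \<open>t\<close> by \<open>Q\<close>, so \<open>t\<close> is outside \<open>Q\<close> and
          therefore beyond all of \<open>H\<close>. By maximality of the chain such a
          \<open>t\<close> is light.\<close>
        then obtain x where x: "x \<in> space M" "t \<in> P x" "Q \<subseteq> P x" "t \<notin> Q"
          by (auto simp: unrooted_def shadow_def)
        have "H \<subseteq> P t"
        proof
          fix h assume h: "h \<in> H"
          have "h \<in> P t \<or> t \<in> P h" using P_chain[OF x(1), of h t] x Q(2) h by blast
          then show "h \<in> P t" using branch_down[OF Q(1), of h] h Q(2) x(4) by blast
        qed
        then have "\<not> \<Phi> t" using H(4)[OF t] Q(2) x(4) by blast
        moreover have "measure \<nu> (A \<inter> unrooted (insert Q R) t) \<le> measure \<nu> (A \<inter> {x \<in> space M. t \<in> P x})"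
          using C_sets[OF t] by (intro \<nu>.finite_measure_mono) (auto simp: unrooted_def)
        ultimately show ?thesis unfolding \<Phi>_def by simp
      qed
      moreover have "real (card (insert Q R)) * \<delta> \<le> measure \<nu> A"
      proof -
        have "real (card (insert Q R)) * \<delta> \<le> (real (card R) + 1) * \<delta>"
          using \<delta> card_insert_le_m1[of "Suc (card R)" R Q] by (intro mult_right_mono) auto
        then show ?thesis using R(3) split heavy by (simp add: algebra_simps)
      qed
      ultimately show ?thesis using R(1,2) Q(1) ne by (intro exI[of _ "insert Q R"]) auto
    qed
  qed
  moreover obtain n where "measure \<nu> A < real (Suc n) * \<delta>"
  proof -
    obtain n where "measure \<nu> A / \<delta> < real n" using reals_Archimedean2 by blast
    then have "measure \<nu> A < real (Suc n) * \<delta>" using \<delta> by (simp add: field_simps)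
    then show thesis by (rule that)
  qed
  ultimately show ?thesis by blast
qed

text \<open>The order relation up to the diagonal, written so that it is visibly measurable.\<close>

definition below :: "('a \<times> 'a) set" where
  "below = (\<Union>q\<in>D. P q \<times> {x \<in> space M. q \<in> P x})"

lemma below_sets [measurable]: "below \<in> sets (M \<Otimes>\<^sub>M M)"
  unfolding below_def using countable_D D_subset P_sets cone_point
  by (intro sets.countable_UN'') auto

lemma below_D: "(t, x) \<in> below \<Longrightarrow> t \<in> P x \<and> x \<in> space M"
  unfolding below_def using P_trans by blast

lemma below_iff: "x \<in> space M \<Longrightarrow> t \<noteq> x \<Longrightarrow> (t, x) \<in> below \<longleftrightarrow> t \<in> P x"
  using below_D D_dense[of x t] unfolding below_def by blast

section \<open>Joint measurability and the last root before a point\<close>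

lemma AE_neq: "x \<in> space M \<Longrightarrow> AE t in M. t \<noteq> x"
  using AE_not_in[OF point_null[of x]] by simp

text \<open>A jointly measurable form of \<open>x \<in> unrooted R t\<close>, with which it agrees
  off the diagonal, as Tonelli's theorem demands.\<close>

definition unrooted_pairs :: "'a set set \<Rightarrow> ('a \<times> 'a) set" where
  "unrooted_pairs R = below - (\<Union>Q\<in>R. Q \<times> shadow Q)"

lemma unrooted_pairs_sets:
  assumes "finite R" "\<And>Q. Q \<in> R \<Longrightarrow> branch Q"
  shows "unrooted_pairs R \<in> sets (M \<Otimes>\<^sub>M M)"
  unfolding unrooted_pairs_def using assms
  by (intro sets.Diff sets.finite_UN pair_measureI branch_sets shadow_sets below_sets) auto

lemma unrooted_pairs_D: "(t, x) \<in> unrooted_pairs R \<Longrightarrow> x \<in> unrooted R t"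
  using below_D[of t x] by (auto simp: unrooted_pairs_def unrooted_def shadow_def)

lemma unrooted_pairs_iff:
  "x \<in> space M \<Longrightarrow> t \<noteq> x \<Longrightarrow> (t, x) \<in> unrooted_pairs R \<longleftrightarrow> x \<in> unrooted R t"
  using below_iff[of x t] by (auto simp: unrooted_pairs_def unrooted_def shadow_def)

text \<open>Roots before a common point are nested, so the union is the longest of finitely many, or
  empty if there is none; see \<open>root_of_cases\<close>.\<close>

definition root_of :: "'a set set \<Rightarrow> 'a \<Rightarrow> 'a set" where
  "root_of R x = \<Union>{Q\<in>R. Q \<subseteq> P x}"

lemma root_of_subset: "root_of R x \<subseteq> P x"
  by (auto simp: root_of_def)

lemma root_of_sets:
  "finite R \<Longrightarrow> (\<And>Q. Q \<in> R \<Longrightarrow> branch Q) \<Longrightarrow> root_of R x \<in> sets M"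
  unfolding root_of_def using branch_sets by (intro sets.finite_Union) auto

lemma not_in_root_of: "x \<in> space M \<Longrightarrow> t \<in> P x - root_of R x \<longleftrightarrow> x \<in> unrooted R t"
  by (auto simp: root_of_def unrooted_def)

lemma branch_comparable:
  assumes "branch Q" "branch Q'" "x \<in> space M" "Q \<subseteq> P x" "Q' \<subseteq> P x"
  shows "Q \<subseteq> Q' \<or> Q' \<subseteq> Q"
proof (rule ccontr)
  assume "\<not> ?thesis"
  then obtain s t where st: "s \<in> Q" "s \<notin> Q'" "t \<in> Q'" "t \<notin> Q" by blast
  then have "s \<in> P t \<or> t \<in> P s" using P_chain[OF assms(3)] assms(4,5) by blast
  then show False using branch_down[OF assms(1), of s] branch_down[OF assms(2), of t] st by blast
qed

lemma root_of_cases: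
  assumes "finite R" "\<And>Q. Q \<in> R \<Longrightarrow> branch Q" "x \<in> space M"
  shows "root_of R x = {} \<or> root_of R x \<in> R"
proof (cases "{Q\<in>R. Q \<subseteq> P x} = {}")
  case False
  then have "\<Union>{Q\<in>R. Q \<subseteq> P x} \<in> {Q\<in>R. Q \<subseteq> P x}"
  proof (intro Union_in_chain)
    have "Q \<subset> Q' \<or> Q = Q' \<or> Q' \<subset> Q" if "Q \<in> {Q\<in>R. Q \<subseteq> P x}" "Q' \<in> {Q\<in>R. Q \<subseteq> P x}" for Q Q'
      using branch_comparable[of Q Q' x] assms that by blast
    then show "subset.chain UNIV {Q\<in>R. Q \<subseteq> P x}"
      unfolding subset.chain_def by blast
  qed (use assms False in auto)
  then show ?thesis by (auto simp: root_of_def)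
next
  case True
  then show ?thesis unfolding root_of_def by (metis Union_empty)
qed

lemma root_of_eq_sets:
  assumes "finite R" "\<And>Q. Q \<in> R \<Longrightarrow> branch Q" "Q \<in> R"
  shows "{x \<in> space M. root_of R x = Q} \<in> sets M"
proof -
  have "{x \<in> space M. root_of R x = Q} = shadow Q - (\<Union>Q'\<in>{Q'\<in>R. \<not> Q' \<subseteq> Q}. shadow Q')"
    using assms(3) by (auto simp: root_of_def shadow_def)
  also have "\<dots> \<in> sets M"
    using assms by (intro sets.Diff sets.finite_UN shadow_sets) auto
  finally show ?thesis .
qed

end

section \<open>Weighted estimates along paths\<close>

lemma conj_exp_gt_1: "1 < p \<Longrightarrow> 1 < conj_exp p"
  by (simp add: conj_exp_def field_simps)

lemma conj_exp_inverse: "1 < p \<Longrightarrow> 1 / p + 1 / conj_exp p = 1"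
  by (simp add: conj_exp_def field_simps)

lemma conj_exp_mult: "1 < p \<Longrightarrow> conj_exp p * (p - 1) = p"
  by (simp add: conj_exp_def field_simps)

lemma divide_conj_exp: "1 < p \<Longrightarrow> p / conj_exp p = p - 1"
  by (simp add: conj_exp_def field_simps)

text \<open>Young's inequality, integrated after normalising both factors; the normalisation divides
  by \<open>A\<close> and \<open>B\<close>, hence the separate zero case. Working with nonnegative
  integrals presupposes no integrability of the product, which is instead a consequence.\<close>

lemma nn_integral_Holder:
  fixes F H :: "'a \<Rightarrow> real"
  assumes p: "1 < p" and [measurable]: "F \<in> borel_measurable M" "H \<in> borel_measurable M"
    and nonneg: "\<And>x. 0 \<le> F x" "\<And>x. 0 \<le> H x" "0 \<le> A" "0 \<le> B"
    and A: "(\<integral>\<^sup>+x. ennreal (F x powr p) \<partial>M) \<le> ennreal A"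
    and B: "(\<integral>\<^sup>+x. ennreal (H x powr conj_exp p) \<partial>M) \<le> ennreal B"
  shows "(\<integral>\<^sup>+x. ennreal (F x * H x) \<partial>M) \<le> ennreal (A powr (1 / p) * B powr (1 / conj_exp p))"
proof (cases "A = 0 \<or> B = 0")
  case True
  have "AE x in M. F x * H x = 0"
  proof (cases "A = 0")
    case True
    then have "(\<integral>\<^sup>+x. ennreal (F x powr p) \<partial>M) = 0" using A by simp
    then have "AE x in M. ennreal (F x powr p) = 0" by (subst (asm) nn_integral_0_iff_AE) auto
    then show ?thesis by eventually_elim (auto simp: ennreal_eq_0_iff)
  next
    case False
    then have "(\<integral>\<^sup>+x. ennreal (H x powr conj_exp p) \<partial>M) = 0" using B True by simp
    then have "AE x in M. ennreal (H x powr conj_exp p) = 0" by (subst (asm) nn_integral_0_iff_AE) auto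
    then show ?thesis by eventually_elim (auto simp: ennreal_eq_0_iff)
  qed
  then have "(\<integral>\<^sup>+x. ennreal (F x * H x) \<partial>M) = (\<integral>\<^sup>+x. 0 \<partial>M)"
    by (intro nn_integral_cong_AE) auto
  then show ?thesis by simp
next
  case False
  then have pos: "0 < A" "0 < B" using nonneg by auto
  define q where "q = conj_exp p"
  have q: "1 < q" "1 / p + 1 / q = 1" using conj_exp_gt_1 conj_exp_inverse p by (auto simp: q_def)
  define \<alpha> where "\<alpha> = A powr (1 / p)"
  define \<beta> where "\<beta> = B powr (1 / q)"
  have ab: "0 < \<alpha>" "0 < \<beta>" "\<alpha> powr p = A" "\<beta> powr q = B"
    using pos p q by (auto simp: \<alpha>_def \<beta>_def powr_powr)
  have pw: "F x * H x \<le> \<alpha> * \<beta> / (p * A) * F x powr p + \<alpha> * \<beta> / (q * B) * H x powr q" for x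
  proof -
    have "F x / \<alpha> * (H x / \<beta>) \<le> (F x / \<alpha>) powr p / p + (H x / \<beta>) powr q / q"
      using nonneg ab by (intro Youngs_inequality[OF p q]) auto
    also have "\<dots> = F x powr p / (p * A) + H x powr q / (q * B)"
      using ab nonneg by (simp add: powr_divide field_simps)
    finally have "F x / \<alpha> * (H x / \<beta>) * (\<alpha> * \<beta>) \<le> (F x powr p / (p * A) + H x powr q / (q * B)) * (\<alpha> * \<beta>)"
      using ab by (intro mult_right_mono) auto
    then show ?thesis using ab by (simp add: field_simps)
  qed
  have "(\<integral>\<^sup>+x. ennreal (F x * H x) \<partial>M) \<le>
      (\<integral>\<^sup>+x. ennreal (\<alpha> * \<beta> / (p * A)) * ennreal (F x powr p) + ennreal (\<alpha> * \<beta> / (q * B)) * ennreal (H x powr q) \<partial>M)"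
    using pw ab pos p q by (intro nn_integral_mono) (simp add: ennreal_mult[symmetric] ennreal_plus[symmetric] ennreal_leI del: ennreal_plus)
  also have "\<dots> = ennreal (\<alpha> * \<beta> / (p * A)) * (\<integral>\<^sup>+x. ennreal (F x powr p) \<partial>M) +
      ennreal (\<alpha> * \<beta> / (q * B)) * (\<integral>\<^sup>+x. ennreal (H x powr q) \<partial>M)"
    by (simp add: nn_integral_add nn_integral_cmult)
  also have "\<dots> \<le> ennreal (\<alpha> * \<beta> / (p * A)) * ennreal A + ennreal (\<alpha> * \<beta> / (q * B)) * ennreal B"
    using A B by (intro add_mono mult_left_mono) (auto simp: q_def)
  also have "\<dots> = ennreal (\<alpha> * \<beta> / (p * A) * A + \<alpha> * \<beta> / (q * B) * B)"
    using ab pos p q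
    by (simp add: ennreal_mult[symmetric] ennreal_plus[symmetric] del: ennreal_plus)
  also have "\<alpha> * \<beta> / (p * A) * A + \<alpha> * \<beta> / (q * B) * B = \<alpha> * \<beta> * (1 / p + 1 / q)"
    using pos p q(1) by (simp add: field_simps)
  finally show ?thesis using q(2) by (simp add: \<alpha>_def \<beta>_def q_def)
qed

section \<open>Dyadic position and geometric sums\<close>

lemma dyadic_position:
  fixes r y :: real
  assumes "0 < y" "y \<le> r"
  obtains j :: nat where "r / 2 ^ Suc j < y" "y \<le> r / 2 ^ j"
proof -
  have "\<exists>n. r / 2 ^ n < y"
  proof -
    obtain n :: nat where "r / y < 2 ^ n" using real_arch_pow[of 2 "r / y"] by auto
    then show ?thesis using assms by (auto simp: field_simps intro!: exI[of _ n])
  qed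
  then obtain n where n: "r / 2 ^ n < y" "\<And>m. m < n \<Longrightarrow> \<not> r / 2 ^ m < y"
    using exists_least_iff[of "\<lambda>n. r / 2 ^ n < y"] by blast
  then obtain j where "n = Suc j" using assms by (cases n) auto
  then show thesis using n(1) n(2)[of j] by (intro that[of j]) auto
qed

lemma suminf_ennreal_geometric:
  fixes c r :: real
  assumes "0 \<le> c" "0 \<le> r" "r < 1"
  shows "(\<Sum>j. ennreal (c * r ^ j)) = ennreal (c / (1 - r))"
proof -
  have "(\<lambda>j. c * r ^ j) sums (c * (1 / (1 - r)))"
    using assms by (intro sums_mult geometric_sums) auto
  then show ?thesis using assms by (subst suminf_ennreal_eq) auto
qed

lemma le_suminf_ennreal: "f j \<le> (\<Sum>i. f i)" for f :: "nat \<Rightarrow> ennreal"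
  using sum_le_suminf[of f "{j}"] by simp

text \<open>Value of the geometric series in \<open>weighted_mass\<close>. The numerator is the loss
  from replacing \<open>mass t\<close> by the lower end of its dyadic interval, at the power
  -1/2.\<close>

definition mass_const :: real where "mass_const = sqrt 2 / (1 - 1 / sqrt 2)"

text \<open>The exponent is p/p' = p - 1: the second Hoelder factor, raised to the power p.\<close>

definition path_const :: "real \<Rightarrow> real" where "path_const p = mass_const powr (p - 1)"

text \<open>Value of the geometric series in \<open>unrooted_weight\<close>. The numerator is sqrt 2
  twice, once for each of the two points bounded by the upper end of its level.\<close>

definition level_const :: real where "level_const = 2 / (1 - 1 / sqrt 2)"

lemma mass_const_pos: "0 < mass_const"
  and path_const_pos: "0 < path_const p"
  and level_const_pos: "0 < level_const"
  by (simp_all add: mass_const_def path_const_def level_const_def)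

locale hardy_order = path_order M P d D
  for M :: "'a measure" and P d D +
  fixes p :: real and u v :: "'a \<Rightarrow> 'k::{real_normed_field, banach, second_countable_topology}"
  assumes p: "1 < p" and u_measurable [measurable]: "u \<in> borel_measurable M"
    and u_integrable: "x \<in> space M \<Longrightarrow> set_integrable M (P x) (\<lambda>t. norm (u t) powr conj_exp p)"
    and v_Lp: "v \<in> Lp M p"
begin

abbreviation "w t \<equiv> norm (u t) powr conj_exp p"

section \<open>The mass accumulated along a path\<close>

definition mass :: "'a \<Rightarrow> real" where
  "mass x = (LINT t:P x|M. w t)"

lemma mass_nonneg: "0 \<le> mass x"
  unfolding mass_def set_lebesgue_integral_def by (rule Bochner_Integration.integral_nonneg) simp

lemma nn_integral_mass:
  assumes "x \<in> space M"
  shows "(\<integral>\<^sup>+t. ennreal (w t) * indicator (P x) t \<partial>M) = ennreal (mass x)"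
proof -
  have "(\<integral>\<^sup>+t. ennreal (w t) * indicator (P x) t \<partial>M) = (\<integral>\<^sup>+t. ennreal (indicator (P x) t *\<^sub>R w t) \<partial>M)"
    by (intro nn_integral_cong) (auto split: split_indicator)
  also have "\<dots> = ennreal (mass x)"
    unfolding mass_def set_lebesgue_integral_def
    using u_integrable[OF assms] unfolding set_integrable_def
    by (intro nn_integral_eq_integral) auto
  finally show ?thesis .
qed

lemma mass_mono:
  assumes "x \<in> space M" "t \<in> P x" shows "mass t \<le> mass x"
proof -
  have t: "t \<in> space M" using P_space assms by blast
  have "(\<integral>\<^sup>+s. ennreal (w s) * indicator (P t) s \<partial>M) \<le> (\<integral>\<^sup>+s. ennreal (w s) * indicator (P x) s \<partial>M)"
    using P_trans[OF assms] by (intro nn_integral_mono) (auto split: split_indicator)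
  then have "ennreal (mass t) \<le> ennreal (mass x)"
    using nn_integral_mass assms(1) t by simp
  then show ?thesis using mass_nonneg by simp
qed

text \<open>The paths \<open>P x\<close> are measurable one at a time only. Replacing
  \<open>P x\<close> by a section of \<open>below\<close> changes a null set and makes path
  integrals measurable in the end point.\<close>

lemma nn_integral_below:
  assumes x: "x \<in> space M"
  shows "(\<integral>\<^sup>+t. g t * indicator (P x) t \<partial>M) = (\<integral>\<^sup>+t. g t * indicator below (t, x) \<partial>M)"
proof (rule nn_integral_cong_AE)
  show "AE t in M. g t * indicator (P x) t = g t * indicator below (t, x)"
    using AE_neq[OF x] by eventually_elim (use below_iff[OF x] in \<open>auto split: split_indicator\<close>)
qed

lemma mass_measurable [measurable]: "mass \<in> borel_measurable M"
proof -
  have "(\<lambda>(x, t). ennreal (w t) * indicator below (t, x)) \<in> borel_measurable (M \<Otimes>\<^sub>M M)"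
    by measurable
  then have "(\<lambda>x. enn2real (\<integral>\<^sup>+t. ennreal (w t) * indicator below (t, x) \<partial>M)) \<in> borel_measurable M"
    by (intro borel_measurable_enn2real borel_measurable_nn_integral) (simp add: case_prod_beta')
  moreover have "mass x = enn2real (\<integral>\<^sup>+t. ennreal (w t) * indicator below (t, x) \<partial>M)" if "x \<in> space M" for x
    using nn_integral_mass[OF that] nn_integral_below[OF that, of "\<lambda>t. ennreal (w t)"] mass_nonneg
    by simp
  ultimately show ?thesis by (subst measurable_cong) auto
qed

text \<open>The sublevel set is a chain, covered by an increasing sequence of paths
  \<open>P (y n)\<close> with \<open>y n\<close> in the set itself, each of mass at most
  \<open>s\<close>; continuity from below does the rest. This plays the part of the substitution s =
  \<open>mass t\<close>.\<close>

lemma sublevel_mass: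
  assumes x: "x \<in> space M" and s: "0 \<le> s"
  shows "(\<integral>\<^sup>+t. ennreal (w t) * indicator {t \<in> P x. mass t \<le> s} t \<partial>M) \<le> ennreal s"
proof (cases "{t \<in> P x. mass t \<le> s} = {}")
  case False
  define H where "H = {t \<in> P x. mass t \<le> s}"
  have "path_chain H" using P_chain[OF x] P_space[OF x] by (auto simp: path_chain_def H_def)
  moreover have "H \<noteq> {}" using False by (simp add: H_def)
  ultimately obtain Q y where Q: "H \<subseteq> Q" "\<And>n. y n \<in> H" "\<And>n. P (y n) \<subseteq> P (y (Suc n))"
    and Qy: "Q = (\<Union>n::nat. P (y n))"
    using branch_cofinal[of H] by metis
  have y: "y n \<in> space M" for n using Q(2)[of n] P_space[OF x] by (auto simp: H_def)
  let ?N = "density M (\<lambda>t. ennreal (w t))"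
  have "(\<integral>\<^sup>+t. ennreal (w t) * indicator H t \<partial>M) \<le> (\<integral>\<^sup>+t. ennreal (w t) * indicator Q t \<partial>M)"
    using Q(1) by (intro nn_integral_mono) (auto split: split_indicator)
  also have "\<dots> = emeasure ?N Q"
    using P_sets[OF y] unfolding Qy by (subst emeasure_density) auto
  also have "\<dots> = (SUP n. emeasure ?N (P (y n)))"
    unfolding Qy using P_sets[OF y] Q(3) by (intro SUP_emeasure_incseq[symmetric] incseq_SucI) auto
  also have "\<dots> \<le> ennreal s"
  proof (rule SUP_least)
    fix n
    have "emeasure ?N (P (y n)) = ennreal (mass (y n))"
      using P_sets[OF y] by (subst emeasure_density) (auto simp: nn_integral_mass[OF y])
    also have "\<dots> \<le> ennreal s" using Q(2)[of n] by (intro ennreal_leI) (auto simp: H_def)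
    finally show "emeasure ?N (P (y n)) \<le> ennreal s" .
  qed
  finally show ?thesis unfolding H_def .
qed simp

text \<open>The analogue of the integral of s^(-1/2) over (0, r), which is 2 r^(1/2), obtained from
  dyadic sublevel sets.\<close>

lemma weighted_mass:
  assumes x: "x \<in> space M"
  shows "(\<integral>\<^sup>+t. ennreal (w t * mass t powr (-1/2)) * indicator (P x) t \<partial>M) \<le> ennreal (mass_const * mass x powr (1/2))"
proof (cases "mass x = 0")
  case True
  have "(\<integral>\<^sup>+t. ennreal (w t * mass t powr (-1/2)) * indicator (P x) t \<partial>M) = (\<integral>\<^sup>+t. 0 \<partial>M)"
  proof (rule nn_integral_cong)
    fix t
    show "ennreal (w t * mass t powr (-1/2)) * indicator (P x) t = 0"
    proof (cases "t \<in> P x")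
      case True
      then have "mass t = 0" using mass_mono[OF x True] mass_nonneg[of t] \<open>mass x = 0\<close> by simp
      \<comment> \<open>\<open>powr\<close> with base 0 is 0, also for a negative exponent.\<close>
      then show ?thesis by simp
    qed simp
  qed
  then show ?thesis by simp
next
  case False
  define r where "r = mass x"
  have r: "0 < r" using False mass_nonneg[of x] by (simp add: r_def)
  let ?S = "\<lambda>j. {t \<in> P x. mass t \<le> r / 2 ^ j}"
  have S: "?S j \<in> sets M" for j
  proof -
    have "?S j = P x \<inter> {t \<in> space M. mass t \<le> r / 2 ^ j}" using P_space[OF x] by auto
    then show ?thesis using P_sets[OF x] by auto
  qed
  \<comment> \<open>\<open>c j\<close> bounds the weight where \<open>mass t\<close> exceeds r /
    2^(j+1). The sets \<open>?S j\<close> are full sublevel sets and not shells, so that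
    \<open>sublevel_mass\<close> applies; counting points repeatedly only enlarges the upper
    bound.\<close>
  define c where "c j = r powr (-1/2) * sqrt 2 * sqrt 2 ^ j" for j :: nat
  have c: "0 \<le> c j" for j by (simp add: c_def)
  have "(\<integral>\<^sup>+t. ennreal (w t * mass t powr (-1/2)) * indicator (P x) t \<partial>M) \<le>
      (\<integral>\<^sup>+t. (\<Sum>j. ennreal (c j) * (ennreal (w t) * indicator (?S j) t)) \<partial>M)"
  proof (rule nn_integral_mono)
    fix t
    show "ennreal (w t * mass t powr (-1/2)) * indicator (P x) t \<le>
        (\<Sum>j. ennreal (c j) * (ennreal (w t) * indicator (?S j) t))"
    proof (cases "t \<in> P x \<and> 0 < mass t")
      case True
      then have "mass t \<le> r" using mass_mono[OF x] by (simp add: r_def)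
      with True obtain j where j: "r / 2 ^ Suc j < mass t" "mass t \<le> r / 2 ^ j"
        using dyadic_position by blast
      have "mass t powr (-1/2) \<le> (r / 2 ^ Suc j) powr (-1/2)"
        using j(1) r by (intro powr_mono2') auto
      also have "\<dots> = r powr (-1/2) / (2 ^ Suc j) powr (-1/2)"
        using r by (simp add: powr_divide)
      also have "(2 ^ Suc j :: real) powr (-1/2) = 1 / (sqrt 2 * sqrt 2 ^ j)"
        by (simp add: powr_minus_divide powr_half_sqrt real_sqrt_mult real_sqrt_power)
      also have "r powr (-1/2) / (1 / (sqrt 2 * sqrt 2 ^ j)) = c j" by (simp add: c_def)
      finally have "w t * mass t powr (-1/2) \<le> c j * w t"
        by (metis mult.commute mult_left_mono powr_ge_zero)
      then have "ennreal (w t * mass t powr (-1/2)) * indicator (P x) t \<le>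
          ennreal (c j) * (ennreal (w t) * indicator (?S j) t)"
        using True j(2) c by (simp add: ennreal_mult[symmetric] ennreal_leI)
      also have "\<dots> \<le> (\<Sum>j. ennreal (c j) * (ennreal (w t) * indicator (?S j) t))"
        by (rule le_suminf_ennreal)
      finally show ?thesis .
    next
      case False
      then have "mass t = 0 \<or> t \<notin> P x" using mass_nonneg[of t] by auto
      then show ?thesis by auto
    qed
  qed
  also have "\<dots> = (\<Sum>j. ennreal (c j) * (\<integral>\<^sup>+t. ennreal (w t) * indicator (?S j) t \<partial>M))"
    using S by (subst nn_integral_suminf) (auto simp: nn_integral_cmult)
  also have "\<dots> \<le> (\<Sum>j. ennreal (c j) * ennreal (r / 2 ^ j))"
    using sublevel_mass[OF x] r by (intro suminf_le mult_left_mono) auto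
  also have "\<dots> = (\<Sum>j. ennreal (sqrt 2 * r powr (1/2) * (1 / sqrt 2) ^ j))"
  proof (intro arg_cong[where f = suminf] ext)
    fix j
    have "r powr (-1/2) * r = r powr (1/2)"
      using r powr_add[of r "-1/2" 1] by simp
    then have "c j * (r / 2 ^ j) = sqrt 2 * r powr (1/2) * (sqrt 2 ^ j / 2 ^ j)"
      by (simp add: c_def field_simps)
    also have "sqrt 2 ^ j / 2 ^ j = (sqrt 2 / 2) ^ j" by (simp add: power_divide)
    also have "sqrt 2 / 2 = 1 / sqrt 2" by (simp add: field_simps)
    finally show "ennreal (c j) * ennreal (r / 2 ^ j) = ennreal (sqrt 2 * r powr (1/2) * (1 / sqrt 2) ^ j)"
      using c r by (simp add: ennreal_mult[symmetric])
  qed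
  also have "\<dots> = ennreal (sqrt 2 * r powr (1/2) / (1 - 1 / sqrt 2))"
    by (rule suminf_ennreal_geometric) auto
  also have "sqrt 2 * r powr (1/2) / (1 - 1 / sqrt 2) = mass_const * mass x powr (1/2)"
    by (simp add: mass_const_def r_def)
  finally show ?thesis .
qed

text \<open>The Hoelder weights cancel only where \<open>mass t\<close> is positive, since
  \<open>powr\<close> sends base 0 to 0. Elsewhere on the path the integrand must be shown to vanish
  almost everywhere.\<close>

lemma AE_mass_zero:
  assumes x: "x \<in> space M"
  shows "AE t in M. t \<in> P x \<longrightarrow> mass t = 0 \<longrightarrow> u t = 0"
proof -
  let ?S = "{t \<in> P x. mass t \<le> 0}"
  have "?S = P x \<inter> {t \<in> space M. mass t \<le> 0}" using P_space[OF x] by auto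
  then have S: "?S \<in> sets M" using P_sets[OF x] by auto
  have "(\<integral>\<^sup>+t. ennreal (w t) * indicator ?S t \<partial>M) = 0"
    using sublevel_mass[OF x, of 0] by simp
  then have "AE t in M. ennreal (w t) * indicator ?S t = 0"
    using S by (subst (asm) nn_integral_0_iff_AE) auto
  then show ?thesis
    by eventually_elim (auto simp: ennreal_eq_0_iff split: split_indicator_asm)
qed

lemma Lp_measurable: "f \<in> Lp M p \<Longrightarrow> f \<in> borel_measurable M"
  and Lp_integrable: "f \<in> Lp M p \<Longrightarrow> integrable M (\<lambda>x. norm (f x) powr p)"
  for f :: "'a \<Rightarrow> 'k"
  by (simp_all add: Lp_def)

lemma Lp_nn_integral:
  fixes f :: "'a \<Rightarrow> 'k"
  assumes "f \<in> Lp M p"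
  shows "(\<integral>\<^sup>+x. ennreal (norm (f x) powr p) \<partial>M) = ennreal (Lp_norm M p f powr p)"
proof -
  have "0 \<le> (LINT x|M. norm (f x) powr p)" by (rule Bochner_Integration.integral_nonneg) simp
  then have "Lp_norm M p f powr p = (LINT x|M. norm (f x) powr p)"
    using p by (simp add: Lp_norm_def powr_powr)
  then show ?thesis using Lp_integrable[OF assms] by (simp add: nn_integral_eq_integral)
qed

text \<open>\<open>B\<close> will be a root or the remainder of a path beyond its last root. Only
  the factor with \<open>f\<close> is localised to \<open>B\<close>; the factor with
  \<open>u\<close> is integrated over all of \<open>P x\<close>, where \<open>weighted_mass\<close>
  applies.\<close>

lemma path_integral_bound:
  fixes f :: "'a \<Rightarrow> 'k"
  assumes x: "x \<in> space M" and B: "B \<in> sets M" "B \<subseteq> P x" and f: "f \<in> Lp M p"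
  defines "J \<equiv> \<integral>\<^sup>+t. ennreal (norm (f t) powr p * mass t powr ((p - 1) / 2)) * indicator B t \<partial>M"
  shows "set_integrable M B (\<lambda>t. f t * u t)"
    and "ennreal (norm (LINT t:B|M. f t * u t) powr p) \<le> ennreal (path_const p * mass x powr ((p - 1) / 2)) * J"
proof -
  note [measurable] = Lp_measurable[OF f] B(1)
  define q where "q = conj_exp p"
  have q: "1 < q" "q * (p - 1) = p" "p / q = p - 1"
    using conj_exp_gt_1 conj_exp_mult divide_conj_exp p by (auto simp: q_def)
  \<comment> \<open>First \<open>J\<close> is shown finite, to obtain a real bound \<open>A\<close>
    for Hoelder's inequality.\<close>
  have "J \<le> (\<integral>\<^sup>+t. ennreal (mass x powr ((p - 1) / 2)) * ennreal (norm (f t) powr p) \<partial>M)"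
    unfolding J_def
  proof (rule nn_integral_mono)
    fix t
    show "ennreal (norm (f t) powr p * mass t powr ((p - 1) / 2)) * indicator B t \<le>
        ennreal (mass x powr ((p - 1) / 2)) * ennreal (norm (f t) powr p)"
    proof (cases "t \<in> B")
      case True
      then have "mass t powr ((p - 1) / 2) \<le> mass x powr ((p - 1) / 2)"
        using mass_mono[OF x] B(2) p mass_nonneg by (intro powr_mono2) auto
      then have "norm (f t) powr p * mass t powr ((p - 1) / 2) \<le> mass x powr ((p - 1) / 2) * norm (f t) powr p"
        by (metis mult.commute mult_left_mono powr_ge_zero)
      then show ?thesis using True by (simp add: ennreal_mult[symmetric] ennreal_leI)
    qed simp
  qed
  also have "\<dots> = ennreal (mass x powr ((p - 1) / 2)) * ennreal (Lp_norm M p f powr p)"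
    by (simp add: nn_integral_cmult Lp_nn_integral[OF f])
  also have "\<dots> < \<infinity>" by (simp add: ennreal_mult[symmetric])
  finally obtain A where A: "J = ennreal A" "0 \<le> A" by (cases J) auto
  \<comment> \<open>The exponent (p - 1)/(2p) is 1/(2p'): the p-th power of the weight in
    \<open>F\<close> is \<open>mass t powr ((p - 1) / 2)\<close>, and the p'-th power of the weight
    in \<open>H\<close> is \<open>mass t powr (-1/2)\<close>.\<close>
  define F where "F t = norm (f t) * mass t powr ((p - 1) / (2 * p)) * indicator B t" for t
  define H where "H t = norm (u t) * mass t powr (- (p - 1) / (2 * p)) * indicator (P x) t" for t
  have FH [measurable]: "F \<in> borel_measurable M" "H \<in> borel_measurable M"
    unfolding F_def H_def using P_sets[OF x] by measurable
  have Fp: "ennreal (F t powr p) = ennreal (norm (f t) powr p * mass t powr ((p - 1) / 2)) * indicator B t" for t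
    using p by (auto simp: F_def powr_mult powr_powr mass_nonneg split: split_indicator)
  have Hq: "ennreal (H t powr q) = ennreal (w t * mass t powr (-1/2)) * indicator (P x) t" for t
  proof -
    have "- (p - 1) / (2 * p) * q = -1/2" using q(2) p by (simp add: field_simps)
    then have "(mass t powr (- (p - 1) / (2 * p))) powr q = mass t powr (-1/2)"
      by (simp only: powr_powr)
    then show ?thesis using q by (auto simp: H_def powr_mult q_def split: split_indicator)
  qed
  let ?b = "A powr (1 / p) * (mass_const * mass x powr (1/2)) powr (1 / q)"
  have Holder: "(\<integral>\<^sup>+t. ennreal (F t * H t) \<partial>M) \<le> ennreal ?b"
    unfolding q_def
  proof (rule nn_integral_Holder[OF p FH])
    show "(\<integral>\<^sup>+t. ennreal (F t powr p) \<partial>M) \<le> ennreal A"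
      unfolding Fp using A(1) by (simp add: J_def)
    show "(\<integral>\<^sup>+t. ennreal (H t powr conj_exp p) \<partial>M) \<le> ennreal (mass_const * mass x powr (1 / 2))"
      using weighted_mass[OF x] unfolding q_def[symmetric] Hq by simp
  qed (use A(2) mass_const_pos mass_nonneg in \<open>auto simp: F_def H_def\<close>)
  have "(\<integral>\<^sup>+t. ennreal (norm (indicator B t *\<^sub>R (f t * u t))) \<partial>M) \<le> (\<integral>\<^sup>+t. ennreal (F t * H t) \<partial>M)"
  proof (rule nn_integral_mono_AE)
    show "AE t in M. ennreal (norm (indicator B t *\<^sub>R (f t * u t))) \<le> ennreal (F t * H t)"
      using AE_mass_zero[OF x]
    proof eventually_elim
      fix t assume ae: "t \<in> P x \<longrightarrow> mass t = 0 \<longrightarrow> u t = 0"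
      show "ennreal (norm (indicator B t *\<^sub>R (f t * u t))) \<le> ennreal (F t * H t)"
      proof (cases "t \<in> B \<and> mass t \<noteq> 0")
        case True
        have "(p - 1) / (2 * p) + - (p - 1) / (2 * p) = 0"
          unfolding add_divide_distrib[symmetric] by simp
        then have "mass t powr ((p - 1) / (2 * p)) * mass t powr (- (p - 1) / (2 * p)) = 1"
          using True unfolding powr_add[symmetric] by simp
        moreover have "t \<in> P x" using True B(2) by blast
        then have "F t * H t = norm (f t) * norm (u t) *
            (mass t powr ((p - 1) / (2 * p)) * mass t powr (- (p - 1) / (2 * p)))"
          using True by (simp add: F_def H_def)
        ultimately have FH_eq: "F t * H t = norm (f t) * norm (u t)" by simp
        have "norm (indicator B t *\<^sub>R (f t * u t)) = norm (f t) * norm (u t)"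
          using True by (simp add: norm_mult)
        then show ?thesis unfolding FH_eq by simp
      next
        case False
        then have "indicator B t *\<^sub>R (f t * u t) = 0" using ae B(2) by (auto split: split_indicator)
        then show ?thesis by (simp only: norm_zero ennreal_0 zero_le)
      qed
    qed
  qed
  also note Holder
  finally have bound: "(\<integral>\<^sup>+t. ennreal (norm (indicator B t *\<^sub>R (f t * u t))) \<partial>M) \<le> ennreal ?b" .
  then have int: "integrable M (\<lambda>t. indicator B t *\<^sub>R (f t * u t))"
    by (intro integrableI_bounded) (auto simp: less_top[symmetric] top_unique)
  then show "set_integrable M B (\<lambda>t. f t * u t)" by (simp add: set_integrable_def)
  have "ennreal (norm (LINT t:B|M. f t * u t)) \<le> ennreal ?b"
    unfolding set_lebesgue_integral_def
    using integral_norm_bound_ennreal[OF int] bound by (rule order_trans)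
  then have "norm (LINT t:B|M. f t * u t) \<le> ?b" by simp
  then have "norm (LINT t:B|M. f t * u t) powr p \<le> ?b powr p"
    using p by (intro powr_mono2) auto
  also have "?b powr p = A * (mass_const * mass x powr (1/2)) powr (p - 1)"
  proof -
    have "1 / p * p = 1" "1 / q * p = p - 1" using p q(3) by simp_all
    then have "(A powr (1 / p)) powr p * ((mass_const * mass x powr (1/2)) powr (1 / q)) powr p =
        A * (mass_const * mass x powr (1/2)) powr (p - 1)"
      unfolding powr_powr using A(2) by simp
    then show ?thesis using mass_const_pos by (simp only: powr_mult powr_ge_zero)
  qed
  also have "\<dots> = path_const p * mass x powr ((p - 1) / 2) * A"
    by (simp add: path_const_def powr_mult powr_powr mass_const_pos less_imp_le)
  finally show "ennreal (norm (LINT t:B|M. f t * u t) powr p) \<le> ennreal (path_const p * mass x powr ((p - 1) / 2)) * J"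
    using A path_const_pos[of p] by (simp add: ennreal_mult[symmetric] ennreal_leI)
qed

end

section \<open>Finite rank approximation\<close>

context hardy_order
begin

text \<open>The dyadic shells whose closures are the sets \<open>Z\<close>, written in terms of h =
  \<open>mass\<close> to the power p - 1. Unlike the closures they are disjoint.\<close>

definition level :: "int \<Rightarrow> 'a set" where
  "level k = {x \<in> space M. 2 powr k \<le> mass x powr (p - 1) \<and> mass x powr (p - 1) < 2 powr (k + 1)}"

definition level_weight :: "int \<Rightarrow> real" where
  "level_weight k = 2 powr k * (LINT x:level k|M. norm (v x) powr p)"

text \<open>Normalised by 2^k so that the total mass is \<open>level_weight k\<close>, the
  counterpart of the p-th power of the k-th sigma, and one \<open>\<delta>\<close> can serve all
  levels.\<close>

definition level_measure :: "int \<Rightarrow> 'a measure" where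
  "level_measure k = density M (\<lambda>x. ennreal (2 powr k * norm (v x) powr p) * indicator (level k) x)"

lemma level_sets [measurable]: "level k \<in> sets M"
  unfolding level_def by measurable

lemma v_measurable [measurable]: "v \<in> borel_measurable M"
  using v_Lp by (simp add: Lp_def)

lemma level_weight_nonneg: "0 \<le> level_weight k"
  unfolding level_weight_def set_lebesgue_integral_def
  by (intro mult_nonneg_nonneg Bochner_Integration.integral_nonneg) auto

lemma sets_level_measure [simp]: "sets (level_measure k) = sets M"
  and space_level_measure [simp]: "space (level_measure k) = space M"
  by (simp_all add: level_measure_def)

lemma emeasure_level_measure:
  assumes "A \<in> sets M"
  shows "emeasure (level_measure k) A =
    (\<integral>\<^sup>+x. ennreal (2 powr k * norm (v x) powr p) * indicator (level k) x * indicator A x \<partial>M)"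
  unfolding level_measure_def using assms by (subst emeasure_density) auto

lemma emeasure_level_measure_space: "emeasure (level_measure k) (space M) = ennreal (level_weight k)"
proof -
  have int: "integrable M (\<lambda>x. indicator (level k) x *\<^sub>R norm (v x) powr p)"
    using v_Lp by (intro integrable_mult_indicator) (auto simp: Lp_def)
  have "emeasure (level_measure k) (space M) =
      (\<integral>\<^sup>+x. ennreal (2 powr k) * ennreal (indicator (level k) x *\<^sub>R norm (v x) powr p) \<partial>M)"
    unfolding emeasure_level_measure[OF sets.top]
    by (intro nn_integral_cong) (auto simp: ennreal_mult split: split_indicator)
  also have "\<dots> = ennreal (2 powr k) * (\<integral>\<^sup>+x. ennreal (indicator (level k) x *\<^sub>R norm (v x) powr p) \<partial>M)"
    by (rule nn_integral_cmult) measurable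
  also have "(\<integral>\<^sup>+x. ennreal (indicator (level k) x *\<^sub>R norm (v x) powr p) \<partial>M) =
      ennreal (LINT x:level k|M. norm (v x) powr p)"
    unfolding set_lebesgue_integral_def using int by (intro nn_integral_eq_integral) auto
  finally show ?thesis
    by (simp add: level_weight_def ennreal_mult')
qed

lemma finite_level_measure: "finite_measure (level_measure k)"
  by (rule finite_measureI) (simp add: emeasure_level_measure_space)

lemma measure_level_measure_space: "measure (level_measure k) (space M) = level_weight k"
  using emeasure_level_measure_space[of k] level_weight_nonneg[of k] by (simp add: measure_def)

text \<open>A nonempty shadow places the root inside some path, which makes integration over it a
  bounded functional.\<close>

definition good_roots :: "real \<Rightarrow> 'a set set \<Rightarrow> bool" where
  "good_roots \<delta> R \<longleftrightarrow> finite R \<and> (\<forall>Q\<in>R. branch Q \<and> shadow Q \<noteq> {}) \<and>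
     (\<forall>k. \<forall>t\<in>space M. emeasure (level_measure k) (unrooted R t) \<le> ennreal \<delta>)"

text \<open>Level \<open>k\<close> contributes floor(\<open>level_weight k\<close> /
  \<open>\<delta>\<close>) pairs, because \<open>j\<close> starts at 0. That is the largest number
  of roots the greedy choice can spend on this level.\<close>

definition root_indices :: "real \<Rightarrow> (int \<times> nat) set" where
  "root_indices \<delta> = {(k, j). real (Suc j) * \<delta> \<le> level_weight k}"

lemma unrooted_antimono: "R \<subseteq> R' \<Longrightarrow> unrooted R' t \<subseteq> unrooted R t"
  by (auto simp: unrooted_def)

text \<open>Only levels of total mass at least \<open>\<delta>\<close> receive roots; all others
  satisfy the bound outright. Collecting the roots of all levels does no harm, as further roots only
  shrink the unrooted sets.\<close>

lemma good_roots_exist: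
  assumes \<delta>: "0 < \<delta>" and fin: "finite (root_indices \<delta>)"
  obtains R where "good_roots \<delta> R" "card R \<le> card (root_indices \<delta>)"
proof -
  have "\<exists>R. finite R \<and> (\<forall>Q\<in>R. branch Q \<and> shadow Q \<noteq> {}) \<and>
      real (card R) * \<delta> \<le> level_weight k \<and>
      (\<forall>t\<in>space M. emeasure (level_measure k) (unrooted R t) \<le> ennreal \<delta>)" for k
  proof -
    interpret finite_measure "level_measure k" by (rule finite_level_measure)
    obtain R where R: "finite R" "\<forall>Q\<in>R. branch Q \<and> shadow Q \<noteq> {}"
      "real (card R) * \<delta> \<le> level_weight k"
      "\<And>t. t \<in> space M \<Longrightarrow> measure (level_measure k) (space M \<inter> unrooted R t) \<le> \<delta>"
      using roots_exist[OF finite_level_measure sets_level_measure \<delta> sets.top, of k]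
      unfolding measure_level_measure_space by blast
    moreover have "space M \<inter> unrooted R t = unrooted R t" for t by (auto simp: unrooted_def)
    ultimately show ?thesis using \<delta> by (intro exI[of _ R]) (auto simp: emeasure_eq_measure ennreal_leI)
  qed
  then obtain R where R: "\<And>k. finite (R k)" "\<And>k Q. Q \<in> R k \<Longrightarrow> branch Q \<and> shadow Q \<noteq> {}"
    "\<And>k. real (card (R k)) * \<delta> \<le> level_weight k"
    "\<And>k t. t \<in> space M \<Longrightarrow> emeasure (level_measure k) (unrooted (R k) t) \<le> ennreal \<delta>"
    by metis
  define K where "K = fst ` root_indices \<delta>"
  have K: "finite K" using fin by (simp add: K_def)
  have notK: "level_weight k < \<delta>" if "k \<notin> K" for k
  proof (rule ccontr)
    assume "\<not> ?thesis"
    then have "(k, 0) \<in> root_indices \<delta>" by (simp add: root_indices_def)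
    then show False using that by (force simp: K_def)
  qed
  define RR where "RR = (\<Union>k\<in>K. R k)"
  have RR: "finite RR" "\<And>Q. Q \<in> RR \<Longrightarrow> branch Q \<and> shadow Q \<noteq> {}"
    using K R(1,2) by (auto simp: RR_def)
  have "emeasure (level_measure k) (unrooted RR t) \<le> ennreal \<delta>" if t: "t \<in> space M" for k t
  proof (cases "k \<in> K")
    case True
    then have "R k \<subseteq> RR" by (auto simp: RR_def)
    then have "emeasure (level_measure k) (unrooted RR t) \<le> emeasure (level_measure k) (unrooted (R k) t)"
      using unrooted_sets[OF R(1) _ t] R(2) by (intro emeasure_mono unrooted_antimono) auto
    then show ?thesis using R(4)[OF t] by (rule order_trans)
  next
    case False
    have "emeasure (level_measure k) (unrooted RR t) \<le> emeasure (level_measure k) (space M)"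
      by (intro emeasure_mono) (auto simp: unrooted_def)
    also have "\<dots> \<le> ennreal \<delta>"
      unfolding emeasure_level_measure_space using notK[OF False] by (intro ennreal_leI) simp
    finally show ?thesis .
  qed
  then have "good_roots \<delta> RR" using RR by (simp add: good_roots_def)
  moreover have "card RR \<le> card (root_indices \<delta>)"
  proof -
    have "card RR \<le> (\<Sum>k\<in>K. card (R k))"
      unfolding RR_def by (rule card_UN_le[OF K])
    \<comment> \<open>The j-th root chosen for level \<open>k\<close> is charged to the pair (k,
      j).\<close>
    also have "\<dots> = card (SIGMA k:K. {..<card (R k)})"
      using K by (subst card_SigmaI) auto
    also have "\<dots> \<le> card (root_indices \<delta>)"
    proof (rule card_mono[OF fin], safe)
      fix k j assume j: "j < card (R k)"
      then have "real (Suc j) * \<delta> \<le> real (card (R k)) * \<delta>" using \<delta> by (intro mult_right_mono) auto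
      then show "(k, j) \<in> root_indices \<delta>" using R(3)[of k] j by (simp add: root_indices_def)
    qed
    finally show ?thesis .
  qed
  ultimately show thesis by (rule that)
qed

lemma dyadic_level:
  assumes "x \<in> space M" "0 < mass x"
  shows "x \<in> level \<lfloor>log 2 (mass x powr (p - 1))\<rfloor>"
proof -
  have "0 < mass x powr (p - 1)" using assms by simp
  then show ?thesis
    using assms floor_log_eq_powr_iff[of "mass x powr (p - 1)" 2 "\<lfloor>log 2 (mass x powr (p - 1))\<rfloor>"]
    by (simp add: level_def)
qed

text \<open>A point \<open>x\<close> beyond \<open>t\<close> lies on level k + j for some j >= 0,
  where \<open>k\<close> is the level of \<open>t\<close>. There the product of the half powers is
  at most 2 * 2^(k+j) * 2^(-j/2): the factor 2^(k+j) belongs to the level measure, of which the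
  unrooted set has at most \<open>\<delta>\<close>, and 2^(-j/2) makes the sum over levels
  converge.\<close>

lemma unrooted_weight:
  assumes t: "t \<in> space M" and R: "good_roots \<delta> R"
  shows "(\<integral>\<^sup>+x. ennreal (norm (v x) powr p * (mass x powr ((p - 1) / 2) * mass t powr ((p - 1) / 2))) *
      indicator (unrooted R t) x \<partial>M) \<le> ennreal (level_const * \<delta>)"
proof (cases "mass t = 0")
  case False
  then have mt: "0 < mass t" using mass_nonneg[of t] by simp
  have [measurable]: "unrooted R t \<in> sets M"
    using R t by (intro unrooted_sets) (auto simp: good_roots_def)
  define k where "k = \<lfloor>log 2 (mass t powr (p - 1))\<rfloor>"
  have tk: "t \<in> level k" unfolding k_def by (rule dyadic_level[OF t mt])
  define c where "c j = 2 * (1 / sqrt 2) ^ j" for j :: nat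
  have c: "0 \<le> c j" for j by (simp add: c_def)
  let ?g = "\<lambda>j x. ennreal (2 powr (k + int j) * norm (v x) powr p) * indicator (level (k + int j)) x * indicator (unrooted R t) x"
  have "(\<integral>\<^sup>+x. ennreal (norm (v x) powr p * (mass x powr ((p - 1) / 2) * mass t powr ((p - 1) / 2))) *
      indicator (unrooted R t) x \<partial>M) \<le> (\<integral>\<^sup>+x. (\<Sum>j. ennreal (c j) * ?g j x) \<partial>M)"
  proof (rule nn_integral_mono)
    fix x assume x: "x \<in> space M"
    show "ennreal (norm (v x) powr p * (mass x powr ((p - 1) / 2) * mass t powr ((p - 1) / 2))) *
      indicator (unrooted R t) x \<le> (\<Sum>j. ennreal (c j) * ?g j x)"
    proof (cases "x \<in> unrooted R t")
      case True
      then have le: "mass t \<le> mass x" using mass_mono[OF x] by (simp add: unrooted_def)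
      with mt have mx: "0 < mass x" by simp
      define k' where "k' = \<lfloor>log 2 (mass x powr (p - 1))\<rfloor>"
      have xk: "x \<in> level k'" unfolding k'_def by (rule dyadic_level[OF x mx])
      have "mass t powr (p - 1) \<le> mass x powr (p - 1)" using le mt p by (intro powr_mono2) auto
      then have "k \<le> k'"
        unfolding k_def k'_def using mt mx by (intro floor_mono) (simp add: log_le_cancel_iff)
      then obtain j where j: "k' = k + int j" using zle_iff_zadd by blast
      have half: "mass z powr ((p - 1) / 2) \<le> 2 powr ((real_of_int i + 1) / 2)" if "z \<in> level i" for z i
      proof -
        have "(mass z powr (p - 1)) powr (1 / 2) \<le> (2 powr (i + 1)) powr (1 / 2)"
          using that by (intro powr_mono2) (auto simp: level_def)
        then show ?thesis by (simp add: powr_powr)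
      qed
      have "mass x powr ((p - 1) / 2) * mass t powr ((p - 1) / 2) \<le>
          2 powr ((real_of_int k' + 1) / 2) * 2 powr ((real_of_int k + 1) / 2)"
        using half[OF xk] half[OF tk] by (intro mult_mono) auto
      also have "(2::real) powr ((real_of_int k' + 1) / 2) * 2 powr ((real_of_int k + 1) / 2) =
          2 powr (1 + real_of_int (k + int j) + (- real j / 2))"
      proof -
        have "(real_of_int k' + 1) / 2 + (real_of_int k + 1) / 2 = 1 + real_of_int (k + int j) + (- real j / 2)"
          by (simp add: j field_simps)
        then show ?thesis by (simp only: powr_add[symmetric])
      qed
      also have "\<dots> = 2 * 2 powr (k + int j) * 2 powr (- real j / 2)"
        by (simp only: powr_add powr_one)
      also have "2 powr (- real j / 2) = (1 / sqrt 2) ^ j"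
      proof -
        have "(1 / sqrt 2) ^ j = (2 powr (- 1 / 2)) ^ j"
          by (simp add: powr_minus_divide powr_half_sqrt)
        also have "\<dots> = 2 powr (- real j / 2)" by (simp add: powr_power)
        finally show ?thesis by simp
      qed
      finally have "mass x powr ((p - 1) / 2) * mass t powr ((p - 1) / 2) \<le> c j * 2 powr (k + int j)"
        by (simp add: c_def mult_ac)
      then have "norm (v x) powr p * (mass x powr ((p - 1) / 2) * mass t powr ((p - 1) / 2)) \<le>
          norm (v x) powr p * (c j * 2 powr (k + int j))"
        by (rule mult_left_mono) simp
      then have "ennreal (norm (v x) powr p * (mass x powr ((p - 1) / 2) * mass t powr ((p - 1) / 2))) *
          indicator (unrooted R t) x \<le> ennreal (c j) * ?g j x"
        using True xk c by (simp add: j ennreal_mult[symmetric] ennreal_leI mult_ac)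
      also have "\<dots> \<le> (\<Sum>j. ennreal (c j) * ?g j x)" by (rule le_suminf_ennreal)
      finally show ?thesis .
    qed simp
  qed
  also have "\<dots> = (\<Sum>j. ennreal (c j) * emeasure (level_measure (k + int j)) (unrooted R t))"
    by (subst nn_integral_suminf) (auto simp: nn_integral_cmult emeasure_level_measure)
  also have "\<dots> \<le> (\<Sum>j. ennreal (c j) * ennreal \<delta>)"
    using R t by (intro suminf_le mult_left_mono) (auto simp: good_roots_def)
  also have "\<dots> = (\<Sum>j. ennreal (2 * \<delta> * (1 / sqrt 2) ^ j))"
  proof (intro arg_cong[where f = suminf] ext)
    fix j
    have eq: "c j * \<delta> = 2 * \<delta> * (1 / sqrt 2) ^ j" by (simp only: c_def mult_ac)
    show "ennreal (c j) * ennreal \<delta> = ennreal (2 * \<delta> * (1 / sqrt 2) ^ j)"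
      unfolding eq[symmetric] by (rule ennreal_mult'[OF c, symmetric])
  qed
  also have "\<dots> \<le> ennreal (level_const * \<delta>)"
  proof (cases "0 \<le> \<delta>")
    case True
    then show ?thesis by (subst suminf_ennreal_geometric) (auto simp: level_const_def mult_ac)
  next
    case False
    then have "ennreal (2 * \<delta> * (1 / sqrt 2) ^ j) = 0" for j
      by (intro ennreal_neg) (auto simp: mult_le_0_iff)
    then show ?thesis by simp
  qed
  finally show ?thesis .
qed (use p in simp)

section \<open>The Hardy operator and its finite rank approximant\<close>

definition op :: "('a \<Rightarrow> 'k) \<Rightarrow> 'a \<Rightarrow> 'k" where
  "op f x = v x * (LINT t:P x|M. f t * u t)"

definition rooted_op :: "'a set set \<Rightarrow> ('a \<Rightarrow> 'k) \<Rightarrow> 'a \<Rightarrow> 'k" where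
  "rooted_op R f x = v x * (LINT t:root_of R x|M. f t * u t)"

lemma op_minus_rooted:
  assumes x: "x \<in> space M" and f: "f \<in> Lp M p" and R: "good_roots \<delta> R"
  shows "op f x - rooted_op R f x = v x * (LINT t:P x - root_of R x|M. f t * u t)"
proof -
  have root: "root_of R x \<in> sets M" using R by (intro root_of_sets) (auto simp: good_roots_def)
  have diff: "P x - root_of R x \<in> sets M" using root P_sets[OF x] by auto
  have "(LINT t:(P x - root_of R x) \<union> root_of R x|M. f t * u t) =
      (LINT t:P x - root_of R x|M. f t * u t) + (LINT t:root_of R x|M. f t * u t)"
    using path_integral_bound(1)[OF x diff _ f] path_integral_bound(1)[OF x root root_of_subset f]
    by (intro set_integral_Un) auto
  moreover have "(P x - root_of R x) \<union> root_of R x = P x" using root_of_subset by blast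
  ultimately show ?thesis by (simp add: op_def rooted_op_def algebra_simps)
qed

lemma op_minus_rooted_bound:
  assumes f: "f \<in> Lp M p" and R: "good_roots \<delta> R" and \<delta>: "0 \<le> \<delta>"
  shows "(\<integral>\<^sup>+x. ennreal (norm (op f x - rooted_op R f x) powr p) \<partial>M) \<le>
    ennreal (path_const p * level_const * \<delta> * Lp_norm M p f powr p)"
proof -
  note [measurable] = Lp_measurable[OF f]
  have br: "finite R" "\<And>Q. Q \<in> R \<Longrightarrow> branch Q" using R by (auto simp: good_roots_def)
  have [measurable]: "unrooted_pairs R \<in> sets (M \<Otimes>\<^sub>M M)" by (rule unrooted_pairs_sets[OF br])
  let ?h = "\<lambda>x. mass x powr ((p - 1) / 2)"
  let ?\<Phi> = "\<lambda>(t, x). ennreal (path_const p * norm (v x) powr p * ?h x) *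
      (ennreal (norm (f t) powr p * ?h t) * indicator (unrooted_pairs R) (t, x))"
  have "(\<integral>\<^sup>+x. ennreal (norm (op f x - rooted_op R f x) powr p) \<partial>M) \<le>
      (\<integral>\<^sup>+x. (\<integral>\<^sup>+t. ?\<Phi> (t, x) \<partial>M) \<partial>M)"
  proof (rule nn_integral_mono)
    fix x assume x: "x \<in> space M"
    let ?B = "P x - root_of R x"
    let ?J = "\<integral>\<^sup>+t. ennreal (norm (f t) powr p * ?h t) * indicator ?B t \<partial>M"
    have B: "?B \<in> sets M" using root_of_sets[OF br] P_sets[OF x] by auto
    have "ennreal (norm (op f x - rooted_op R f x) powr p) =
        ennreal (norm (v x) powr p) * ennreal (norm (LINT t:?B|M. f t * u t) powr p)"
      unfolding op_minus_rooted[OF x f R] by (simp add: norm_mult powr_mult ennreal_mult)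
    also have "\<dots> \<le> ennreal (norm (v x) powr p) * (ennreal (path_const p * ?h x) * ?J)"
      using path_integral_bound(2)[OF x B _ f] by (intro mult_left_mono) auto
    also have "\<dots> = ennreal (path_const p * norm (v x) powr p * ?h x) * ?J"
      using path_const_pos[of p] by (simp add: ennreal_mult mult_ac)
    \<comment> \<open>Before the order of integration is exchanged, the path remainder is replaced
      by a section of a jointly measurable set; they differ at most at \<open>t = x\<close>.\<close>
    also have "?J = (\<integral>\<^sup>+t. ennreal (norm (f t) powr p * ?h t) * indicator (unrooted_pairs R) (t, x) \<partial>M)"
    proof (rule nn_integral_cong_AE)
      show "AE t in M. ennreal (norm (f t) powr p * ?h t) * indicator ?B t =
          ennreal (norm (f t) powr p * ?h t) * indicator (unrooted_pairs R) (t, x)"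
        using AE_neq[OF x]
      proof eventually_elim
        fix t assume "t \<noteq> x"
        then have "t \<in> ?B \<longleftrightarrow> (t, x) \<in> unrooted_pairs R"
          using unrooted_pairs_iff[OF x] not_in_root_of[OF x] by blast
        then show "ennreal (norm (f t) powr p * ?h t) * indicator ?B t =
          ennreal (norm (f t) powr p * ?h t) * indicator (unrooted_pairs R) (t, x)"
          by (simp add: indicator_def)
      qed
    qed
    also have "ennreal (path_const p * norm (v x) powr p * ?h x) * \<dots> = (\<integral>\<^sup>+t. ?\<Phi> (t, x) \<partial>M)"
      using x by (simp add: nn_integral_cmult)
    finally show "ennreal (norm (op f x - rooted_op R f x) powr p) \<le> (\<integral>\<^sup>+t. ?\<Phi> (t, x) \<partial>M)" .
  qed
  also have "\<dots> = (\<integral>\<^sup>+t. (\<integral>\<^sup>+x. ?\<Phi> (t, x) \<partial>M) \<partial>M)"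
  proof -
    interpret pair_sigma_finite M M ..
    show ?thesis by (rule Fubini) measurable
  qed
  also have "\<dots> \<le> (\<integral>\<^sup>+t. ennreal (path_const p * level_const * \<delta>) * ennreal (norm (f t) powr p) \<partial>M)"
  proof (rule nn_integral_mono)
    fix t assume t: "t \<in> space M"
    have [measurable]: "unrooted R t \<in> sets M" by (rule unrooted_sets[OF br t])
    have "(\<integral>\<^sup>+x. ?\<Phi> (t, x) \<partial>M) \<le> (\<integral>\<^sup>+x. ennreal (path_const p * norm (f t) powr p) *
        (ennreal (norm (v x) powr p * (?h x * ?h t)) * indicator (unrooted R t) x) \<partial>M)"
    proof (rule nn_integral_mono)
      fix x
      show "?\<Phi> (t, x) \<le> ennreal (path_const p * norm (f t) powr p) *
        (ennreal (norm (v x) powr p * (?h x * ?h t)) * indicator (unrooted R t) x)"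
      proof (cases "(t, x) \<in> unrooted_pairs R")
        case True
        then show ?thesis
          using unrooted_pairs_D[OF True] path_const_pos[of p] by (simp add: ennreal_mult[symmetric] mult_ac)
      qed simp
    qed
    also have "\<dots> = ennreal (path_const p * norm (f t) powr p) *
        (\<integral>\<^sup>+x. ennreal (norm (v x) powr p * (?h x * ?h t)) * indicator (unrooted R t) x \<partial>M)"
      by (rule nn_integral_cmult) measurable
    also have "\<dots> \<le> ennreal (path_const p * norm (f t) powr p) * ennreal (level_const * \<delta>)"
      by (intro mult_left_mono unrooted_weight[OF t R]) auto
    also have "\<dots> = ennreal (path_const p * level_const * \<delta>) * ennreal (norm (f t) powr p)"
      using path_const_pos[of p] level_const_pos \<delta> by (simp add: ennreal_mult[symmetric] mult_ac)
    finally show "(\<integral>\<^sup>+x. ?\<Phi> (t, x) \<partial>M) \<le> ennreal (path_const p * level_const * \<delta>) * ennreal (norm (f t) powr p)" .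
  qed
  also have "\<dots> = ennreal (path_const p * level_const * \<delta>) * ennreal (Lp_norm M p f powr p)"
    by (simp add: nn_integral_cmult Lp_nn_integral[OF f])
  also have "\<dots> = ennreal (path_const p * level_const * \<delta> * Lp_norm M p f powr p)"
    using path_const_pos[of p] level_const_pos \<delta> by (simp add: ennreal_mult)
  finally show ?thesis .
qed

lemma op_measurable:
  assumes f: "f \<in> Lp M p" shows "op f \<in> borel_measurable M"
proof -
  note [measurable] = Lp_measurable[OF f]
  have "(\<lambda>(x, t). indicat_real below (t, x) *\<^sub>R (f t * u t)) \<in> borel_measurable (M \<Otimes>\<^sub>M M)"
    by measurable
  then have "(\<lambda>x. LINT t|M. indicat_real below (t, x) *\<^sub>R (f t * u t)) \<in> borel_measurable M"
    by (intro borel_measurable_lebesgue_integral) (simp add: case_prod_beta')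
  then have "(\<lambda>x. v x * (LINT t|M. indicat_real below (t, x) *\<^sub>R (f t * u t))) \<in> borel_measurable M"
    by measurable
  moreover have "op f x = v x * (LINT t|M. indicat_real below (t, x) *\<^sub>R (f t * u t))" if x: "x \<in> space M" for x
  proof -
    have [measurable]: "P x \<in> sets M" by (rule P_sets[OF x])
    have "(LINT t:P x|M. f t * u t) = (LINT t|M. indicat_real below (t, x) *\<^sub>R (f t * u t))"
      unfolding set_lebesgue_integral_def
    proof (rule integral_cong_AE)
      show "AE t in M. indicat_real (P x) t *\<^sub>R (f t * u t) = indicat_real below (t, x) *\<^sub>R (f t * u t)"
        using AE_neq[OF x] by eventually_elim (use below_iff[OF x] in \<open>auto split: split_indicator\<close>)
    qed (use x in measurable)
    then show ?thesis by (simp add: op_def)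
  qed
  ultimately show ?thesis by (subst measurable_cong) auto
qed

text \<open>On the region with last root \<open>Q\<close> the approximant is a multiple of
  \<open>v\<close>, the factor being the integral over \<open>Q\<close>. These regions are
  disjoint.\<close>

definition rank_one :: "'a set set \<Rightarrow> 'a set \<Rightarrow> 'a \<Rightarrow> 'k" where
  "rank_one R Q x = (if root_of R x = Q then v x else 0)"

lemma rank_one_Lp:
  assumes R: "good_roots \<delta> R" and Q: "Q \<in> R"
  shows "rank_one R Q \<in> Lp M p"
proof -
  have [measurable]: "{x \<in> space M. root_of R x = Q} \<in> sets M"
    using R Q by (intro root_of_eq_sets) (auto simp: good_roots_def)
  have [measurable]: "rank_one R Q \<in> borel_measurable M"
    unfolding rank_one_def by measurable
  have "integrable M (\<lambda>x. norm (rank_one R Q x) powr p)"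
  proof (rule Bochner_Integration.integrable_bound[OF Lp_integrable[OF v_Lp]])
    show "AE x in M. norm (norm (rank_one R Q x) powr p) \<le> norm (norm (v x) powr p)"
      by (auto simp: rank_one_def)
  qed measurable
  then show ?thesis by (simp add: Lp_def)
qed

lemma rooted_op_sum:
  assumes R: "good_roots \<delta> R" and x: "x \<in> space M"
  shows "rooted_op R f x = (\<Sum>Q\<in>R. (LINT t:Q|M. f t * u t) * rank_one R Q x)"
proof -
  have fin: "finite R" using R by (simp add: good_roots_def)
  have "(\<Sum>Q\<in>R. (LINT t:Q|M. f t * u t) * rank_one R Q x) =
      (\<Sum>Q\<in>R. if root_of R x = Q then (LINT t:root_of R x|M. f t * u t) * v x else 0)"
    by (intro sum.cong) (auto simp: rank_one_def)
  also have "\<dots> = (if root_of R x \<in> R then (LINT t:root_of R x|M. f t * u t) * v x else 0)"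
    by (rule sum.delta'[OF fin])
  \<comment> \<open>If no root precedes \<open>x\<close>, then \<open>root_of R x\<close> is empty
    and both sides are 0.\<close>
  also have "\<dots> = rooted_op R f x"
    using root_of_cases[of R x] x R
    by (auto simp: rooted_op_def good_roots_def set_lebesgue_integral_def)
  finally show ?thesis by simp
qed

lemma rooted_op_measurable:
  assumes R: "good_roots \<delta> R" shows "rooted_op R f \<in> borel_measurable M"
proof -
  have "rank_one R Q \<in> borel_measurable M" if "Q \<in> R" for Q
    using rank_one_Lp[OF R that] by (rule Lp_measurable)
  then have "(\<lambda>x. \<Sum>Q\<in>R. (LINT t:Q|M. f t * u t) * rank_one R Q x) \<in> borel_measurable M"
    by (intro borel_measurable_sum borel_measurable_times) auto
  then show ?thesis using rooted_op_sum[OF R] by (subst measurable_cong) auto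
qed

lemma Lp_of_bound:
  fixes g f :: "'a \<Rightarrow> 'k"
  assumes [measurable]: "g \<in> borel_measurable M" and K: "0 \<le> K"
    and bound: "(\<integral>\<^sup>+x. ennreal (norm (g x) powr p) \<partial>M) \<le> ennreal (K * Lp_norm M p f powr p)"
  shows "g \<in> Lp M p" "Lp_norm M p g \<le> K powr (1 / p) * Lp_norm M p f"
proof -
  have "integrable M (\<lambda>x. norm (g x) powr p)"
  proof (rule integrableI_bounded)
    show "(\<integral>\<^sup>+x. ennreal (norm (norm (g x) powr p)) \<partial>M) < \<infinity>"
      using bound by (auto simp: less_top[symmetric] top_unique)
  qed measurable
  then show g: "g \<in> Lp M p" by (simp add: Lp_def)
  have nn: "0 \<le> Lp_norm M p h" for h :: "'a \<Rightarrow> 'k" by (simp add: Lp_norm_def)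
  have "Lp_norm M p g powr p \<le> K * Lp_norm M p f powr p"
    using bound K nn[of f] by (simp add: Lp_nn_integral[OF g])
  then have "(Lp_norm M p g powr p) powr (1 / p) \<le> (K * Lp_norm M p f powr p) powr (1 / p)"
    using p by (intro powr_mono2) auto
  then show "Lp_norm M p g \<le> K powr (1 / p) * Lp_norm M p f"
    using p K nn by (simp add: powr_powr powr_mult)
qed

text \<open>Choose \<open>x\<close> in the shadow; \<open>Q\<close> is then part of the path to
  \<open>x\<close>, and the path estimate with the crude bound \<open>mass t \<le> mass x\<close>
  suffices.\<close>

lemma root_functional_bound:
  assumes Q: "branch Q" "shadow Q \<noteq> {}"
  shows "\<exists>c\<ge>0. \<forall>f\<in>Lp M p. norm (LINT t:Q|M. f t * u t) powr p \<le> c * Lp_norm M p f powr p"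
proof -
  obtain x where x: "x \<in> space M" "Q \<subseteq> P x" using Q(2) by (auto simp: shadow_def)
  let ?h = "mass x powr ((p - 1) / 2)"
  have "norm (LINT t:Q|M. f t * u t) powr p \<le> (path_const p * ?h * ?h) * Lp_norm M p f powr p"
    if f: "f \<in> Lp M p" for f
  proof -
    note [measurable] = Lp_measurable[OF f] branch_sets[OF Q(1)]
    have "ennreal (norm (LINT t:Q|M. f t * u t) powr p) \<le> ennreal (path_const p * ?h) *
        (\<integral>\<^sup>+t. ennreal (norm (f t) powr p * mass t powr ((p - 1) / 2)) * indicator Q t \<partial>M)"
      by (rule path_integral_bound(2)[OF x(1) branch_sets[OF Q(1)] x(2) f])
    also have "\<dots> \<le> ennreal (path_const p * ?h) * (\<integral>\<^sup>+t. ennreal ?h * ennreal (norm (f t) powr p) \<partial>M)"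
    proof (intro mult_left_mono nn_integral_mono)
      fix t
      show "ennreal (norm (f t) powr p * mass t powr ((p - 1) / 2)) * indicator Q t \<le>
          ennreal ?h * ennreal (norm (f t) powr p)"
      proof (cases "t \<in> Q")
        case True
        then have "mass t powr ((p - 1) / 2) \<le> ?h"
          using mass_mono[OF x(1)] x(2) p mass_nonneg by (intro powr_mono2) auto
        then have "norm (f t) powr p * mass t powr ((p - 1) / 2) \<le> ?h * norm (f t) powr p"
          by (metis mult.commute mult_left_mono powr_ge_zero)
        then show ?thesis using True by (simp add: ennreal_mult[symmetric] ennreal_leI)
      qed simp
    qed simp
    also have "\<dots> = ennreal (path_const p * ?h * ?h * Lp_norm M p f powr p)"
    proof -
      have "(\<integral>\<^sup>+t. ennreal ?h * ennreal (norm (f t) powr p) \<partial>M) = ennreal ?h * ennreal (Lp_norm M p f powr p)"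
        by (simp add: nn_integral_cmult Lp_nn_integral[OF f])
      then show ?thesis using path_const_pos[of p] by (simp add: ennreal_mult mult.assoc)
    qed
    finally show ?thesis using path_const_pos[of p] by (simp add: ennreal_le_iff)
  qed
  then show ?thesis using path_const_pos[of p] by (intro exI[of _ "path_const p * ?h * ?h"]) auto
qed

lemma rooted_op_bounded:
  assumes R: "good_roots \<delta> R"
  shows "bounded_operator M p (rooted_op R)"
proof -
  have br: "finite R" "\<And>Q. Q \<in> R \<Longrightarrow> branch Q" "\<And>Q. Q \<in> R \<Longrightarrow> shadow Q \<noteq> {}"
    using R by (auto simp: good_roots_def)
  have root: "root_of R x \<in> sets M" for x by (rule root_of_sets[OF br(1,2)])
  have "\<forall>Q\<in>R. \<exists>c\<ge>0. \<forall>f\<in>Lp M p. norm (LINT t:Q|M. f t * u t) powr p \<le> c * Lp_norm M p f powr p"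
    using root_functional_bound br by blast
  then obtain c where c: "\<And>Q. Q \<in> R \<Longrightarrow> 0 \<le> c Q"
    "\<And>Q f. Q \<in> R \<Longrightarrow> f \<in> Lp M p \<Longrightarrow> norm (LINT t:Q|M. f t * u t) powr p \<le> c Q * Lp_norm M p f powr p"
    by metis
  \<comment> \<open>There are finitely many roots, so the sum of their constants bounds all
    functionals at once.\<close>
  define K where "K = sum c R"
  have K: "0 \<le> K" "\<And>Q. Q \<in> R \<Longrightarrow> c Q \<le> K"
    using c(1) br(1) by (auto simp: K_def intro: sum_nonneg member_le_sum)
  have bound: "(\<integral>\<^sup>+x. ennreal (norm (rooted_op R f x) powr p) \<partial>M) \<le>
      ennreal (K * Lp_norm M p v powr p * Lp_norm M p f powr p)" if f: "f \<in> Lp M p" for f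
  proof -
    have "(\<integral>\<^sup>+x. ennreal (norm (rooted_op R f x) powr p) \<partial>M) \<le>
        (\<integral>\<^sup>+x. ennreal (K * Lp_norm M p f powr p) * ennreal (norm (v x) powr p) \<partial>M)"
    proof (rule nn_integral_mono)
      fix x assume x: "x \<in> space M"
      have "norm (LINT t:root_of R x|M. f t * u t) powr p \<le> K * Lp_norm M p f powr p"
      proof (cases "root_of R x \<in> R")
        case True
        then have "norm (LINT t:root_of R x|M. f t * u t) powr p \<le> c (root_of R x) * Lp_norm M p f powr p"
          using c(2) f by blast
        also have "\<dots> \<le> K * Lp_norm M p f powr p" using K(2)[OF True] by (intro mult_right_mono) auto
        finally show ?thesis .
      next
        case False
        then have "root_of R x = {}" using root_of_cases[OF br(1,2) x] by blast
        then show ?thesis using K(1) p by (simp add: set_lebesgue_integral_def)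
      qed
      then have "norm (v x) powr p * norm (LINT t:root_of R x|M. f t * u t) powr p \<le>
          norm (v x) powr p * (K * Lp_norm M p f powr p)"
        by (rule mult_left_mono) simp
      then show "ennreal (norm (rooted_op R f x) powr p) \<le>
          ennreal (K * Lp_norm M p f powr p) * ennreal (norm (v x) powr p)"
        using K(1) by (simp add: rooted_op_def norm_mult powr_mult ennreal_mult[symmetric] ennreal_leI mult_ac)
    qed
    also have "\<dots> = ennreal (K * Lp_norm M p f powr p) * ennreal (Lp_norm M p v powr p)"
      by (simp add: nn_integral_cmult Lp_nn_integral[OF v_Lp])
    also have "\<dots> = ennreal (K * Lp_norm M p v powr p * Lp_norm M p f powr p)"
      using K(1) by (simp add: ennreal_mult mult_ac)
    finally show ?thesis .
  qed
  have K': "0 \<le> K * Lp_norm M p v powr p" using K(1) by simp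
  have int: "set_integrable M (root_of R x) (\<lambda>t. f t * u t)" if "x \<in> space M" "f \<in> Lp M p" for f x
    by (rule path_integral_bound(1)[OF that(1) root root_of_subset that(2)])
  show ?thesis
    unfolding bounded_operator_def
  proof (intro conjI ballI allI)
    show "rooted_op R f \<in> Lp M p" if "f \<in> Lp M p" for f
      by (rule Lp_of_bound(1)[OF rooted_op_measurable[OF R] K' bound[OF that]])
    show "AE x in M. rooted_op R (\<lambda>t. f t + g t) x = rooted_op R f x + rooted_op R g x"
      if "f \<in> Lp M p" "g \<in> Lp M p" for f g
    proof (rule AE_I2)
      fix x assume x: "x \<in> space M"
      have "(LINT t:root_of R x|M. (f t + g t) * u t) =
          (LINT t:root_of R x|M. f t * u t) + (LINT t:root_of R x|M. g t * u t)"
        unfolding distrib_right using int[OF x that(1)] int[OF x that(2)] by (rule set_integral_add)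
      then show "rooted_op R (\<lambda>t. f t + g t) x = rooted_op R f x + rooted_op R g x"
        by (simp add: rooted_op_def distrib_left)
    qed
    show "AE x in M. rooted_op R (\<lambda>t. b * f t) x = b * rooted_op R f x" for f b
      by (rule AE_I2) (simp add: rooted_op_def mult.assoc mult.left_commute)
    show "\<exists>C. \<forall>f\<in>Lp M p. Lp_norm M p (rooted_op R f) \<le> C * Lp_norm M p f"
      using Lp_of_bound(2)[OF rooted_op_measurable[OF R] K' bound] by blast
  qed
qed

lemma rooted_op_rank:
  assumes R: "good_roots \<delta> R" and m: "card R < m"
  shows "rank_less M p (rooted_op R) m"
proof -
  have fin: "finite R" using R by (simp add: good_roots_def)
  let ?B = "rank_one R ` R"
  have "?B \<subseteq> Lp M p" using rank_one_Lp[OF R] by blast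
  moreover have "card ?B < m" using card_image_le[OF fin, of "rank_one R"] m by simp
  moreover have "\<exists>c. AE x in M. rooted_op R f x = (\<Sum>b\<in>?B. c b * b x)" for f
  proof (intro exI AE_I2)
    fix x assume x: "x \<in> space M"
    \<comment> \<open>Different roots may yield the same function, for instance if \<open>v\<close>
      vanishes on both regions. Spanning is expressed with a set of functions, so the coefficients
      of each fibre are added up.\<close>
    let ?c = "\<lambda>b. \<Sum>Q | Q \<in> R \<and> rank_one R Q = b. (LINT t:Q|M. f t * u t)"
    have "rooted_op R f x = (\<Sum>b\<in>?B. \<Sum>Q | Q \<in> R \<and> rank_one R Q = b. (LINT t:Q|M. f t * u t) * rank_one R Q x)"
      unfolding rooted_op_sum[OF R x] by (rule sum.image_gen[OF fin])
    also have "\<dots> = (\<Sum>b\<in>?B. ?c b * b x)"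
      by (intro sum.cong) (auto simp: sum_distrib_right)
    finally show "rooted_op R f x = (\<Sum>b\<in>?B. ?c b * b x)" .
  qed
  ultimately show ?thesis
    unfolding rank_less_def using fin by (intro exI[of _ ?B]) auto
qed

lemma approx_num_bound:
  assumes \<delta>: "0 < \<delta>" and fin: "finite (root_indices \<delta>)" and m: "card (root_indices \<delta>) < m"
  shows "approx_num M p op m \<le> ennreal ((path_const p * level_const * \<delta>) powr (1 / p))"
proof -
  obtain R where R: "good_roots \<delta> R" "card R \<le> card (root_indices \<delta>)"
    using good_roots_exist[OF \<delta> fin] .
  have K: "0 \<le> path_const p * level_const * \<delta>" using path_const_pos[of p] level_const_pos \<delta> by simp
  have "(\<lambda>x. op f x - rooted_op R f x) \<in> Lp M p \<and>
      Lp_norm M p (\<lambda>x. op f x - rooted_op R f x) \<le> (path_const p * level_const * \<delta>) powr (1 / p) * Lp_norm M p f"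
    if f: "f \<in> Lp M p" for f
  proof -
    have "(\<lambda>x. op f x - rooted_op R f x) \<in> borel_measurable M"
      using op_measurable[OF f] rooted_op_measurable[OF R(1)] by measurable
    from Lp_of_bound[OF this K op_minus_rooted_bound[OF f R(1)]] \<delta> show ?thesis by simp
  qed
  then have "op_norm M p (\<lambda>f x. op f x - rooted_op R f x) \<le> ennreal ((path_const p * level_const * \<delta>) powr (1 / p))"
    unfolding op_norm_def by (intro Inf_lower) auto
  then show ?thesis
    unfolding approx_num_def
    using rooted_op_bounded[OF R(1)] rooted_op_rank[OF R(1), of m] R(2) m
    by (intro INF_lower2[of "rooted_op R"]) auto
qed

end

section \<open>Summation\<close>

text \<open>Layer cake: both sums are integrals of their counting functions.\<close>

lemma nn_integral_count_space_mono_counts: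
  fixes A :: "nat \<Rightarrow> ennreal" and B :: "'i::countable \<Rightarrow> real"
  assumes B: "\<And>i. 0 \<le> B i"
    and le: "\<And>s. 0 < s \<Longrightarrow>
      emeasure (count_space N) {n\<in>N. ennreal s < A n} \<le> emeasure (count_space UNIV) {i. s \<le> B i}"
  shows "(\<integral>\<^sup>+n. A n \<partial>count_space N) \<le> (\<integral>\<^sup>+i. ennreal (B i) \<partial>count_space UNIV)"
proof -
  interpret N: pair_sigma_finite "count_space N" lborel
    by (rule pair_sigma_finite.intro) (auto intro!: sigma_finite_measure_count_space_countable sigma_finite_lborel)
  interpret I: pair_sigma_finite "count_space (UNIV :: 'i set)" lborel
    by (rule pair_sigma_finite.intro) (auto intro!: sigma_finite_measure_count_space_countable sigma_finite_lborel)
  \<comment> \<open>Strict on this side, non-strict for \<open>B\<close>: the lengths are the same,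
    and the strict form fits upper bounds on \<open>A n\<close> that allow equality with
    \<open>s\<close>.\<close>
  let ?S = "\<lambda>n. {s. 0 < s \<and> ennreal s < A n}"
  have S: "A n = emeasure lborel (?S n) \<and> ?S n \<in> sets borel" for n
  proof (cases "A n")
    case (real r)
    then have "?S n = {0<..<r}" by (auto simp: ennreal_less_iff)
    then show ?thesis using real by simp
  next
    case top
    then have "?S n = {0<..}" by auto
    moreover have "emeasure lborel {0::real<..} = \<infinity>"
    proof (rule ccontr)
      assume "emeasure lborel {0::real<..} \<noteq> \<infinity>"
      then obtain r where r: "emeasure lborel {0::real<..} = ennreal r" "0 \<le> r"
        by (cases "emeasure lborel {0::real<..}") auto
      have "emeasure lborel {0<..r + 1} \<le> emeasure lborel {0::real<..}"
        by (intro emeasure_mono) auto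
      then show False using r by (simp add: ennreal_le_iff)
    qed
    ultimately show ?thesis using top by simp
  qed
  have "(\<integral>\<^sup>+n. A n \<partial>count_space N) = (\<integral>\<^sup>+n. (\<integral>\<^sup>+s. indicator (?S n) s \<partial>lborel) \<partial>count_space N)"
    using S by (intro nn_integral_cong) auto
  also have "\<dots> = (\<integral>\<^sup>+s. (\<integral>\<^sup>+n. indicator (?S n) s \<partial>count_space N) \<partial>lborel)"
    using N.Fubini'[of "\<lambda>n s. indicator (?S n) s"] S
    by (subst N.Fubini') (auto intro!: measurable_pair_measure_countable1)
  also have "\<dots> \<le> (\<integral>\<^sup>+s. (\<integral>\<^sup>+i. indicator {0<..B i} s \<partial>count_space UNIV) \<partial>lborel)"
  proof (rule nn_integral_mono)
    fix s :: real
    show "(\<integral>\<^sup>+n. indicator (?S n) s \<partial>count_space N) \<le> (\<integral>\<^sup>+i. indicator {0<..B i} s \<partial>count_space UNIV)"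
    proof (cases "0 < s")
      case True
      have "(\<integral>\<^sup>+n. indicator (?S n) s \<partial>count_space N) =
          (\<integral>\<^sup>+n. indicator {n\<in>N. ennreal s < A n} n \<partial>count_space N)"
        using True by (intro nn_integral_cong) (auto split: split_indicator)
      also have "\<dots> = emeasure (count_space N) {n\<in>N. ennreal s < A n}" by (rule nn_integral_indicator) auto
      also have "\<dots> \<le> emeasure (count_space UNIV) {i. s \<le> B i}" by (rule le[OF True])
      also have "\<dots> = (\<integral>\<^sup>+i. indicator {i. s \<le> B i} i \<partial>count_space UNIV)" by (rule nn_integral_indicator[symmetric]) auto
      also have "\<dots> = (\<integral>\<^sup>+i. indicator {0<..B i} s \<partial>count_space UNIV)"
        using True by (intro nn_integral_cong) (auto split: split_indicator)
      finally show ?thesis .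
    qed simp
  qed
  also have "\<dots> = (\<integral>\<^sup>+i. (\<integral>\<^sup>+s. indicator {0<..B i} s \<partial>lborel) \<partial>count_space UNIV)"
    by (rule I.Fubini') (auto intro!: measurable_pair_measure_countable1)
  also have "\<dots> = (\<integral>\<^sup>+i. ennreal (B i) \<partial>count_space UNIV)"
    using B by (intro nn_integral_cong) simp
  finally show ?thesis .
qed

section \<open>Powers of extended reals, and a zeta value\<close>

lemma ennpowr_mono: "0 \<le> r \<Longrightarrow> x \<le> y \<Longrightarrow> ennpowr x r \<le> ennpowr y r"
  by (auto simp: ennpowr_def top_unique less_top[symmetric] intro!: ennreal_leI powr_mono2 enn2real_mono)

lemma ennpowr_ennreal: "0 \<le> x \<Longrightarrow> ennpowr (ennreal x) r = ennreal (x powr r)"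
  by (simp add: ennpowr_def)

lemma ennpowr_mult:
  assumes "0 < c" "0 < r"
  shows "ennpowr (ennreal c * x) r = ennreal (c powr r) * ennpowr x r"
  using assms
  by (cases x) (auto simp: ennpowr_def ennreal_mult_top ennreal_mult[symmetric] powr_mult)

text \<open>The Riemann zeta function at \<open>r\<close>.\<close>

definition tail_sum :: "real \<Rightarrow> real" where
  "tail_sum r = (\<Sum>j. real (Suc j) powr (- r))"

lemma tail_sum:
  assumes "1 < r"
  shows "(\<Sum>j. ennreal (real (Suc j) powr (- r))) = ennreal (tail_sum r)" "0 < tail_sum r"
proof -
  have "summable (\<lambda>j. real j powr (- r))" using assms by (subst summable_real_powr_iff) simp
  then have s: "summable (\<lambda>j. real (Suc j) powr (- r))" by (subst summable_Suc_iff)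
  then show "(\<Sum>j. ennreal (real (Suc j) powr (- r))) = ennreal (tail_sum r)"
    unfolding tail_sum_def by (intro suminf_ennreal2) auto
  show "0 < tail_sum r" unfolding tail_sum_def by (rule suminf_pos[OF s]) auto
qed

context hardy_order
begin

lemma approx_num_sum:
  assumes q: "p < q"
  shows "(\<integral>\<^sup>+n. ennpowr (approx_num M p op n) q \<partial>count_space {1..}) \<le>
    ennreal ((path_const p * level_const) powr (q / p) * tail_sum (q / p)) *
      (\<integral>\<^sup>+k. ennreal (level_weight k powr (q / p)) \<partial>count_space UNIV)"
proof -
  define c where "c = path_const p * level_const"
  have c: "0 < c" using path_const_pos[of p] level_const_pos by (simp add: c_def)
  have q0: "0 < q" "1 < q / p" using p q by (auto simp: field_simps)
  define B where "B = (\<lambda>(k, j). (c * level_weight k / real (Suc j)) powr (q / p))"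
  have "(\<integral>\<^sup>+n. ennpowr (approx_num M p op n) q \<partial>count_space {1..}) \<le>
      (\<integral>\<^sup>+i. ennreal (B i) \<partial>count_space UNIV)"
  proof (rule nn_integral_count_space_mono_counts)
    show "0 \<le> B i" for i by (simp add: B_def case_prod_beta')
    fix s :: real assume s: "0 < s"
    \<comment> \<open>Chosen so that \<open>c * \<delta>\<close> is s^(p/q). Then
      \<open>s \<le> B (k, j)\<close> says exactly that (k, j) is in
      \<open>root_indices \<delta>\<close>, and the bound (c \<delta>)^(1/p) on the later
      approximation numbers has q-th power \<open>s\<close>.\<close>
    define \<delta> where "\<delta> = s powr (p / q) / c"
    have \<delta>: "0 < \<delta>" using s c by (simp add: \<delta>_def)
    have "s \<le> B (k, j) \<longleftrightarrow> (k, j) \<in> root_indices \<delta>" for k j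
    proof -
      let ?y = "c * level_weight k / real (Suc j)"
      have y: "0 \<le> ?y" using c level_weight_nonneg[of k] by simp
      have "s = (s powr (p / q)) powr (q / p)" using s p q0 by (simp add: powr_powr)
      then have "s \<le> B (k, j) \<longleftrightarrow> (s powr (p / q)) powr (q / p) \<le> ?y powr (q / p)"
        by (simp add: B_def)
      also have "\<dots> \<longleftrightarrow> s powr (p / q) \<le> ?y"
        using y q0 powr_mono2[of "q / p" "s powr (p / q)" ?y] powr_less_mono2[of "q / p" ?y "s powr (p / q)"]
        by (meson less_le_not_le linorder_not_le order_less_imp_le powr_ge_zero zero_less_one order_less_trans)
      also have "\<dots> \<longleftrightarrow> (k, j) \<in> root_indices \<delta>"
        using c by (simp add: root_indices_def \<delta>_def field_simps)
      finally show ?thesis .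
    qed
    then have J: "{i. s \<le> B i} = root_indices \<delta>" by auto
    show "emeasure (count_space {1..}) {n\<in>{1..}. ennreal s < ennpowr (approx_num M p op n) q} \<le>
        emeasure (count_space UNIV) {i. s \<le> B i}"
    proof (cases "finite (root_indices \<delta>)")
      case True
      have "{n\<in>{1..}. ennreal s < ennpowr (approx_num M p op n) q} \<subseteq> {1..card (root_indices \<delta>)}"
      proof safe
        fix n :: nat assume n: "ennreal s < ennpowr (approx_num M p op n) q" "1 \<le> n"
        show "n \<in> {1..card (root_indices \<delta>)}"
        proof (rule ccontr)
          assume "n \<notin> {1..card (root_indices \<delta>)}"
          then have "approx_num M p op n \<le> ennreal ((path_const p * level_const * \<delta>) powr (1 / p))"
            using n(2) by (intro approx_num_bound[OF \<delta> True]) auto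
          also have "path_const p * level_const * \<delta> = s powr (p / q)" using c by (simp add: \<delta>_def c_def[symmetric])
          finally have "ennpowr (approx_num M p op n) q \<le> ennpowr (ennreal ((s powr (p / q)) powr (1 / p))) q"
            using q0 by (intro ennpowr_mono) auto
          also have "\<dots> = ennreal s" using s p q0 by (simp add: ennpowr_ennreal powr_powr)
          finally show False using n(1) by simp
        qed
      qed
      then have "emeasure (count_space {1..}) {n\<in>{1..}. ennreal s < ennpowr (approx_num M p op n) q} \<le>
          emeasure (count_space {1..}) {1..card (root_indices \<delta>)}"
        by (intro emeasure_mono) auto
      also have "\<dots> = emeasure (count_space UNIV) (root_indices \<delta>)"
        using True by (simp add: emeasure_count_space)
      finally show ?thesis unfolding J .
    next
      \<comment> \<open>With infinitely many indices the count on the right is infinite.\<close>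
      case False
      then show ?thesis unfolding J by (simp add: emeasure_count_space)
    qed
  qed
  also have "\<dots> = (\<integral>\<^sup>+k. (\<integral>\<^sup>+j. ennreal (B (k, j)) \<partial>count_space UNIV) \<partial>count_space UNIV)"
    by (rule nn_integral_fst_count_space[symmetric])
  also have "\<dots> = (\<integral>\<^sup>+k. ennreal (c powr (q / p) * tail_sum (q / p)) * ennreal (level_weight k powr (q / p)) \<partial>count_space UNIV)"
  proof (rule nn_integral_cong)
    fix k
    have "(\<integral>\<^sup>+j. ennreal (B (k, j)) \<partial>count_space UNIV) =
        (\<Sum>j. ennreal ((c * level_weight k) powr (q / p)) * ennreal (real (Suc j) powr (- (q / p))))"
      unfolding nn_integral_count_space_nat
      using c level_weight_nonneg[of k]
      by (intro arg_cong[where f = suminf] ext)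
        (simp add: B_def powr_divide powr_minus_divide ennreal_mult[symmetric])
    also have "\<dots> = ennreal ((c * level_weight k) powr (q / p)) * ennreal (tail_sum (q / p))"
      using tail_sum(1)[OF q0(2)] by (simp only: ennreal_suminf_cmult)
    also have "\<dots> = ennreal (c powr (q / p) * tail_sum (q / p)) * ennreal (level_weight k powr (q / p))"
      using c level_weight_nonneg[of k] tail_sum(2)[OF q0(2)]
      by (simp add: ennreal_mult[symmetric] powr_mult mult_ac)
    finally show "(\<integral>\<^sup>+j. ennreal (B (k, j)) \<partial>count_space UNIV) =
        ennreal (c powr (q / p) * tail_sum (q / p)) * ennreal (level_weight k powr (q / p))" .
  qed
  also have "\<dots> = ennreal (c powr (q / p) * tail_sum (q / p)) *
      (\<integral>\<^sup>+k. ennreal (level_weight k powr (q / p)) \<partial>count_space UNIV)"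
    by (rule nn_integral_cmult) simp
  finally show ?thesis by (simp add: c_def)
qed

end

section \<open>The Hardy operator on a tree\<close>

lemma (in mtree) path_order_tree:
  assumes a: "a \<in> points \<Gamma>"
  shows "path_order (tleb \<Gamma>) (tpath \<Gamma> a) (tdist \<Gamma> a) rational_points"
proof -
  have P: "tpath \<Gamma> a x = btw a x" if "x \<in> points \<Gamma>" for x by (rule tpath_eq[OF a that])
  have in_points: "t \<in> points \<Gamma>" if "t \<in> btw a x" for t x using that by (simp add: btw_def)
  show ?thesis
    unfolding path_order_def path_order_axioms_def space_tleb
  proof (intro conjI allI impI)
    show "sigma_finite_measure (tleb \<Gamma>)" by (rule sigma_finite_tleb)
    show "tpath \<Gamma> a x \<in> sets (tleb \<Gamma>)" if "x \<in> points \<Gamma>" for x using P[OF that] btw_sets by simp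
    show "x \<in> tpath \<Gamma> a x" if "x \<in> points \<Gamma>" for x using P[OF that] ends_in_btw(2)[OF that] by simp
    show "tpath \<Gamma> a t \<subseteq> tpath \<Gamma> a x" if "x \<in> points \<Gamma>" "t \<in> tpath \<Gamma> a x" for x t
      using that P in_points btw_trans by simp
    show "s \<in> tpath \<Gamma> a t \<or> t \<in> tpath \<Gamma> a s"
      if "x \<in> points \<Gamma>" "s \<in> tpath \<Gamma> a x" "t \<in> tpath \<Gamma> a x" for x s t
      using that P in_points btw_chain[OF a, of x s t] by simp
    show "tdist \<Gamma> a t < tdist \<Gamma> a x" if x: "x \<in> points \<Gamma>" and t: "t \<in> tpath \<Gamma> a x" "t \<noteq> x" for x t
    proof -
      have tX: "t \<in> points \<Gamma>" "t \<in> btw a x" using t P[OF x] in_points by auto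
      then show ?thesis
        using cdist_btw[OF a x tX(2)] cdist_pos[OF tX(1) x t(2)] tdist_eq[OF a x] tdist_eq[OF a tX(1)] by simp
    qed
    show "{x \<in> points \<Gamma>. t \<in> tpath \<Gamma> a x} \<in> sets (tleb \<Gamma>)" if "t \<in> points \<Gamma>" for t
    proof -
      have "{x \<in> points \<Gamma>. t \<in> tpath \<Gamma> a x} = {x \<in> points \<Gamma>. t \<in> btw a x}" using P by auto
      then show ?thesis using cone_sets[OF that] by simp
    qed
    show "countable rational_points" by (rule countable_rational_points)
    show "rational_points \<subseteq> points \<Gamma>" by (rule rational_points_subset)
    show "\<exists>q\<in>rational_points. t \<in> tpath \<Gamma> a q \<and> q \<in> tpath \<Gamma> a x"
      if x: "x \<in> points \<Gamma>" and t: "t \<in> tpath \<Gamma> a x" "t \<noteq> x" for x t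
    proof -
      obtain q where q: "q \<in> rational_points" "t \<in> btw a q" "q \<in> btw a x"
        using rational_points_dense[OF x _ t(2), of a] t(1) P[OF x] by auto
      then show ?thesis using P[OF x] P[of q] in_points by auto
    qed
    show "{x} \<in> null_sets (tleb \<Gamma>)" if "x \<in> points \<Gamma>" for x by (rule singleton_null[OF that])
  qed
qed

lemma (in mtree) hardy_order_tree:
  fixes u v :: "'a \<Rightarrow> 'k::{real_normed_field, banach, second_countable_topology}"
  assumes a: "a \<in> points \<Gamma>" and p: "1 < p"
    and u: "u \<in> borel_measurable (tleb \<Gamma>)"
      "\<forall>K\<in>sets (tleb \<Gamma>). relatively_compact \<Gamma> K \<longrightarrow> u \<in> Lp (restrict_space (tleb \<Gamma>) K) (conj_exp p)"
    and v: "v \<in> Lp (tleb \<Gamma>) p"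
  shows "hardy_order (tleb \<Gamma>) (tpath \<Gamma> a) (tdist \<Gamma> a) rational_points p u v"
proof -
  have "set_integrable (tleb \<Gamma>) (tpath \<Gamma> a x) (\<lambda>t. norm (u t) powr conj_exp p)" if x: "x \<in> points \<Gamma>" for x
  proof -
    have "u \<in> Lp (restrict_space (tleb \<Gamma>) (btw a x)) (conj_exp p)"
      using u(2) btw_sets relatively_compact_btw[OF a x] by blast
    then show ?thesis
      unfolding tpath_eq[OF a x] set_integrable_def Lp_def
      using sets.Int[OF btw_sets[of a x] sets.top]
      by (subst (asm) integrable_restrict_space) (auto simp: integrable_restrict_space)
  qed
  then show ?thesis
    using path_order_tree[OF a] p u(1) v by (simp add: hardy_order_def hardy_order_axioms_def)
qed

section \<open>Comparison of the levels with the sequence sigma\<close>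

context
  fixes \<Gamma> :: "('a, 'e) metric_graph"
    and u v :: "'a \<Rightarrow> 'k::{real_normed_field, banach, second_countable_topology}" and a :: 'a and p :: real
  assumes tree: "is_tree \<Gamma>"
    and p: "1 < p"
    and u: "u \<in> borel_measurable (tleb \<Gamma>)"
      "\<forall>K\<in>sets (tleb \<Gamma>). relatively_compact \<Gamma> K \<longrightarrow> u \<in> Lp (restrict_space (tleb \<Gamma>) K) (conj_exp p)"
    and v: "v \<in> Lp (tleb \<Gamma>) p"
    and a: "a \<in> points \<Gamma>"
begin

interpretation mtree \<Gamma> by (rule mtree.intro[OF tree])

interpretation H: hardy_order "tleb \<Gamma>" "tpath \<Gamma> a" "tdist \<Gamma> a" rational_points p u v
  by (rule hardy_order_tree[OF a p u v])

lemma mass_eq_U: "H.mass = U \<Gamma> p u a"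
  by (rule ext) (simp add: H.mass_def U_def)

lemma op_eq_hardy: "H.op = hardy \<Gamma> u v a"
  by (intro ext) (simp add: H.op_def hardy_def)

text \<open>Since p'/p = 1/(p - 1), the thresholds for U in the definition of \<open>Z\<close> are
  the thresholds 2^k for its power p - 1.\<close>

lemma powr_le_powr_iff_conj:
  assumes "0 \<le> (y::real)"
  shows "2 powr (r * conj_exp p / p) \<le> y \<longleftrightarrow> 2 powr r \<le> y powr (p - 1)"
proof -
  have e: "r * conj_exp p / p = r / (p - 1)" using p by (simp add: conj_exp_def field_simps)
  have r: "2 powr r = (2 powr (r / (p - 1))) powr (p - 1)" using p by (simp add: powr_powr)
  have "(2 powr (r / (p - 1))) powr (p - 1) \<le> y powr (p - 1) \<longleftrightarrow> 2 powr (r / (p - 1)) \<le> y"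
    using p assms powr_mono2[of "p - 1" "2 powr (r / (p - 1))" y]
      powr_less_mono2[of "p - 1" y "2 powr (r / (p - 1))"] by fastforce
  then show ?thesis unfolding e using r by simp
qed

lemma level_subset_Z: "H.level k \<subseteq> Z \<Gamma> p u a k"
proof -
  have "H.level k \<subseteq> {x \<in> points \<Gamma>. 2 powr (of_int k * conj_exp p / p) \<le> U \<Gamma> p u a x \<and>
                   U \<Gamma> p u a x < 2 powr (of_int (k + 1) * conj_exp p / p)}"
  proof
    fix x assume x: "x \<in> H.level k"
    show "x \<in> {x \<in> points \<Gamma>. 2 powr (of_int k * conj_exp p / p) \<le> U \<Gamma> p u a x \<and>
                   U \<Gamma> p u a x < 2 powr (of_int (k + 1) * conj_exp p / p)}"
      using x powr_le_powr_iff_conj[OF H.mass_nonneg, of "of_int k" x]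
        powr_le_powr_iff_conj[OF H.mass_nonneg, of "of_int (k + 1)" x]
      by (simp add: H.level_def mass_eq_U not_le[symmetric])
  qed
  also have "\<dots> \<subseteq> Z \<Gamma> p u a k"
    unfolding Z_def by (rule closure_of_subset) (auto simp: ttopology_def)
  finally show ?thesis .
qed

text \<open>For inadmissible \<open>k\<close> the sequence sigma is 0 by definition, so the level
  must carry no mass. Indeed U is at most the p'-th power of the norm of \<open>u\<close>, whose
  power p - 1 is the p-th power of that norm.\<close>

lemma level_empty:
  assumes "\<not> admissible \<Gamma> p u k" shows "H.level k = {}"
proof (rule ccontr)
  assume "H.level k \<noteq> {}"
  then obtain x where x: "x \<in> points \<Gamma>" "2 powr k \<le> H.mass x powr (p - 1)" by (auto simp: H.level_def)
  have uL: "u \<in> Lp (tleb \<Gamma>) (conj_exp p)" and less: "Lp_norm (tleb \<Gamma>) (conj_exp p) u powr p < 2 powr k"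
    using assms by (auto simp: admissible_def)
  let ?I = "LINT t|tleb \<Gamma>. norm (u t) powr conj_exp p"
  have "H.mass x \<le> ?I"
    unfolding H.mass_def set_lebesgue_integral_def
    using uL H.u_integrable[of x] x(1) unfolding set_integrable_def
    by (intro integral_mono) (auto simp: Lp_def split: split_indicator)
  then have "2 powr k \<le> ?I powr (p - 1)"
    using x(2) p H.mass_nonneg[of x] by (smt (verit) powr_mono2)
  also have "?I powr (p - 1) = Lp_norm (tleb \<Gamma>) (conj_exp p) u powr p"
    using divide_conj_exp[OF p] by (simp add: Lp_norm_def powr_powr)
  finally show False using less by simp
qed

text \<open>In general only an inequality: the closure \<open>Z\<close> can carry more of the mass
  of \<open>v\<close> than the level itself.\<close>

lemma level_weight_le_sigma: "H.level_weight k \<le> sigma_seq \<Gamma> p u v a k powr p"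
proof (cases "admissible \<Gamma> p u k")
  case True
  have Zs: "Z \<Gamma> p u a k \<in> sets (tleb \<Gamma>)"
    unfolding Z_def by (rule closedin_sets_tleb) simp
  have v': "integrable (tleb \<Gamma>) (\<lambda>x. norm (v x) powr p)" using v by (simp add: Lp_def)
  have "(LINT x:H.level k|tleb \<Gamma>. norm (v x) powr p) \<le> mu \<Gamma> p v (Z \<Gamma> p u a k)"
    unfolding mu_def set_lebesgue_integral_def
  proof (rule integral_mono)
    show "integrable (tleb \<Gamma>) (\<lambda>x. indicat_real (H.level k) x *\<^sub>R norm (v x) powr p)"
      by (rule integrable_mult_indicator[OF H.level_sets v'])
    show "integrable (tleb \<Gamma>) (\<lambda>x. indicat_real (Z \<Gamma> p u a k) x *\<^sub>R norm (v x) powr p)"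
      by (rule integrable_mult_indicator[OF Zs v'])
  qed (use level_subset_Z in \<open>auto split: split_indicator\<close>)
  then have le: "H.level_weight k \<le> 2 powr k * mu \<Gamma> p v (Z \<Gamma> p u a k)"
    by (simp add: H.level_weight_def)
  then have "0 \<le> 2 powr k * mu \<Gamma> p v (Z \<Gamma> p u a k)" using H.level_weight_nonneg[of k] by linarith
  then show ?thesis using le True p by (simp add: sigma_seq_def powr_powr)
next
  case False
  then show ?thesis using level_empty by (simp add: H.level_weight_def set_lebesgue_integral_def)
qed

lemma approx_num_lq_bound:
  assumes q: "p < q"
  shows "lq_norm q {1..} (approx_num (tleb \<Gamma>) p (hardy \<Gamma> u v a)) \<le>
    ennreal (((path_const p * level_const) powr (q / p) * tail_sum (q / p)) powr (1 / q)) *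
      lq_norm q UNIV (\<lambda>k. ennreal (sigma_seq \<Gamma> p u v a k))"
proof -
  have q0: "0 < q" "1 < q / p" using p q by (auto simp: field_simps)
  let ?K = "(path_const p * level_const) powr (q / p) * tail_sum (q / p)"
  have K: "0 < ?K" using path_const_pos[of p] level_const_pos tail_sum(2)[OF q0(2)] by simp
  have "(\<integral>\<^sup>+n. ennpowr (approx_num (tleb \<Gamma>) p (hardy \<Gamma> u v a) n) q \<partial>count_space {1..}) \<le>
      ennreal ?K * (\<integral>\<^sup>+k. ennreal (H.level_weight k powr (q / p)) \<partial>count_space UNIV)"
    using H.approx_num_sum[OF q] by (simp add: op_eq_hardy)
  also have "\<dots> \<le> ennreal ?K * (\<integral>\<^sup>+k. ennpowr (ennreal (sigma_seq \<Gamma> p u v a k)) q \<partial>count_space UNIV)"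
  proof (intro mult_left_mono nn_integral_mono)
    fix k
    have s: "0 \<le> sigma_seq \<Gamma> p u v a k" by (simp add: sigma_seq_def)
    have "H.level_weight k powr (q / p) \<le> (sigma_seq \<Gamma> p u v a k powr p) powr (q / p)"
      using level_weight_le_sigma H.level_weight_nonneg q0 by (intro powr_mono2) auto
    also have "\<dots> = sigma_seq \<Gamma> p u v a k powr q" using p by (simp add: powr_powr)
    finally show "ennreal (H.level_weight k powr (q / p)) \<le> ennpowr (ennreal (sigma_seq \<Gamma> p u v a k)) q"
      using s by (simp add: ennpowr_ennreal ennreal_leI)
  qed simp
  finally have "lq_norm q {1..} (approx_num (tleb \<Gamma>) p (hardy \<Gamma> u v a)) \<le>
      ennpowr (ennreal ?K * (\<integral>\<^sup>+k. ennpowr (ennreal (sigma_seq \<Gamma> p u v a k)) q \<partial>count_space UNIV)) (1 / q)"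
    unfolding lq_norm_def using q0 by (intro ennpowr_mono) auto
  also have "\<dots> = ennreal (?K powr (1 / q)) * lq_norm q UNIV (\<lambda>k. ennreal (sigma_seq \<Gamma> p u v a k))"
    unfolding lq_norm_def using K q0 by (intro ennpowr_mult) auto
  finally show ?thesis .
qed

end

theorem theorem6p6:
  fixes p q :: real
  assumes "1 < p" and "p < q"
  shows "\<exists>c::real. 0 < c \<and>
    (\<forall>(\<Gamma> :: ('a, 'e) metric_graph)
      (u :: 'a \<Rightarrow> 'k::{real_normed_field, banach, second_countable_topology}) (v :: 'a \<Rightarrow> 'k) (a :: 'a).
      is_tree \<Gamma> \<longrightarrow>
      u \<in> borel_measurable (tleb \<Gamma>) \<longrightarrow>
      (\<forall>K\<in>sets (tleb \<Gamma>). relatively_compact \<Gamma> K \<longrightarrow>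
         u \<in> Lp (restrict_space (tleb \<Gamma>) K) (conj_exp p)) \<longrightarrow>
      v \<in> Lp (tleb \<Gamma>) p \<longrightarrow>
      a \<in> points \<Gamma> \<longrightarrow>
      lq_norm q {1..} (approx_num (tleb \<Gamma>) p (hardy \<Gamma> u v a))
        \<le> ennreal c * lq_norm q UNIV (\<lambda>k. ennreal (sigma_seq \<Gamma> p u v a k)))"
proof (intro exI conjI allI impI)
  have "1 < q / p" using assms by (simp add: field_simps)
  \<comment> \<open>The constant is built from \<open>p\<close> and \<open>q\<close> alone, so one
    witness serves all trees, weights and base points.\<close>
  then show "0 < ((path_const p * level_const) powr (q / p) * tail_sum (q / p)) powr (1 / q)"
    using path_const_pos[of p] level_const_pos tail_sum(2)[of "q / p"] by simp
qed (rule approx_num_lq_bound; (assumption | rule assms))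

end
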